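(* Work in two space dimensions, with a kernel $\mathsf J=\mathsf J_c-\mathsf J_e$ and constants $\gamma_c,\gamma_e\ge 0$ satisfying the assumptions (A1)–(A3) and $\gamma_0>0$ stated in the context. Put $B_c=[J_c\star\mathbf 1]+\gamma_c$ and $B_e=[J_e\star\mathbf 1]+\gamma_e$, and assume that $B_c-3B_e=\alpha_0>0$ for some $\alpha_0$ independent of $h$, provided $h$ is sufficiently small. Let smooth, $\Omega$-periodic initial data $\Phi(\cdot,\cdot,0)$ be given, and suppose that $\Phi(x_1,x_2,t)$ is the unique, smooth, $\Omega$-periodic solution on $\Omega$ for $0\le t\le T$, for some $T<\infty$, of the nonlocal Cahn–Hilliard equation $$\partial_t\Phi=\Delta\big(\Phi^3+\gamma_c\Phi-\gamma_e\Phi+(\mathsf J*1)\Phi-\mathsf J*\Phi\big).$$ Set $\Phi^k_{i,j}:=\Phi(p_i,p_j,ks)$. Let $\phi^k\in\mathcal C_{m\times n}$ be the $k$-th periodic solution of the fully discrete nCH scheme defined in the context with time step $s$, grid size $h$ and starting value $\phi^0_{i,j}:=\Phi^0_{i,j}$. Put $e^k_{i,j}:=\Phi^k_{i,j}-\phi^k_{i,j}$. Let $C_*>0$ be any fixed constant. Then there exist $s_0,h_0>0$ and a constant $C>0$, with $C$ independent of $h$ and $s$, such that whenever $0<s\le s_0$, $0<h\le h_0$ and $s\le C_* h$, $$\|e^l\|_\infty\le C\,(h^2+s^2)$$ for all positive integers $l$ such that $l\,s\le T$.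
   Context: Continuous setting: $\Omega=(0,L_1)\times(0,L_2)$; $C^\infty_{\rm per}(\Omega)$ is the set of smooth $\Omega$-periodic functions on $\mathbb R^2$. The kernel is $\mathsf J=\mathsf J_c-\mathsf J_e$ where: (A1) $\mathsf J_c,\mathsf J_e\in C^\infty_{\rm per}(\Omega)$ are non-negative; (A2) $\mathsf J_c,\mathsf J_e$ are even, $\mathsf J_\alpha(-x_1,-x_2)=\mathsf J_\alpha(x_1,x_2)$; (A3) $\int_\Omega\mathsf J\,d\mathbf x>0$. Periodic convolution: $(\mathsf J*\phi)(\mathbf x)=\int_\Omega\mathsf J(\mathbf y)\phi(\mathbf x-\mathbf y)\,d\mathbf y$; in particular $\mathsf J*1=\int_\Omega \mathsf J\,d\mathbf x$. Constants $\gamma_c,\gamma_e\ge0$ satisfy $\gamma_0:=\gamma_c-\gamma_e+\mathsf J*1>0$. Grid: $h>0$ with $L_1=m h$, $L_2=n h$, $m,n$ positive integers; $p_r:=(r-\tfrac12)h$ for integer or half-integer $r$. $\mathcal C_{m\times n}$ is the space of cell-centered grid functions $\phi_{i,j}=\phi(p_i,p_j)$, $1\le i\le m$, $1\le j\le n$; periodic ones are extended by $\phi_{i+am,j+bn}=\phi_{i,j}$, $a,b\in\mathbb Z$. $\|\phi\|_\infty=\max_{i,j}|\phi_{i,j}|$. $\Delta_h$ is the standard five-point discrete Laplacian, $(\Delta_h\phi)_{i,j}=h^{-2}(\phi_{i+1,j}+\phi_{i-1,j}+\phi_{i,j+1}+\phi_{i,j-1}-4\phi_{i,j})$. For a vertex-centered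 periodic grid function $f_{k+\frac12,l+\frac12}=f(p_{k+\frac12},p_{l+\frac12})$ and periodic $\phi\in\mathcal C_{m\times n}$, the discrete convolution is $[f\star\phi]_{i,j}=h^2\sum_{k=1}^m\sum_{l=1}^n f_{k+\frac12,l+\frac12}\,\phi_{i-k,j-l}$. $J_c,J_e$ denote the vertex-centered grid restrictions $(J_\alpha)_{i+\frac12,j+\frac12}=\mathsf J_\alpha(p_{i+\frac12},p_{j+\frac12})$, $J=J_c-J_e$, and $\mathbf 1$ is the constant grid function 1 (so $[J_\alpha\star\mathbf 1]$ is a constant). Fully discrete nCH scheme with time step $s>0$: given periodic $\phi^{k-1},\phi^k\in\mathcal C_{m\times n}$, $k\ge0$, with the convention $\phi^{-1}:=\phi^0$, find periodic $\phi^{k+1}\in\mathcal C_{m\times n}$ (it exists and is unique) such that $$\phi^{k+1}-\phi^k=s\,\Delta_h w^{k+1/2},$$ $$w^{k+1/2}=\eta(\phi^k,\phi^{k+1})+([J_c\star\mathbf 1]+\gamma_c)\phi^{k+1/2}-([J_e\star\mathbf 1]+\gamma_e)\hat\phi^{k+1/2}-[J\star\hat\phi^{k+1/2}],$$ where $\eta(\phi^k,\phi^{k+1})=\tfrac14\big((\phi^k)^2+(\phi^{k+1})^2\big)(\phi^k+\phi^{k+1})$, $\phi^{k+1/2}=\tfrac12(\phi^k+\phi^{k+1})$, $\hat\phi^{k+1/2}=\tfrac32\phi^k-\tfrac12\phi^{k-1}$. *)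

theory Defs
  imports "HOL-Analysis.Analysis"
begin

text \<open>
  \<open>C\<^sup>k\<close> functions on a set \<open>S\<close>, with derivatives taken relative to \<open>S\<close>.  In finite dimension,
  continuity of all directional derivatives \<open>\<lambda>x. f' x v\<close> is continuity of the derivative.
  It is used only for the whole space and for slabs \<open>\<real>\<^sup>2 \<times> [0,T]\<close> with \<open>T > 0\<close>, where derivatives
  relative to \<open>S\<close> are unique and smoothness includes the boundary times \<open>0\<close> and \<open>T\<close>.
\<close>

primrec Ck_on :: "nat \<Rightarrow> 'a::real_normed_vector set \<Rightarrow> ('a \<Rightarrow> 'b::real_normed_vector) \<Rightarrow> bool" where
  "Ck_on 0 S f \<longleftrightarrow> continuous_on S f"
| "Ck_on (Suc k) S f \<longleftrightarrow>
     (\<exists>f'. (\<forall>x\<in>S. (f has_derivative f' x) (at x within S)) \<and> (\<forall>v. Ck_on k S (\<lambda>x. f' x v)))"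

definition smooth_on :: "'a::real_normed_vector set \<Rightarrow> ('a \<Rightarrow> 'b::real_normed_vector) \<Rightarrow> bool" where
  "smooth_on S f \<longleftrightarrow> (\<forall>k. Ck_on k S f)"

definition Omega :: "real \<Rightarrow> real \<Rightarrow> (real \<times> real) set" where
  "Omega L1 L2 = {0<..<L1} \<times> {0<..<L2}"

definition periodic2 :: "real \<Rightarrow> real \<Rightarrow> (real \<times> real \<Rightarrow> real) \<Rightarrow> bool" where
  "periodic2 L1 L2 f \<longleftrightarrow>
     (\<forall>x1 x2. f (x1 + L1, x2) = f (x1, x2) \<and> f (x1, x2 + L2) = f (x1, x2))"

definition smooth_per :: "real \<Rightarrow> real \<Rightarrow> (real \<times> real \<Rightarrow> real) \<Rightarrow> bool" where
  "smooth_per L1 L2 f \<longleftrightarrow> smooth_on UNIV f \<and> periodic2 L1 L2 f"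

definition pconv ::
  "real \<Rightarrow> real \<Rightarrow> (real \<times> real \<Rightarrow> real) \<Rightarrow> (real \<times> real \<Rightarrow> real) \<Rightarrow> real \<times> real \<Rightarrow> real" where
  "pconv L1 L2 f g x = integral (Omega L1 L2) (\<lambda>y. f y * g (x - y))"

definition laplacian :: "(real \<times> real \<Rightarrow> real) \<Rightarrow> real \<times> real \<Rightarrow> real" where
  "laplacian u x =
     (deriv ^^ 2) (\<lambda>a. u (a, snd x)) (fst x) + (deriv ^^ 2) (\<lambda>b. u (fst x, b)) (snd x)"

definition admissible_kernel ::
  "real \<Rightarrow> real \<Rightarrow> (real \<times> real \<Rightarrow> real) \<Rightarrow> (real \<times> real \<Rightarrow> real) \<Rightarrow> bool" where
  "admissible_kernel L1 L2 Jc Je \<longleftrightarrow>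
     smooth_per L1 L2 Jc \<and> smooth_per L1 L2 Je \<and>
     (\<forall>x. Jc x \<ge> 0) \<and> (\<forall>x. Je x \<ge> 0) \<and>
     (\<forall>x. Jc (- x) = Jc x) \<and> (\<forall>x. Je (- x) = Je x) \<and>
     integral (Omega L1 L2) (\<lambda>x. Jc x - Je x) > 0"

text \<open>
  The space derivatives at each time and the time derivative (one-sided at \<open>0\<close> and \<open>T\<close>) exist
  because \<open>\<Phi>\<close> is required to be smooth.  The values of \<open>\<Phi> x t\<close> for \<open>t\<close> outside \<open>[0,T]\<close> are
  irrelevant.  \<open>J * 1\<close> is the integral of \<open>J\<close>.
\<close>

definition nCH_solution ::
  "real \<Rightarrow> real \<Rightarrow> (real \<times> real \<Rightarrow> real) \<Rightarrow> real \<Rightarrow> real \<Rightarrow> real \<Rightarrow> (real \<times> real \<Rightarrow> real \<Rightarrow> real) \<Rightarrow> bool" where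
  "nCH_solution L1 L2 J \<gamma>c \<gamma>e T \<Phi> \<longleftrightarrow>
     smooth_on (UNIV \<times> {0..T}) (\<lambda>(x, t). \<Phi> x t) \<and>
     (\<forall>t\<in>{0..T}. periodic2 L1 L2 (\<lambda>x. \<Phi> x t)) \<and>
     (\<forall>x. \<forall>t\<in>{0..T}.
        (\<Phi> x has_real_derivative
           laplacian (\<lambda>y. \<Phi> y t ^ 3 + \<gamma>c * \<Phi> y t - \<gamma>e * \<Phi> y t
             + integral (Omega L1 L2) J * \<Phi> y t - pconv L1 L2 J (\<lambda>z. \<Phi> z t) y) x)
          (at t within {0..T}))"

definition unique_nCH_solution ::
  "real \<Rightarrow> real \<Rightarrow> (real \<times> real \<Rightarrow> real) \<Rightarrow> real \<Rightarrow> real \<Rightarrow> real \<Rightarrow> (real \<times> real \<Rightarrow> real \<Rightarrow> real) \<Rightarrow> bool" where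
  "unique_nCH_solution L1 L2 J \<gamma>c \<gamma>e T \<Phi> \<longleftrightarrow>
     nCH_solution L1 L2 J \<gamma>c \<gamma>e T \<Phi> \<and>
     (\<forall>\<Psi>. nCH_solution L1 L2 J \<gamma>c \<gamma>e T \<Psi> \<and> (\<forall>x. \<Psi> x 0 = \<Phi> x 0)
        \<longrightarrow> (\<forall>x. \<forall>t\<in>{0..T}. \<Psi> x t = \<Phi> x t))"

type_synonym grid_fun = "int \<Rightarrow> int \<Rightarrow> real"

definition uniform_grid :: "real \<Rightarrow> real \<Rightarrow> real \<Rightarrow> nat \<Rightarrow> nat \<Rightarrow> bool" where
  "uniform_grid L1 L2 h m n \<longleftrightarrow>
     0 < h \<and> 0 < m \<and> 0 < n \<and> L1 = real m * h \<and> L2 = real n * h"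

definition grid_pt :: "real \<Rightarrow> real \<Rightarrow> real" where
  "grid_pt h r = (r - 1/2) * h"

definition cell_restr :: "real \<Rightarrow> (real \<times> real \<Rightarrow> real) \<Rightarrow> grid_fun" where
  "cell_restr h f i j = f (grid_pt h (of_int i), grid_pt h (of_int j))"

text \<open>A vertex-centered grid function is indexed by \<open>(i, j)\<close> at the vertex \<open>(i + 1/2, j + 1/2)\<close>.\<close>

definition vertex_restr :: "real \<Rightarrow> (real \<times> real \<Rightarrow> real) \<Rightarrow> grid_fun" where
  "vertex_restr h f i j = f (grid_pt h (of_int i + 1/2), grid_pt h (of_int j + 1/2))"

definition grid_periodic :: "nat \<Rightarrow> nat \<Rightarrow> grid_fun \<Rightarrow> bool" where
  "grid_periodic m n \<phi> \<longleftrightarrow> (\<forall>i j a b. \<phi> (i + a * int m) (j + b * int n) = \<phi> i j)"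

definition grid_max_norm :: "nat \<Rightarrow> nat \<Rightarrow> grid_fun \<Rightarrow> real" where
  "grid_max_norm m n \<phi> = Max ((\<lambda>(i, j). \<bar>\<phi> i j\<bar>) ` ({1..int m} \<times> {1..int n}))"

definition dlaplacian :: "real \<Rightarrow> grid_fun \<Rightarrow> grid_fun" where
  "dlaplacian h \<phi> i j =
     (\<phi> (i + 1) j + \<phi> (i - 1) j + \<phi> i (j + 1) + \<phi> i (j - 1) - 4 * \<phi> i j) / h\<^sup>2"

definition dconv :: "nat \<Rightarrow> nat \<Rightarrow> real \<Rightarrow> grid_fun \<Rightarrow> grid_fun \<Rightarrow> grid_fun" where
  "dconv m n h f \<phi> i j = h\<^sup>2 * (\<Sum>k = 1..int m. \<Sum>l = 1..int n. f k l * \<phi> (i - k) (j - l))"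

text \<open>
  The constant value of the discrete convolution of \<open>f\<close> with the grid function \<open>1\<close>; the index
  \<open>(1, 1)\<close> is immaterial.
\<close>

definition dconv_one :: "nat \<Rightarrow> nat \<Rightarrow> real \<Rightarrow> grid_fun \<Rightarrow> real" where
  "dconv_one m n h f = dconv m n h f (\<lambda>_ _. 1) 1 1"

text \<open>\<open>B_coeff m n h K \<gamma>\<close> is \<open>B\<^sub>c\<close> for \<open>(K, \<gamma>) = (J\<^sub>c, \<gamma>\<^sub>c)\<close> and \<open>B\<^sub>e\<close> for \<open>(J\<^sub>e, \<gamma>\<^sub>e)\<close>.\<close>

definition B_coeff :: "nat \<Rightarrow> nat \<Rightarrow> real \<Rightarrow> (real \<times> real \<Rightarrow> real) \<Rightarrow> real \<Rightarrow> real" where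
  "B_coeff m n h K \<gamma> = dconv_one m n h (vertex_restr h K) + \<gamma>"

definition eta :: "real \<Rightarrow> real \<Rightarrow> real" where
  "eta a b = 1/4 * (a\<^sup>2 + b\<^sup>2) * (a + b)"

text \<open>
  The discrete chemical potential \<open>w\<^sup>k\<^sup>+\<^sup>1\<^sup>/\<^sup>2\<close>, with \<open>\<phi>p\<close>, \<open>\<phi>\<close>, \<open>\<phi>n\<close> standing for the time levels
  \<open>k - 1\<close>, \<open>k\<close>, \<open>k + 1\<close>.
\<close>

definition dpotential ::
  "nat \<Rightarrow> nat \<Rightarrow> real \<Rightarrow> (real \<times> real \<Rightarrow> real) \<Rightarrow> (real \<times> real \<Rightarrow> real) \<Rightarrow> real \<Rightarrow> real \<Rightarrow>
   grid_fun \<Rightarrow> grid_fun \<Rightarrow> grid_fun \<Rightarrow> grid_fun" where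
  "dpotential m n h Jc Je \<gamma>c \<gamma>e \<phi>p \<phi> \<phi>n i j =
     (let \<phi>half = (\<lambda>i j. 1/2 * (\<phi> i j + \<phi>n i j));
          \<phi>hat = (\<lambda>i j. 3/2 * \<phi> i j - 1/2 * \<phi>p i j);
          J = (\<lambda>i j. vertex_restr h Jc i j - vertex_restr h Je i j)
      in eta (\<phi> i j) (\<phi>n i j) + B_coeff m n h Jc \<gamma>c * \<phi>half i j
           - B_coeff m n h Je \<gamma>e * \<phi>hat i j - dconv m n h J \<phi>hat i j)"

definition nCH_scheme ::
  "nat \<Rightarrow> nat \<Rightarrow> real \<Rightarrow> real \<Rightarrow> (real \<times> real \<Rightarrow> real) \<Rightarrow> (real \<times> real \<Rightarrow> real) \<Rightarrow> real \<Rightarrow> real \<Rightarrow>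
   (nat \<Rightarrow> grid_fun) \<Rightarrow> bool" where
  "nCH_scheme m n h s Jc Je \<gamma>c \<gamma>e \<phi> \<longleftrightarrow>
     (\<forall>k. grid_periodic m n (\<phi> k)) \<and>
     (\<forall>k i j. \<phi> (Suc k) i j - \<phi> k i j =
        s * dlaplacian h
              (dpotential m n h Jc Je \<gamma>c \<gamma>e (if k = 0 then \<phi> 0 else \<phi> (k - 1)) (\<phi> k) (\<phi> (Suc k)))
              i j)"

end

theory Submission
  imports Defs
begin

text \<open>
  The error \<open>e\<^sup>k = \<Phi>\<^sup>k - \<phi>\<^sup>k\<close> is estimated in a discrete \<open>H\<^sup>2\<close> norm, which controls the maximum norm
  in two dimensions.  All differences of \<open>\<Phi>\<close> commute with the scheme, so the truncation error is
  \<open>O(s\<^sup>2 + h\<^sup>2)\<close> together with its second differences, except in the first step, where it is \<open>O(s + h\<^sup>2)\<close>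
  but enters \<open>e\<^sup>1\<close> with a factor \<open>s\<close>.  Testing the error equation with \<open>e\<^sup>k + e\<^sup>k\<^sup>+\<^sup>1\<close> makes the extrapolated
  concave term telescope, with a remainder that the convex term absorbs because \<open>B\<^sub>c > 3 B\<^sub>e\<close>.  If \<open>e = O(h)\<close> in the maximum norm, then the nonlinear
  terms, which lack one derivative, are recovered by the inverse inequality \<open>h |D u| \<le> 2 |u|\<close>, and
  so are the terms with a factor \<open>s \<le> C\<^sub>* h\<close>.

  The bound \<open>e\<^sup>k\<^sup>+\<^sup>1 = O(h)\<close> needed for the implicit step comes from a maximum principle: \<open>\<eta>\<close> is increasing in
  its second argument, so \<open>e\<^sup>k\<^sup>+\<^sup>1 - s \<Delta>\<^sub>h (\<mu> e\<^sup>k\<^sup>+\<^sup>1) = G\<close> with \<open>\<mu> \<ge> B\<^sub>c / 2\<close> and \<open>G = O(h)\<close>.  The constant in this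
  bound depends on the Gronwall constant; one energy step with it improves the bound to \<open>O(h\<^sup>2) \<le> h\<close>, and
  repeating the step with the bound \<open>h\<close> closes the induction with a constant independent of it.
\<close>

subsection \<open>Grid functions and their differences\<close>

text \<open>The test function controls the gradient of the mean of two error levels, but not the
  gradient of their increment. Expanding the cubic term about the mean isolates a part with a
  nonnegative coefficient, which stays on the good side. In what remains, the increment of the error
  occurs only next to the increment of \<open>\<Phi>\<close>, which is O(s) = O(h), or next to
  another error. These factors \<open>h\<close> are what the inverse inequality spends. The work is
  done in \<open>H\<^sup>2\<close> from the start: an \<open>L\<^sup>2\<close> bound of order
  \<open>h\<^sup>2\<close> followed by an inverse inequality would give only order \<open>h\<close>
  in the maximum norm. The energy step for the new level presupposes that this level is small, and a
  sequence of time levels offers no continuity argument by which smallness could persist. Hence the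
  separate bound for the implicit step, and hence two passes through the same energy
  estimate.\<close>

lemma sum_periodic_shift1:
  fixes f :: "int \<Rightarrow> real"
  assumes "\<And>i. f (i + int m) = f i"
  shows "(\<Sum>i=1..int m. f (i + 1)) = (\<Sum>i=1..int m. f i)"
proof -
  have "(\<Sum>i=1..int m. f (i + 1)) = (\<Sum>i=2..int m + 1. f i)"
    by (rule sum.reindex_bij_witness[where i="\<lambda>i. i - 1" and j="\<lambda>i. i + 1"]) auto
  moreover have "(\<Sum>i=1..int m + 1. f i) = f 1 + (\<Sum>i=2..int m + 1. f i)"
  proof -
    have "{1..int m + 1} = insert 1 {2..int m + 1}" by auto
    then show ?thesis by simp
  qed
  moreover have "(\<Sum>i=1..int m + 1. f i) = f (int m + 1) + (\<Sum>i=1..int m. f i)"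
  proof -
    have "{1..int m + 1} = insert (int m + 1) {1..int m}" by auto
    then show ?thesis by simp
  qed
  moreover have "f (int m + 1) = f 1" using assms[of 1] by (simp add: add.commute)
  ultimately show ?thesis by simp
qed

lemma sum_periodic_shift:
  fixes f :: "int \<Rightarrow> real"
  assumes per: "\<And>i. f (i + int m) = f i"
  shows "(\<Sum>i=1..int m. f (i + a)) = (\<Sum>i=1..int m. f i)"
proof (induction a rule: int_induct[where k=0])
  case base then show ?case by simp
next
  case (step1 a)
  have "(\<Sum>i=1..int m. f (i + 1 + a)) = (\<Sum>i=1..int m. f (i + a))"
    by (rule sum_periodic_shift1[where f="\<lambda>i. f (i + a)"])
      (metis per add.assoc add.commute)
  then show ?case using step1 by (simp add: algebra_simps)
next
  case (step2 a)
  have "(\<Sum>i=1..int m. f (i + 1 + (a - 1))) = (\<Sum>i=1..int m. f (i + (a - 1)))"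
    by (rule sum_periodic_shift1[where f="\<lambda>i. f (i + (a - 1))"])
      (metis per add.assoc add.commute)
  then show ?case using step2 by (simp add: algebra_simps)
qed

definition shift :: "int \<Rightarrow> int \<Rightarrow> grid_fun \<Rightarrow> grid_fun" where
  "shift a b u = (\<lambda>i j. u (i + a) (j + b))"

lemma shift_0 [simp]: "shift 0 0 u = u"
  by (simp add: shift_def)

lemma shift_shift [simp]: "shift a b (shift c d u) = shift (a + c) (b + d) u"
  by (simp add: shift_def algebra_simps)

text \<open>The direction \<open>True\<close> is the first coordinate.\<close>

definition fdiff :: "real \<Rightarrow> bool \<Rightarrow> grid_fun \<Rightarrow> grid_fun" where
  "fdiff h v u = (\<lambda>i j. (shift (of_bool v) (of_bool (\<not> v)) u i j - u i j) / h)"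

primrec fdiffs :: "real \<Rightarrow> bool list \<Rightarrow> grid_fun \<Rightarrow> grid_fun" where
  "fdiffs h [] u = u"
| "fdiffs h (v # vs) u = fdiff h v (fdiffs h vs u)"

lemma fdiff_add: "fdiff h v (\<lambda>i j. u i j + w i j) = (\<lambda>i j. fdiff h v u i j + fdiff h v w i j)"
  by (auto simp: fun_eq_iff fdiff_def shift_def diff_divide_distrib add_divide_distrib)

lemma fdiff_diff: "fdiff h v (\<lambda>i j. u i j - w i j) = (\<lambda>i j. fdiff h v u i j - fdiff h v w i j)"
  by (auto simp: fun_eq_iff fdiff_def shift_def diff_divide_distrib add_divide_distrib)

lemma fdiff_scale: "fdiff h v (\<lambda>i j. c * u i j) = (\<lambda>i j. c * fdiff h v u i j)"
  by (auto simp: fun_eq_iff fdiff_def shift_def diff_divide_distrib right_diff_distrib)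

lemma fdiff_mult:
  "fdiff h v (\<lambda>i j. u i j * w i j) =
     (\<lambda>i j. fdiff h v u i j * shift (of_bool v) (of_bool (\<not> v)) w i j + u i j * fdiff h v w i j)"
  by (auto simp: fun_eq_iff fdiff_def shift_def diff_divide_distrib add_divide_distrib algebra_simps)

lemma fdiff_shift: "fdiff h v (shift a b u) = shift a b (fdiff h v u)"
  by (auto simp: fun_eq_iff fdiff_def shift_def algebra_simps)

lemma fdiff_fdiff: "fdiff h v (fdiff h w u) = fdiff h w (fdiff h v u)"
  by (auto simp: fun_eq_iff fdiff_def shift_def diff_divide_distrib algebra_simps)

lemma fdiffs_add: "fdiffs h vs (\<lambda>i j. u i j + w i j) = (\<lambda>i j. fdiffs h vs u i j + fdiffs h vs w i j)"
  by (induction vs) (auto simp: fdiff_add)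

lemma fdiffs_diff: "fdiffs h vs (\<lambda>i j. u i j - w i j) = (\<lambda>i j. fdiffs h vs u i j - fdiffs h vs w i j)"
  by (induction vs) (auto simp: fdiff_diff)

lemma fdiffs_scale: "fdiffs h vs (\<lambda>i j. c * u i j) = (\<lambda>i j. c * fdiffs h vs u i j)"
  by (induction vs) (auto simp: fdiff_scale)

lemma fdiffs_shift: "fdiffs h vs (shift a b u) = shift a b (fdiffs h vs u)"
  by (induction vs) (auto simp: fdiff_shift)

lemma fdiffs_fdiff: "fdiffs h vs (fdiff h v u) = fdiff h v (fdiffs h vs u)"
  by (induction vs) (auto simp: fdiff_fdiff)

lemma dlaplacian_fdiff:
  "dlaplacian h u i j =
     (fdiff h True u i j - shift (-1) 0 (fdiff h True u) i j) / h +
     (fdiff h False u i j - shift 0 (-1) (fdiff h False u) i j) / h"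
  by (simp add: dlaplacian_def fdiff_def shift_def power2_eq_square
      diff_divide_distrib add_divide_distrib algebra_simps)

lemma dlaplacian_eq_fdiffs:
  "dlaplacian h u i j =
     shift (-1) 0 (fdiffs h [True, True] u) i j + shift 0 (-1) (fdiffs h [False, False] u) i j"
  by (simp add: dlaplacian_def fdiff_def shift_def power2_eq_square
      diff_divide_distrib add_divide_distrib algebra_simps)

lemma dlaplacian_add:
  "dlaplacian h (\<lambda>i j. u i j + w i j) = (\<lambda>i j. dlaplacian h u i j + dlaplacian h w i j)"
  by (auto simp: fun_eq_iff dlaplacian_def diff_divide_distrib add_divide_distrib algebra_simps)

lemma dlaplacian_diff:
  "dlaplacian h (\<lambda>i j. u i j - w i j) = (\<lambda>i j. dlaplacian h u i j - dlaplacian h w i j)"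
  by (auto simp: fun_eq_iff dlaplacian_def diff_divide_distrib add_divide_distrib algebra_simps)

lemma fdiff_dlaplacian: "fdiff h v (dlaplacian h u) = dlaplacian h (fdiff h v u)"
  by (cases v) (auto simp: fun_eq_iff dlaplacian_def fdiff_def shift_def
      diff_divide_distrib add_divide_distrib algebra_simps)

lemma fdiffs_dlaplacian: "fdiffs h vs (dlaplacian h u) = dlaplacian h (fdiffs h vs u)"
  by (induction vs) (auto simp: fdiff_dlaplacian)

subsection \<open>Leibniz rule\<close>

text \<open>
  The bound \<open>nu\<close> stands for the maximum norm or the discrete \<open>L\<^sup>2\<close> norm; the shifts that the
  discrete product rule produces are absorbed in the hypothesis.
\<close>

lemma leibniz_bound:
  fixes nu :: "grid_fun \<Rightarrow> real \<Rightarrow> bool"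
  assumes tri: "\<And>u v a b. nu u a \<Longrightarrow> nu v b \<Longrightarrow> nu (\<lambda>i j. u i j + v i j) (a + b)"
    and "\<And>a b c d vs ws. length vs + length ws \<le> N \<Longrightarrow>
           nu (\<lambda>i j. shift a b (fdiffs h vs f) i j * shift c d (fdiffs h ws g) i j) C"
    and "length us \<le> N"
  shows "nu (fdiffs h us (\<lambda>i j. f i j * g i j)) (2 ^ length us * C)"
  using assms(2-)
proof (induction us arbitrary: f g N)
  case Nil
  from Nil(1)[of "[]" "[]" 0 0 0 0] show ?case by simp
next
  case (Cons v us)
  define a where "a = (of_bool v :: int)"
  define b where "b = (of_bool (\<not> v) :: int)"
  \<comment> \<open>\<open>N\<close> is the budget of differences for the two factors together; the
    difference taken here is charged to the factor on which it falls.\<close>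
  obtain N' where N: "N = Suc N'" using Cons.prems(2) by (cases N) auto
  have 1: "nu (fdiffs h us (\<lambda>i j. fdiff h v f i j * shift a b g i j)) (2 ^ length us * C)"
  proof (rule Cons.IH[where N=N'])
    fix a' b' c' d' and vs ws :: "bool list"
    assume "length vs + length ws \<le> N'"
    then have "nu (\<lambda>i j. shift a' b' (fdiffs h (v # vs) f) i j *
        shift (c' + a) (d' + b) (fdiffs h ws g) i j) C"
      using N by (intro Cons.prems(1)) simp
    then show "nu (\<lambda>i j. shift a' b' (fdiffs h vs (fdiff h v f)) i j *
        shift c' d' (fdiffs h ws (shift a b g)) i j) C"
      by (simp add: fdiffs_shift fdiffs_fdiff)
  qed (use N Cons.prems(2) in simp)
  have 2: "nu (fdiffs h us (\<lambda>i j. f i j * fdiff h v g i j)) (2 ^ length us * C)"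
  proof (rule Cons.IH[where N=N'])
    fix a' b' c' d' and vs ws :: "bool list"
    assume "length vs + length ws \<le> N'"
    then have "nu (\<lambda>i j. shift a' b' (fdiffs h vs f) i j *
        shift c' d' (fdiffs h (v # ws) g) i j) C"
      using N by (intro Cons.prems(1)) simp
    then show "nu (\<lambda>i j. shift a' b' (fdiffs h vs f) i j *
        shift c' d' (fdiffs h ws (fdiff h v g)) i j) C"
      by (simp add: fdiffs_fdiff)
  qed (use N Cons.prems(2) in simp)
  have "fdiffs h (v # us) (\<lambda>i j. f i j * g i j) =
      (\<lambda>i j. fdiffs h us (\<lambda>i j. fdiff h v f i j * shift a b g i j) i j
         + fdiffs h us (\<lambda>i j. f i j * fdiff h v g i j) i j)"
    by (simp add: fdiffs_fdiff[symmetric] fdiff_mult fdiffs_add a_def b_def)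
  then show ?case using tri[OF 1 2] by (simp add: algebra_simps)
qed

text \<open>Discrete \<open>C^k\<close> norm. As a bound at all indices it is insensitive to the
  shifts of the product rule.\<close>

definition sbound :: "real \<Rightarrow> nat \<Rightarrow> grid_fun \<Rightarrow> real \<Rightarrow> bool" where
  "sbound h k u M \<longleftrightarrow> (\<forall>vs. length vs \<le> k \<longrightarrow> (\<forall>i j. \<bar>fdiffs h vs u i j\<bar> \<le> M))"

lemma sboundD: "sbound h k u M \<Longrightarrow> length vs \<le> k \<Longrightarrow> \<bar>fdiffs h vs u i j\<bar> \<le> M"
  by (simp add: sbound_def)

lemma sbound_point: "sbound h k u M \<Longrightarrow> \<bar>u i j\<bar> \<le> M"
  using sboundD[of h k u M "[]"] by simp

lemma sbound_nonneg: "sbound h k u M \<Longrightarrow> 0 \<le> M"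
  using sbound_point[of h k u M 0 0] by linarith

lemma sbound_mono: "sbound h k u M \<Longrightarrow> l \<le> k \<Longrightarrow> M \<le> M' \<Longrightarrow> sbound h l u M'"
  unfolding sbound_def by (meson order_trans)

lemma sbound_add:
  "sbound h k u M \<Longrightarrow> sbound h k w M' \<Longrightarrow> sbound h k (\<lambda>i j. u i j + w i j) (M + M')"
  unfolding sbound_def fdiffs_add by (meson abs_triangle_ineq add_mono order_trans)

lemma sbound_diff:
  "sbound h k u M \<Longrightarrow> sbound h k w M' \<Longrightarrow> sbound h k (\<lambda>i j. u i j - w i j) (M + M')"
  unfolding sbound_def fdiffs_diff by (meson abs_triangle_ineq4 add_mono order_trans)

lemma sbound_scale:
  "sbound h k u M \<Longrightarrow> sbound h k (\<lambda>i j. c * u i j) (\<bar>c\<bar> * M)"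
  unfolding sbound_def fdiffs_scale by (auto simp: abs_mult mult_left_mono)

text \<open>Each difference doubles the number of products, hence at most \<open>2 ^ k\<close> of
  them.\<close>

lemma sbound_mult:
  assumes "sbound h k u M" "sbound h k w M'"
  shows "sbound h k (\<lambda>i j. u i j * w i j) (2 ^ k * (M * M'))"
  unfolding sbound_def
proof (intro allI impI)
  fix vs :: "bool list" and i j assume vs: "length vs \<le> k"
  have M: "0 \<le> M" "0 \<le> M'" using assms sbound_nonneg by auto
  have "\<forall>i j. \<bar>fdiffs h vs (\<lambda>i j. u i j * w i j) i j\<bar> \<le> 2 ^ length vs * (M * M')"
  proof (rule leibniz_bound[where nu="\<lambda>u a. \<forall>i j. \<bar>u i j\<bar> \<le> a", OF _ _ vs])
    show "\<forall>i j. \<bar>u i j\<bar> \<le> a \<Longrightarrow> \<forall>i j. \<bar>v i j\<bar> \<le> b \<Longrightarrow> \<forall>i j. \<bar>u i j + v i j\<bar> \<le> a + b"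
      for u v :: grid_fun and a b
      by (meson abs_triangle_ineq add_mono order_trans)
    show "\<forall>i j. \<bar>shift a b (fdiffs h vs u) i j * shift c d (fdiffs h ws w) i j\<bar> \<le> M * M'"
      if "length vs + length ws \<le> k" for a b c d vs ws
      using that M assms unfolding abs_mult shift_def
      by (auto intro!: mult_mono sboundD)
  qed
  moreover have "2 ^ length vs * (M * M') \<le> 2 ^ k * (M * M')"
    using vs M by (intro mult_right_mono) auto
  ultimately show "\<bar>fdiffs h vs (\<lambda>i j. u i j * w i j) i j\<bar> \<le> 2 ^ k * (M * M')"
    using order_trans by blast
qed

lemma sbound_fdiff: "sbound h (Suc k) u M \<Longrightarrow> sbound h k (fdiff h v u) M"
  unfolding sbound_def
proof (intro allI impI)
  fix vs :: "bool list" and i j assume a: "\<forall>vs. length vs \<le> Suc k \<longrightarrow> (\<forall>i j. \<bar>fdiffs h vs u i j\<bar> \<le> M)"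
    and "length vs \<le> k"
  then have "\<bar>fdiffs h (v # vs) u i j\<bar> \<le> M" by (simp del: fdiffs.simps)
  then show "\<bar>fdiffs h vs (fdiff h v u) i j\<bar> \<le> M" by (simp add: fdiffs_fdiff)
qed

lemma sbound_dlaplacian:
  assumes "sbound h (k + 2) u M" shows "sbound h k (dlaplacian h u) (2 * M)"
  unfolding sbound_def
proof (intro allI impI)
  fix vs :: "bool list" and i j assume vs: "length vs \<le> k"
  have "\<bar>fdiffs h ([w, w] @ vs) u i j\<bar> \<le> M" for w i j
    by (rule sboundD[OF assms]) (use vs in simp)
  from this[of True "i-1" j] this[of False i "j-1"]
  show "\<bar>fdiffs h vs (dlaplacian h u) i j\<bar> \<le> 2 * M"
    by (simp add: fdiffs_dlaplacian dlaplacian_eq_fdiffs shift_def)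
qed

section \<open>Periodic grid functions, the discrete \<open>L\<^sup>2\<close> norm, summation by
  parts\<close>

locale pgrid =
  fixes h :: real and m n :: nat
  assumes h_pos: "0 < h" and m_pos: "0 < m" and n_pos: "0 < n"
begin

abbreviation per :: "grid_fun \<Rightarrow> bool" where "per \<equiv> grid_periodic m n"

lemma per_iff: "per u \<longleftrightarrow> (\<forall>i j. u (i + int m) j = u i j \<and> u i (j + int n) = u i j)"
proof
  assume "per u"
  then have "\<And>i j a b. u (i + a * int m) (j + b * int n) = u i j" by (simp add: grid_periodic_def)
  from this[of _ 1 _ 0] this[of _ 0 _ 1] show "\<forall>i j. u (i + int m) j = u i j \<and> u i (j + int n) = u i j"
    by simp
next
  assume *: "\<forall>i j. u (i + int m) j = u i j \<and> u i (j + int n) = u i j"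
  have 1: "u (i + a * int m) j = u i j" for i j a
  proof (induction a rule: int_induct[where k=0])
    case (step1 a) then show ?case using *[rule_format, of "i + a * int m" j] by (simp add: algebra_simps)
  next
    case (step2 a) then show ?case using *[rule_format, of "i + (a - 1) * int m" j] by (simp add: algebra_simps)
  qed simp
  have 2: "u i (j + a * int n) = u i j" for i j a
  proof (induction a rule: int_induct[where k=0])
    case (step1 a) then show ?case using *[rule_format, of i "j + a * int n"] by (simp add: algebra_simps)
  next
    case (step2 a) then show ?case using *[rule_format, of i "j + (a - 1) * int n"] by (simp add: algebra_simps)
  qed simp
  show "per u" using 1 2 by (simp add: grid_periodic_def)
qed

lemma per_shift: "per u \<Longrightarrow> per (shift a b u)"
  unfolding per_iff shift_def by (metis add.assoc add.commute)

lemma per_comb2: "per u \<Longrightarrow> per w \<Longrightarrow> per (\<lambda>i j. F (u i j) (w i j))"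
  unfolding per_iff by simp

lemma per_comb1: "per u \<Longrightarrow> per (\<lambda>i j. F (u i j))"
  unfolding per_iff by simp

lemma per_fdiff: "per u \<Longrightarrow> per (fdiff h v u)"
  unfolding fdiff_def by (intro per_comb2[where F="\<lambda>x y. (x - y) / h"] per_shift)

lemma per_fdiffs: "per u \<Longrightarrow> per (fdiffs h vs u)"
  by (induction vs) (auto intro: per_fdiff)

lemma per_dlaplacian: "per u \<Longrightarrow> per (dlaplacian h u)"
  unfolding dlaplacian_eq_fdiffs[abs_def] by (intro per_comb2[where F="(+)"] per_shift per_fdiffs)

text \<open>Lets a maximum over the finite cell serve as a maximum over all indices. The offset 1 in
  the residues is there because the cell starts at index 1.\<close>

lemma per_representative:
  "\<exists>i'\<in>{1..int m}. \<exists>j'\<in>{1..int n}. \<forall>u. per u \<longrightarrow> u i j = u i' j'"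
proof (intro bexI allI impI)
  let ?i = "(i - 1) mod int m + 1" and ?j = "(j - 1) mod int n + 1"
  show "?i \<in> {1..int m}" "?j \<in> {1..int n}"
    using m_pos n_pos pos_mod_bound[of "int m" "i - 1"] pos_mod_bound[of "int n" "j - 1"]
      pos_mod_sign[of "int m" "i - 1"] pos_mod_sign[of "int n" "j - 1"]
    by (simp_all add: zle_add1_eq_le[symmetric] del: zle_add1_eq_le)
  fix u assume "per u"
  then have "u (?i + ((i - 1) div int m) * int m) (?j + ((j - 1) div int n) * int n) = u ?i ?j"
    by (metis grid_periodic_def)
  moreover have "?i + ((i - 1) div int m) * int m = i"
    using mod_div_mult_eq[of "i - 1" "int m"] by linarith
  moreover have "?j + ((j - 1) div int n) * int n = j"
    using mod_div_mult_eq[of "j - 1" "int n"] by linarith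
  ultimately show "u i j = u ?i ?j" by metis
qed

definition gsum :: "grid_fun \<Rightarrow> real" where
  "gsum u = h\<^sup>2 * (\<Sum>i=1..int m. \<Sum>j=1..int n. u i j)"

lemma gsum_add: "gsum (\<lambda>i j. u i j + w i j) = gsum u + gsum w"
  by (simp add: gsum_def sum.distrib algebra_simps)

lemma gsum_diff: "gsum (\<lambda>i j. u i j - w i j) = gsum u - gsum w"
  by (simp add: gsum_def sum_subtractf algebra_simps)

lemma gsum_scale: "gsum (\<lambda>i j. c * u i j) = c * gsum u"
  by (simp add: gsum_def sum_distrib_left algebra_simps)

lemma gsum_mono: "(\<And>i j. u i j \<le> w i j) \<Longrightarrow> gsum u \<le> gsum w"
  unfolding gsum_def by (intro mult_left_mono sum_mono) auto

lemma gsum_const: "gsum (\<lambda>i j. c) = (real m * h) * (real n * h) * c"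
  by (simp add: gsum_def power2_eq_square)

lemma gsum_shift:
  assumes "per u" shows "gsum (shift a b u) = gsum u"
proof -
  have p: "u (i + int m) j = u i j" "u i (j + int n) = u i j" for i j
    using assms per_iff by auto
  have "(\<Sum>i=1..int m. \<Sum>j=1..int n. u (i + a) (j + b)) = (\<Sum>i=1..int m. \<Sum>j=1..int n. u (i + a) j)"
    by (intro sum.cong refl sum_periodic_shift p)
  also have "\<dots> = (\<Sum>i=1..int m. \<Sum>j=1..int n. u i j)"
    by (rule sum_periodic_shift[where f="\<lambda>i. \<Sum>j=1..int n. u i j"]) (simp add: p)
  finally show ?thesis by (simp add: gsum_def shift_def)
qed

definition nrm :: "grid_fun \<Rightarrow> real" where
  "nrm u = sqrt (gsum (\<lambda>i j. (u i j)\<^sup>2))"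

lemma gsum_nonneg: "(\<And>i j. 0 \<le> u i j) \<Longrightarrow> 0 \<le> gsum u"
  unfolding gsum_def by (intro mult_nonneg_nonneg sum_nonneg) auto

lemma nrm_nonneg [simp]: "0 \<le> nrm u"
  by (simp add: nrm_def gsum_nonneg)

lemma nrm_sq: "(nrm u)\<^sup>2 = gsum (\<lambda>i j. (u i j)\<^sup>2)"
  by (simp add: nrm_def gsum_nonneg)

text \<open>Carries the triangle and Cauchy-Schwarz inequalities over from
  \<open>L2_set\<close>.\<close>

lemma nrm_L2_set: "nrm u = h * L2_set (\<lambda>(i, j). u i j) ({1..int m} \<times> {1..int n})"
  unfolding nrm_def gsum_def L2_set_def
  by (simp add: real_sqrt_mult h_pos less_imp_le sum.cartesian_product case_prod_unfold)

lemma nrm_add: "nrm (\<lambda>i j. u i j + w i j) \<le> nrm u + nrm w"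
proof -
  have "L2_set (\<lambda>(i, j). u i j + w i j) A \<le> L2_set (\<lambda>(i, j). u i j) A + L2_set (\<lambda>(i, j). w i j) A" for A
    using L2_set_triangle_ineq[of "\<lambda>(i, j). u i j" "\<lambda>(i, j). w i j" A] by (simp add: case_prod_unfold)
  from mult_left_mono[OF this, of h] show ?thesis
    unfolding nrm_L2_set using h_pos by (simp add: algebra_simps)
qed

lemma nrm_scale: "nrm (\<lambda>i j. c * u i j) = \<bar>c\<bar> * nrm u"
  unfolding nrm_def by (simp add: power_mult_distrib gsum_scale real_sqrt_mult)

lemma nrm_diff: "nrm (\<lambda>i j. u i j - w i j) \<le> nrm u + nrm w"
  using nrm_add[of u "\<lambda>i j. (-1) * w i j"] nrm_scale[of "-1" w] by simp

lemma nrm_mono: "(\<And>i j. \<bar>u i j\<bar> \<le> \<bar>w i j\<bar>) \<Longrightarrow> nrm u \<le> nrm w"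
  unfolding nrm_def by (intro real_sqrt_le_mono gsum_mono) (simp add: abs_le_square_iff)

lemma nrm_mult_le:
  assumes "\<And>i j. \<bar>a i j\<bar> \<le> M"
  shows "nrm (\<lambda>i j. a i j * u i j) \<le> M * nrm u"
proof -
  have "0 \<le> M" using assms[of 0 0] by linarith
  have "nrm (\<lambda>i j. a i j * u i j) \<le> nrm (\<lambda>i j. M * u i j)"
    using assms \<open>0 \<le> M\<close> by (intro nrm_mono) (simp add: abs_mult mult_right_mono)
  then show ?thesis using \<open>0 \<le> M\<close> by (simp add: nrm_scale)
qed

lemma nrm_const_le: 
  assumes "\<And>i j. \<bar>u i j\<bar> \<le> M"
  shows "nrm u \<le> sqrt ((real m * h) * (real n * h)) * M"
proof -
  have "0 \<le> M" using assms[of 0 0] by linarith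
  have "nrm u \<le> nrm (\<lambda>i j. M)" using assms \<open>0 \<le> M\<close> by (intro nrm_mono) simp
  also have "\<dots> = sqrt ((real m * h) * (real n * h)) * M"
    using \<open>0 \<le> M\<close> by (simp add: nrm_def gsum_const real_sqrt_mult)
  finally show ?thesis .
qed

lemma nrm_shift: "per u \<Longrightarrow> nrm (shift a b u) = nrm u"
  unfolding nrm_def using gsum_shift[OF per_comb1[of u "\<lambda>x. x\<^sup>2"], of a b]
  by (simp add: shift_def)

lemma gsum_mult_le: "gsum (\<lambda>i j. u i j * w i j) \<le> nrm u * nrm w"
proof -
  have "(\<Sum>i=1..int m. \<Sum>j=1..int n. u i j * w i j)
      \<le> L2_set (\<lambda>(i, j). u i j) ({1..int m} \<times> {1..int n}) * L2_set (\<lambda>(i, j). w i j) ({1..int m} \<times> {1..int n})"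
    unfolding sum.cartesian_product
    by (rule order_trans[OF _ L2_set_mult_ineq])
       (auto intro!: sum_mono simp: case_prod_unfold abs_mult[symmetric])
  from mult_left_mono[OF this, of "h\<^sup>2"] show ?thesis
    unfolding nrm_L2_set gsum_def by (simp add: power2_eq_square algebra_simps)
qed

text \<open>The inverse inequality: by periodicity both copies of \<open>u\<close> in the difference
  have the same norm.\<close>

lemma nrm_fdiff_le:
  assumes "per u" shows "nrm (fdiff h v u) \<le> 2 / h * nrm u"
proof -
  have "nrm (fdiff h v u) = nrm (\<lambda>i j. (1 / h) * (shift (of_bool v) (of_bool (\<not> v)) u i j - u i j))"
    by (simp add: fdiff_def)
  also have "\<dots> = 1 / h * nrm (\<lambda>i j. shift (of_bool v) (of_bool (\<not> v)) u i j - u i j)"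
    using h_pos by (simp only: nrm_scale) simp
  also have "\<dots> \<le> 1 / h * (nrm (shift (of_bool v) (of_bool (\<not> v)) u) + nrm u)"
    using h_pos by (intro mult_left_mono nrm_diff) auto
  finally show ?thesis using assms by (simp add: nrm_shift)
qed

text \<open>The Laplacian is a backward difference of forward differences; a shift of the summation
  index turns the backward difference on \<open>u\<close> into a forward difference on
  \<open>w\<close>, with a change of sign.\<close>

lemma gsum_by_parts:
  assumes "per u" "per w"
  shows "gsum (\<lambda>i j. dlaplacian h u i j * w i j) =
    - (gsum (\<lambda>i j. fdiff h True u i j * fdiff h True w i j)
       + gsum (\<lambda>i j. fdiff h False u i j * fdiff h False w i j))"
proof -
  have 1: "gsum (\<lambda>i j. shift a b g i j * w i j) = gsum (\<lambda>i j. g i j * shift (- a) (- b) w i j)"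
    if "per g" for a b g
  proof -
    have "shift (- a) (- b) (\<lambda>i j. shift a b g i j * w i j) = (\<lambda>i j. g i j * shift (- a) (- b) w i j)"
      by (simp add: shift_def)
    moreover have "per (\<lambda>i j. shift a b g i j * w i j)"
      by (intro per_comb2[where F="(*)"] per_shift that assms)
    ultimately show ?thesis using gsum_shift[of _ "-a" "-b"] by metis
  qed
  have 2: "gsum (\<lambda>i j. (1 / h) * ((g i j - shift a b g i j) * w i j))
      = - gsum (\<lambda>i j. g i j * ((shift (- a) (- b) w i j - w i j) / h))" if "per g" for a b g
  proof -
    have "gsum (\<lambda>i j. (1 / h) * ((g i j - shift a b g i j) * w i j))
        = 1 / h * (gsum (\<lambda>i j. g i j * w i j) - gsum (\<lambda>i j. shift a b g i j * w i j))"
      by (simp only: gsum_scale left_diff_distrib gsum_diff)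
    also have "\<dots> = 1 / h * (gsum (\<lambda>i j. g i j * w i j - g i j * shift (- a) (- b) w i j))"
      using 1[OF that] by (simp only: gsum_diff)
    also have "\<dots> = gsum (\<lambda>i j. (-1) * (g i j * ((shift (- a) (- b) w i j - w i j) / h)))"
      unfolding gsum_scale[symmetric] by (simp add: field_simps)
    finally show ?thesis by (simp only: gsum_scale)
  qed
  have "gsum (\<lambda>i j. dlaplacian h u i j * w i j) =
     gsum (\<lambda>i j. (1 / h) * ((fdiff h True u i j - shift (-1) 0 (fdiff h True u) i j) * w i j)) +
     gsum (\<lambda>i j. (1 / h) * ((fdiff h False u i j - shift 0 (-1) (fdiff h False u) i j) * w i j))"
    unfolding gsum_add[symmetric]
    by (simp add: dlaplacian_fdiff diff_divide_distrib add_divide_distrib algebra_simps)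
  then show ?thesis
    using 2[of "fdiff h True u" "-1" 0] 2[of "fdiff h False u" 0 "-1"] per_fdiff[OF assms(1)]
    by (simp add: fdiff_def[of h _ w])
qed

subsection \<open>Products and discrete Sobolev norms\<close>

text \<open>Discrete \<open>H^k\<close> bound, one number for all words of differences. Periodicity
  is built in because it makes \<open>nrm\<close> invariant under shifts.\<close>

definition hbound :: "nat \<Rightarrow> grid_fun \<Rightarrow> real \<Rightarrow> bool" where
  "hbound k u B \<longleftrightarrow> per u \<and> (\<forall>vs. length vs \<le> k \<longrightarrow> nrm (fdiffs h vs u) \<le> B)"

lemma hboundD: "hbound k u B \<Longrightarrow> length vs \<le> k \<Longrightarrow> nrm (fdiffs h vs u) \<le> B"
  by (simp add: hbound_def)

lemma hbound_nonneg: "hbound k u B \<Longrightarrow> 0 \<le> B"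
  using hboundD[of k u B "[]"] nrm_nonneg[of u] by (simp del: nrm_nonneg)

lemma hbound_mono: "hbound k u B \<Longrightarrow> l \<le> k \<Longrightarrow> B \<le> B' \<Longrightarrow> hbound l u B'"
  unfolding hbound_def by (meson order_trans)

lemma hbound_add:
  "hbound k u B \<Longrightarrow> hbound k w B' \<Longrightarrow> hbound k (\<lambda>i j. u i j + w i j) (B + B')"
  unfolding hbound_def fdiffs_add
  by (auto intro: order_trans[OF nrm_add] add_mono per_comb2)

lemma hbound_diff:
  "hbound k u B \<Longrightarrow> hbound k w B' \<Longrightarrow> hbound k (\<lambda>i j. u i j - w i j) (B + B')"
  unfolding hbound_def fdiffs_diff
  by (auto intro: order_trans[OF nrm_diff] add_mono per_comb2)

lemma hbound_scale:
  "hbound k u B \<Longrightarrow> hbound k (\<lambda>i j. c * u i j) (\<bar>c\<bar> * B)"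
  unfolding hbound_def fdiffs_scale by (auto simp: nrm_scale mult_left_mono per_comb1)

lemma hbound_fdiff: "hbound (Suc k) u B \<Longrightarrow> hbound k (fdiff h v u) B"
  unfolding hbound_def
proof (intro allI impI conjI)
  fix vs :: "bool list"
  assume a: "per u \<and> (\<forall>vs. length vs \<le> Suc k \<longrightarrow> nrm (fdiffs h vs u) \<le> B)" and "length vs \<le> k"
  then have "nrm (fdiffs h (v # vs) u) \<le> B" by (simp del: fdiffs.simps)
  then show "nrm (fdiffs h vs (fdiff h v u)) \<le> B" by (simp add: fdiffs_fdiff)
qed (auto intro: per_fdiff)

lemma hbound_shift: "hbound k u B \<Longrightarrow> hbound k (shift a b u) B"
  unfolding hbound_def by (auto simp: fdiffs_shift nrm_shift per_fdiffs per_shift)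

text \<open>For \<open>h \<le> 1\<close> the factor \<open>2 / h\<close> is at least 1, so the
  shorter words obey the enlarged bound as well.\<close>

lemma hbound_inverse:
  assumes "hbound k u B" "h \<le> 1"
  shows "hbound (Suc k) u (2 / h * B)"
  unfolding hbound_def
proof (intro conjI allI impI)
  have B: "0 \<le> B" using assms hbound_nonneg by auto
  have "1 \<le> 2 / h" using assms(2) h_pos by simp
  from mult_right_mono[OF this B] have B': "B \<le> 2 / h * B" by simp
  show per: "per u" using assms by (simp add: hbound_def)
  fix vs :: "bool list" assume "length vs \<le> Suc k"
  then show "nrm (fdiffs h vs u) \<le> 2 / h * B"
  proof (cases vs)
    case Nil
    then show ?thesis using hboundD[OF assms(1), of "[]"] B' by simp
  next
    case (Cons v ws)
    then have "nrm (fdiffs h ws u) \<le> B" using \<open>length vs \<le> Suc k\<close> by (intro hboundD[OF assms(1)]) simp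
    then have "2 / h * nrm (fdiffs h ws u) \<le> 2 / h * B" using h_pos by (intro mult_left_mono) auto
    then show ?thesis using nrm_fdiff_le[OF per_fdiffs[OF per], of v ws] Cons by simp
  qed
qed

lemma hbound_mult:
  assumes "sbound h k a M" "hbound k u B" "per a"
  shows "hbound k (\<lambda>i j. a i j * u i j) (2 ^ k * (M * B))"
  unfolding hbound_def
proof (intro allI impI conjI)
  have pu: "per u" using assms by (simp add: hbound_def)
  show "per (\<lambda>i j. a i j * u i j)" using pu assms(3) by (rule per_comb2[rotated])
  fix vs :: "bool list" assume vs: "length vs \<le> k"
  have MB: "0 \<le> M" "0 \<le> B" using assms sbound_nonneg hbound_nonneg by auto
  have "nrm (fdiffs h vs (\<lambda>i j. a i j * u i j)) \<le> 2 ^ length vs * (M * B)"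
  proof (rule leibniz_bound[where nu="\<lambda>u a. nrm u \<le> a", OF _ _ vs])
    show "nrm u \<le> a \<Longrightarrow> nrm v \<le> b \<Longrightarrow> nrm (\<lambda>i j. u i j + v i j) \<le> a + b" for u v a b
      using nrm_add[of u v] by linarith
    fix p q r s and vs ws :: "bool list" assume l: "length vs + length ws \<le> k"
    have "nrm (\<lambda>i j. shift p q (fdiffs h vs a) i j * shift r s (fdiffs h ws u) i j)
        \<le> M * nrm (shift r s (fdiffs h ws u))"
      using l by (intro nrm_mult_le) (simp add: shift_def sboundD[OF assms(1)])
    also have "\<dots> \<le> M * B"
      using l MB by (intro mult_left_mono) (simp_all add: nrm_shift per_fdiffs pu hboundD[OF assms(2)])
    finally show "nrm (\<lambda>i j. shift p q (fdiffs h vs a) i j * shift r s (fdiffs h ws u) i j) \<le> M * B" .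
  qed
  moreover have "2 ^ length vs * (M * B) \<le> 2 ^ k * (M * B)"
    using vs MB by (intro mult_right_mono) auto
  ultimately show "nrm (fdiffs h vs (\<lambda>i j. a i j * u i j)) \<le> 2 ^ k * (M * B)"
    using order_trans by blast
qed

text \<open>The product in which all differences fall on \<open>u\<close> cancels, so
  \<open>u\<close> carries at most \<open>k\<close> of them. One use of the product rule splits off
  a product in which \<open>a\<close> is already differenced; the rest is the same commutator for
  \<open>fdiff h v u\<close>, with one difference fewer. This happens at most \<open>Suc k\<close>
  times.\<close>

lemma commutator_bound:
  assumes "sbound h (Suc k) a M" "hbound k u B" "per a" "length vs \<le> Suc k"
  shows "nrm (\<lambda>i j. fdiffs h vs (\<lambda>i j. a i j * u i j) i j - a i j * fdiffs h vs u i j)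
           \<le> real (Suc k) * (2 ^ k * (M * B))"
  using assms
proof (induction k arbitrary: u vs)
  case 0
  then show ?case
  proof (cases vs)
    case Nil then show ?thesis using sbound_nonneg[OF 0(1)] hbound_nonneg[OF 0(2)] nrm_scale[of 0 "\<lambda>_ _. 0"] by simp
  next
    case (Cons v ws)
    then have "ws = []" using 0 by simp
    have "nrm (\<lambda>i j. fdiff h v a i j * shift (of_bool v) (of_bool (\<not> v)) u i j) \<le> M * B"
      using hboundD[OF hbound_mult[OF sbound_fdiff[OF 0(1), of v] hbound_shift[OF 0(2)] per_fdiff[OF 0(3)]], of "[]"]
      by simp
    then show ?thesis using Cons \<open>ws = []\<close> by (simp add: fdiff_mult)
  qed
next
  case (Suc k)
  have MB: "0 \<le> M" "0 \<le> B" using Suc.prems sbound_nonneg hbound_nonneg by auto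
  show ?case
  proof (cases vs)
    case Nil then show ?thesis using MB nrm_scale[of 0 "\<lambda>_ _. 0"] by simp
  next
    case (Cons v ws)
    let ?a = "of_bool v" and ?b = "of_bool (\<not> v)"
    have 1: "nrm (fdiffs h ws (\<lambda>i j. fdiff h v a i j * shift ?a ?b u i j)) \<le> 2 ^ (Suc k) * (M * B)"
      using Suc.prems(4) Cons
      by (intro hboundD[OF hbound_mult[OF sbound_fdiff[OF Suc.prems(1), of v] hbound_shift[OF Suc.prems(2)] per_fdiff[OF Suc.prems(3)]]])
         simp
    have 2: "nrm (\<lambda>i j. fdiffs h ws (\<lambda>i j. a i j * fdiff h v u i j) i j - a i j * fdiffs h ws (fdiff h v u) i j)
           \<le> real (Suc k) * (2 ^ k * (M * B))"
      using Suc.prems Cons by (intro Suc.IH) (auto intro: hbound_fdiff sbound_mono)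
    have "(\<lambda>i j. fdiffs h vs (\<lambda>i j. a i j * u i j) i j - a i j * fdiffs h vs u i j)
      = (\<lambda>i j. fdiffs h ws (\<lambda>i j. fdiff h v a i j * shift ?a ?b u i j) i j
         + (fdiffs h ws (\<lambda>i j. a i j * fdiff h v u i j) i j - a i j * fdiffs h ws (fdiff h v u) i j))"
      using Cons by (simp add: fun_eq_iff fdiffs_fdiff[symmetric] fdiff_mult fdiffs_add)
    then have "nrm (\<lambda>i j. fdiffs h vs (\<lambda>i j. a i j * u i j) i j - a i j * fdiffs h vs u i j)
      \<le> 2 ^ (Suc k) * (M * B) + real (Suc k) * (2 ^ k * (M * B))"
      using order_trans[OF nrm_add add_mono[OF 1 2]] by metis
    also have "\<dots> \<le> 2 ^ (Suc k) * (M * B) + real (Suc k) * (2 ^ Suc k * (M * B))"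
      using MB by (intro add_left_mono mult_left_mono mult_right_mono) auto
    also have "\<dots> = real (Suc (Suc k)) * (2 ^ Suc k * (M * B))" by (simp add: algebra_simps)
    finally show ?thesis .
  qed
qed

lemma fdiff_sup_le:
  assumes "\<And>i j. \<bar>u i j\<bar> \<le> M"
  shows "\<bar>fdiff h v u i j\<bar> \<le> 2 * M / h"
proof -
  have "\<bar>shift (of_bool v) (of_bool (\<not> v)) u i j - u i j\<bar> \<le> 2 * M"
    using abs_triangle_ineq4[of "shift (of_bool v) (of_bool (\<not> v)) u i j" "u i j"]
      assms[of i j] assms[of "i + of_bool v" "j + of_bool (\<not> v)"] by (simp add: shift_def)
  then show ?thesis using h_pos by (simp add: fdiff_def abs_divide divide_right_mono)
qed

text \<open>
  The third differences of a product of two functions of size \<open>O(h)\<close> are controlled by second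
  differences of the factors: the missing derivative is paid for by the inverse inequality.
\<close>

lemma hbound_small_mult:
  assumes f: "hbound 2 f B" "\<And>i j. \<bar>f i j\<bar> \<le> R * h"
    and g: "hbound 2 g B" "\<And>i j. \<bar>g i j\<bar> \<le> R * h" and h1: "h \<le> 1"
  shows "hbound 3 (\<lambda>i j. f i j * g i j) (16 * (R * B))"
  unfolding hbound_def
proof (intro allI impI conjI)
  have pf: "per f" "per g" using f g by (simp_all add: hbound_def)
  then show "per (\<lambda>i j. f i j * g i j)" by (rule per_comb2)
  have B: "0 \<le> B" using f hbound_nonneg by auto
  have "0 \<le> R * h" using f(2)[of 0 0] by linarith
  then have R: "0 \<le> R" using h_pos by (simp add: zero_le_mult_iff)
  have f3: "hbound 3 f (2 / h * B)" "hbound 3 g (2 / h * B)"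
    using hbound_inverse[OF f(1) h1] hbound_inverse[OF g(1) h1] by (simp_all add: numeral_3_eq_3 numeral_2_eq_2)
  have sup1: "\<bar>fdiffs h vs u i j\<bar> \<le> 2 * R" if "length vs \<le> 1" "\<And>i j. \<bar>u i j\<bar> \<le> R * h"
    for vs and u :: grid_fun and i j
  proof (cases vs)
    case Nil
    then show ?thesis using that(2)[of i j] mult_left_mono[OF h1 R] R by simp
  next
    case (Cons v ws)
    then have "ws = []" using that by simp
    then show ?thesis using fdiff_sup_le[of u "R * h" v i j] that(2) Cons h_pos by simp
  qed
  \<comment> \<open>By symmetry \<open>f\<close> is the factor with fewer differences, hence at most
    one. With none, its size \<open>R * h\<close> pays for a third difference of \<open>g\<close>;
    with one, it is still at most \<open>2 * R\<close> pointwise and \<open>g\<close> carries only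
    two.\<close>
  have main: "nrm (\<lambda>i j. shift p q (fdiffs h vs f) i j * shift r s (fdiffs h ws g) i j) \<le> 2 * R * B"
    if l: "length vs + length ws \<le> 3" "length vs \<le> length ws"
      and fg: "per f" "per g" "hbound 2 g B" "hbound 3 g (2 / h * B)" "\<And>i j. \<bar>f i j\<bar> \<le> R * h"
    for p q r s vs ws and f g
  proof (cases "length vs = 0")
    case True
    have "nrm (\<lambda>i j. shift p q (fdiffs h vs f) i j * shift r s (fdiffs h ws g) i j) \<le> R * h * nrm (shift r s (fdiffs h ws g))"
      using True fg(5) by (intro nrm_mult_le) (simp add: shift_def)
    also have "\<dots> \<le> R * h * (2 / h * B)"
      using hboundD[OF fg(4), of ws] l R h_pos by (intro mult_left_mono) (simp_all add: nrm_shift per_fdiffs fg)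
    finally show ?thesis using h_pos by simp
  next
    case False
    then have l': "length vs \<le> 1" "length ws \<le> 2" using l by linarith+
    have "nrm (\<lambda>i j. shift p q (fdiffs h vs f) i j * shift r s (fdiffs h ws g) i j) \<le> 2 * R * nrm (shift r s (fdiffs h ws g))"
      using l' fg(5) by (intro nrm_mult_le) (simp add: shift_def sup1)
    also have "\<dots> \<le> 2 * R * B"
      using l' R by (intro mult_left_mono) (simp_all add: nrm_shift per_fdiffs fg hboundD[OF fg(3)])
    finally show ?thesis .
  qed
  fix us :: "bool list" assume us: "length us \<le> 3"
  have "nrm (fdiffs h us (\<lambda>i j. f i j * g i j)) \<le> 2 ^ length us * (2 * R * B)"
  proof (rule leibniz_bound[where nu="\<lambda>u a. nrm u \<le> a", OF _ _ us])
    show "nrm u \<le> a \<Longrightarrow> nrm v \<le> b \<Longrightarrow> nrm (\<lambda>i j. u i j + v i j) \<le> a + b" for u v a b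
      using nrm_add[of u v] by linarith
    fix p q r s and vs ws :: "bool list" assume l: "length vs + length ws \<le> 3"
    show "nrm (\<lambda>i j. shift p q (fdiffs h vs f) i j * shift r s (fdiffs h ws g) i j) \<le> 2 * R * B"
    proof (cases "length vs \<le> length ws")
      case True
      then show ?thesis using l pf f g f3 by (intro main) auto
    next
      case False
      have "nrm (\<lambda>i j. shift r s (fdiffs h ws g) i j * shift p q (fdiffs h vs f) i j) \<le> 2 * R * B"
        using l pf f g f3 False by (intro main) auto
      then show ?thesis by (simp add: mult.commute)
    qed
  qed
  also have "\<dots> \<le> 2 ^ 3 * (2 * R * B)"
    using us R B by (intro mult_right_mono power_increasing) auto
  finally show "nrm (fdiffs h us (\<lambda>i j. f i j * g i j)) \<le> 16 * (R * B)" by simp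
qed

end

text \<open>Discrete embedding of \<open>W^{1,1}\<close> of a circle into the maximum norm:
  \<open>f i\<close> differs from every other value by at most the total variation over one period;
  then average over the period.\<close>

lemma abs_periodic_le:
  fixes f :: "int \<Rightarrow> real"
  assumes per: "\<And>i. f (i + int m) = f i" and m: "0 < m"
  shows "\<bar>f i\<bar> \<le> (\<Sum>k=1..int m. \<bar>f k\<bar>) / real m + (\<Sum>k=1..int m. \<bar>f (k + 1) - f k\<bar>)"
proof -
  define V where "V = (\<Sum>k=1..int m. \<bar>f (k + 1) - f k\<bar>)"
  have tele: "\<bar>f (i + int j) - f i\<bar> \<le> (\<Sum>l=1..int j. \<bar>f (l + 1 + (i - 1)) - f (l + (i - 1))\<bar>)" for j
  proof (induction j)
    case (Suc j)
    have "{1..int (Suc j)} = insert (int (Suc j)) {1..int j}" by auto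
    then have "(\<Sum>l=1..int (Suc j). \<bar>f (l + 1 + (i - 1)) - f (l + (i - 1))\<bar>)
      = \<bar>f (int (Suc j) + 1 + (i - 1)) - f (int (Suc j) + (i - 1))\<bar> +
        (\<Sum>l=1..int j. \<bar>f (l + 1 + (i - 1)) - f (l + (i - 1))\<bar>)" by (simp add: algebra_simps)
    moreover have "int (Suc j) + 1 + (i - 1) = i + int (Suc j)" "int (Suc j) + (i - 1) = i + int j" by simp_all
    ultimately show ?case using Suc by (smt (verit))
  qed simp
  have V: "(\<Sum>l=1..int m. \<bar>f (l + 1 + (i - 1)) - f (l + (i - 1))\<bar>) = V"
    unfolding V_def
    by (rule trans[OF _ sum_periodic_shift[where a="i - 1"]])
      (auto simp: algebra_simps intro!: sum.cong, metis per add.assoc add.commute)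
  have near: "\<bar>f i\<bar> \<le> \<bar>f (k + (i - 1))\<bar> + V" if "k \<in> {1..int m}" for k
  proof -
    define j where "j = nat (k - 1)"
    have j: "k + (i - 1) = i + int j" "int j \<le> int m" using that by (auto simp: j_def)
    have "(\<Sum>l=1..int j. \<bar>f (l + 1 + (i - 1)) - f (l + (i - 1))\<bar>) \<le> V"
      unfolding V[symmetric] using j by (intro sum_mono2) auto
    then show ?thesis using tele[of j] unfolding j(1) by linarith
  qed
  have "real m * \<bar>f i\<bar> = (\<Sum>k=1..int m. \<bar>f i\<bar>)" by simp
  also have "\<dots> \<le> (\<Sum>k=1..int m. \<bar>f (k + (i - 1))\<bar> + V)" using near by (intro sum_mono)
  also have "\<dots> = (\<Sum>k=1..int m. \<bar>f (k + (i - 1))\<bar>) + real m * V" by (simp add: sum.distrib)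
  also have "(\<Sum>k=1..int m. \<bar>f (k + (i - 1))\<bar>) = (\<Sum>k=1..int m. \<bar>f k\<bar>)"
    by (rule sum_periodic_shift) (simp add: per)
  finally have "\<bar>f i\<bar> \<le> ((\<Sum>k=1..int m. \<bar>f k\<bar>) + real m * V) / real m"
    using m by (simp add: pos_le_divide_eq mult.commute)
  then show ?thesis using m by (simp add: V_def add_divide_distrib)
qed

section \<open>Discrete Sobolev embedding and maximum principle\<close>

context pgrid
begin

abbreviation area :: real where "area \<equiv> (real m * h) * (real n * h)"

lemma area_pos: "0 < area"
  using h_pos m_pos n_pos by simp

lemma gsum_abs_le: "gsum (\<lambda>i j. \<bar>u i j\<bar>) \<le> sqrt area * nrm u"
proof -
  have "gsum (\<lambda>i j. 1 * \<bar>u i j\<bar>) \<le> nrm (\<lambda>i j. 1) * nrm (\<lambda>i j. \<bar>u i j\<bar>)" by (rule gsum_mult_le)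
  moreover have "nrm (\<lambda>i j. 1) = sqrt area" by (simp add: nrm_def gsum_const)
  moreover have "nrm (\<lambda>i j. \<bar>u i j\<bar>) = nrm u" by (simp add: nrm_def)
  ultimately show ?thesis by simp
qed

text \<open>The one-dimensional bound, used in each direction in turn, leaves sums over the four
  words \<open>[]\<close>, \<open>[False]\<close>, \<open>[True]\<close> and
  \<open>[False, True]\<close>; this is why two differences suffice in the plane. Cauchy-Schwarz
  then passes from sums of absolute values to \<open>nrm\<close>.\<close>

lemma sobolev_sup:
  assumes "hbound 2 u B"
  shows "\<bar>u i j\<bar> \<le> sqrt area * ((1 + 1 / (real m * h)) * (1 + 1 / (real n * h))) * B"
proof -
  let ?L1 = "real m * h" and ?L2 = "real n * h"
  have L: "0 < ?L1" "0 < ?L2" using h_pos m_pos n_pos by auto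
  have pu: "per u" using assms by (simp add: hbound_def)
  have y: "\<bar>w i j\<bar> \<le> (\<Sum>l=1..int n. h * \<bar>w i l\<bar>) / ?L2 + (\<Sum>l=1..int n. h * \<bar>fdiff h False w i l\<bar>)"
    if "per w" for w i j
    using abs_periodic_le[of "w i" n j] that n_pos h_pos
    by (simp add: per_iff fdiff_def shift_def abs_divide sum_distrib_left[symmetric])
  have x: "\<bar>w i j\<bar> \<le> (\<Sum>k=1..int m. h * \<bar>w k j\<bar>) / ?L1 + (\<Sum>k=1..int m. h * \<bar>fdiff h True w k j\<bar>)"
    if "per w" for w i j
    using abs_periodic_le[of "\<lambda>i. w i j" m i] that m_pos h_pos
    by (simp add: per_iff fdiff_def shift_def abs_divide sum_distrib_left[symmetric])
  have y': "(\<Sum>k=1..int m. h * \<bar>w k j\<bar>) \<le>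
      gsum (\<lambda>i j. \<bar>w i j\<bar>) / ?L2 + gsum (\<lambda>i j. \<bar>fdiff h False w i j\<bar>)" if "per w" for w
  proof -
    have "(\<Sum>k=1..int m. h * \<bar>w k j\<bar>) \<le> (\<Sum>k=1..int m. h * ((\<Sum>l=1..int n. h * \<bar>w k l\<bar>) / ?L2 + (\<Sum>l=1..int n. h * \<bar>fdiff h False w k l\<bar>)))"
      using y[OF that] h_pos by (intro sum_mono mult_left_mono) auto
    also have "\<dots> = (\<Sum>k=1..int m. h * (\<Sum>l=1..int n. h * \<bar>w k l\<bar>) / ?L2) + (\<Sum>k=1..int m. h * (\<Sum>l=1..int n. h * \<bar>fdiff h False w k l\<bar>))"
      by (simp add: sum.distrib distrib_left)
    also have "\<dots> = gsum (\<lambda>i j. \<bar>w i j\<bar>) / ?L2 + gsum (\<lambda>i j. \<bar>fdiff h False w i j\<bar>)"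
      unfolding gsum_def sum_divide_distrib[symmetric]
      by (simp add: sum_distrib_left power2_eq_square mult.assoc)
    finally show ?thesis .
  qed
  have 1: "gsum (\<lambda>i j. \<bar>fdiffs h vs u i j\<bar>) \<le> sqrt area * B" if "length vs \<le> 2" for vs
    by (rule order_trans[OF gsum_abs_le mult_left_mono[OF hboundD[OF assms that]]]) (use area_pos in simp)
  have "\<bar>u i j\<bar> \<le> (gsum (\<lambda>i j. \<bar>u i j\<bar>) / ?L2 + gsum (\<lambda>i j. \<bar>fdiff h False u i j\<bar>)) / ?L1 +
     (gsum (\<lambda>i j. \<bar>fdiff h True u i j\<bar>) / ?L2 + gsum (\<lambda>i j. \<bar>fdiff h False (fdiff h True u) i j\<bar>))"
    by (rule order_trans[OF x[OF pu] add_mono[OF divide_right_mono[OF y'[OF pu]] y'[OF per_fdiff[OF pu]]]])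
      (use L in simp)
  also have "\<dots> \<le> (sqrt area * B / ?L2 + sqrt area * B) / ?L1 + (sqrt area * B / ?L2 + sqrt area * B)"
    using 1[of "[]"] 1[of "[False]"] 1[of "[True]"] 1[of "[False, True]"] L
    by (intro add_mono divide_right_mono) auto
  also have "\<dots> = sqrt area * ((1 + 1 / ?L1) * (1 + 1 / ?L2)) * B"
    by (simp add: algebra_simps add_divide_distrib)
  finally show ?thesis .
qed

text \<open>The extremum is taken of \<open>\<mu> * e\<close>, on which the Laplacian acts, and not
  of \<open>e\<close>. At a point where its modulus is largest, the Laplacian has the sign opposite
  to \<open>e\<close>, so that \<open>e\<close> is bounded by \<open>G\<close> there. An upper bound
  of \<mu> enters only at that point, where \<open>e\<close> is already under control. The
  conditional form of the last hypothesis exploits this: in the application \<mu> itself depends on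
  \<open>e\<close>.\<close>

lemma max_principle:
  assumes per: "per e" "per \<mu>" and s: "0 \<le> s"
    and eq: "\<And>i j. e i j - s * dlaplacian h (\<lambda>i j. \<mu> i j * e i j) i j = G i j"
    and G: "\<And>i j. \<bar>G i j\<bar> \<le> r" and b: "0 < b" "\<And>i j. b \<le> \<mu> i j"
    and c: "\<And>i j. \<bar>e i j\<bar> \<le> r \<Longrightarrow> \<mu> i j \<le> c"
  shows "\<bar>e i j\<bar> \<le> c * r / b"
proof -
  let ?v = "\<lambda>i j. \<mu> i j * e i j"
  let ?A = "{1..int m} \<times> {1..int n}"
  have fin: "finite ((\<lambda>(i, j). \<bar>?v i j\<bar>) ` ?A)" "(\<lambda>(i, j). \<bar>?v i j\<bar>) ` ?A \<noteq> {}"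
    using m_pos n_pos by auto
  obtain i0 j0 where ij: "Max ((\<lambda>(i, j). \<bar>?v i j\<bar>) ` ?A) = \<bar>?v i0 j0\<bar>"
    using Max_in[OF fin] by auto
  have pv: "per ?v" by (rule per_comb2[OF per(2,1)])
  have max: "\<bar>?v i j\<bar> \<le> \<bar>?v i0 j0\<bar>" for i j
  proof -
    obtain i' j' where i': "i' \<in> {1..int m}" "j' \<in> {1..int n}" "\<forall>u. per u \<longrightarrow> u i j = u i' j'"
      using per_representative[of i j] by blast
    then have "\<bar>?v i' j'\<bar> \<le> Max ((\<lambda>(i, j). \<bar>?v i j\<bar>) ` ?A)"
      by (intro Max_ge fin) auto
    then show ?thesis using i'(3)[rule_format, OF pv] ij by simp
  qed
  have e: "\<bar>e i0 j0\<bar> \<le> r"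
  proof (cases "0 \<le> e i0 j0")
    case True
    then have v0: "\<bar>?v i0 j0\<bar> = ?v i0 j0" using b(2)[of i0 j0] b(1) by simp
    have le: "?v i j \<le> ?v i0 j0" for i j using max[of i j] v0 by linarith
    have "dlaplacian h ?v i0 j0 \<le> 0"
      unfolding dlaplacian_def using le[of "i0+1" j0] le[of "i0-1" j0] le[of i0 "j0+1"] le[of i0 "j0-1"]
      by (intro divide_nonpos_nonneg) auto
    then have "s * dlaplacian h ?v i0 j0 \<le> 0" using s by (simp add: mult_nonneg_nonpos)
    then show ?thesis using eq[of i0 j0] G[of i0 j0] True by linarith
  next
    case False
    then have v0: "\<bar>?v i0 j0\<bar> = - ?v i0 j0" using b(2)[of i0 j0] b(1) by (simp add: abs_mult)
    have le: "?v i j \<ge> ?v i0 j0" for i j using max[of i j] v0 by linarith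
    have "dlaplacian h ?v i0 j0 \<ge> 0"
      unfolding dlaplacian_def using le[of "i0+1" j0] le[of "i0-1" j0] le[of i0 "j0+1"] le[of i0 "j0-1"]
      by (intro divide_nonneg_nonneg) auto
    then have "s * dlaplacian h ?v i0 j0 \<ge> 0" using s by simp
    then show ?thesis using eq[of i0 j0] G[of i0 j0] False by linarith
  qed
  have r: "0 \<le> r" using e by linarith
  have c0: "0 \<le> c" using c[OF e] b(2)[of i0 j0] b(1) by linarith
  have "b * \<bar>e i j\<bar> \<le> \<mu> i j * \<bar>e i j\<bar>" using b by (intro mult_right_mono) auto
  also have "\<dots> = \<bar>?v i j\<bar>" using b(2)[of i j] b(1) by (simp add: abs_mult)
  also have "\<dots> \<le> \<bar>?v i0 j0\<bar>" by (rule max)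
  also have "\<dots> = \<mu> i0 j0 * \<bar>e i0 j0\<bar>" using b(2)[of i0 j0] b(1) by (simp add: abs_mult)
  also have "\<dots> \<le> c * r" using c[OF e] e c0 by (intro mult_mono) auto
  finally show ?thesis using b(1) by (simp add: field_simps)
qed

subsection \<open>Discrete convolution\<close>

lemma dconv_gsum: "dconv m n h f u i j = gsum (\<lambda>k l. f k l * u (i - k) (j - l))"
  by (simp add: dconv_def gsum_def)

lemma dconv_diff: "dconv m n h f (\<lambda>i j. u i j - w i j) i j = dconv m n h f u i j - dconv m n h f w i j"
  by (simp add: dconv_gsum right_diff_distrib gsum_diff)

lemma dconv_diff_kernel: "dconv m n h (\<lambda>i j. f i j - g i j) u i j = dconv m n h f u i j - dconv m n h g u i j"
  by (simp add: dconv_gsum left_diff_distrib gsum_diff)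

lemma shift_dconv: "shift a b (dconv m n h f u) = dconv m n h f (shift a b u)"
  by (intro ext) (simp add: dconv_gsum shift_def algebra_simps)

lemma fdiff_dconv: "fdiff h v (dconv m n h f u) = dconv m n h f (fdiff h v u)"
proof (intro ext)
  fix i j
  have "fdiff h v (dconv m n h f u) i j = (1 / h) * dconv m n h f (\<lambda>i j. shift (of_bool v) (of_bool (\<not> v)) u i j - u i j) i j"
    unfolding fdiff_def shift_dconv dconv_diff by simp
  also have "\<dots> = dconv m n h f (fdiff h v u) i j"
    unfolding dconv_gsum gsum_scale[symmetric] fdiff_def by simp
  finally show "fdiff h v (dconv m n h f u) i j = dconv m n h f (fdiff h v u) i j" .
qed

lemma fdiffs_dconv: "fdiffs h vs (dconv m n h f u) = dconv m n h f (fdiffs h vs u)"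
  by (induction vs) (auto simp: fdiff_dconv)

lemma shift_dconv_kernel:
  assumes "per f" "per u" shows "shift a b (dconv m n h f u) = dconv m n h (shift a b f) u"
proof (intro ext)
  fix i j
  let ?g = "\<lambda>k l. f k l * u (i + a - k) (j + b - l)"
  have "per ?g"
    using assms by (auto simp: per_iff) (metis add.commute add_diff_cancel_left' diff_add_cancel diff_diff_eq)+
  from gsum_shift[OF this, of a b]
  show "shift a b (dconv m n h f u) i j = dconv m n h (shift a b f) u i j"
    by (simp add: dconv_gsum shift_def)
qed

lemma fdiff_dconv_kernel:
  assumes "per f" "per u"
  shows "fdiff h v (dconv m n h f u) = dconv m n h (fdiff h v f) u"
proof (intro ext)
  fix i j
  have "fdiff h v (dconv m n h f u) i j = (1 / h) * dconv m n h (\<lambda>i j. shift (of_bool v) (of_bool (\<not> v)) f i j - f i j) u i j"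
    unfolding fdiff_def shift_dconv_kernel[OF assms] dconv_diff_kernel by simp
  also have "\<dots> = dconv m n h (fdiff h v f) u i j"
    unfolding dconv_gsum gsum_scale[symmetric] fdiff_def by simp
  finally show "fdiff h v (dconv m n h f u) i j = dconv m n h (fdiff h v f) u i j" .
qed

lemma per_dconv:
  assumes "per u" shows "per (dconv m n h f u)"
proof -
  have "u (i + int m - k) j = u (i - k) j" "u i (j + int n - k) = u i (j - k)" for i j k
    using assms by (metis per_iff add_diff_eq add.commute)+
  then show ?thesis unfolding per_iff dconv_def by simp
qed

lemma nrm_sum: "finite K \<Longrightarrow> nrm (\<lambda>i j. \<Sum>k\<in>K. F k i j) \<le> (\<Sum>k\<in>K. nrm (F k))"
proof (induction rule: finite_induct)
  case empty
  then show ?case using nrm_scale[of 0 "\<lambda>_ _. 0"] by simp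
next
  case (insert k K)
  then show ?case using nrm_add[of "F k" "\<lambda>i j. \<Sum>k\<in>K. F k i j"] by simp
qed

text \<open>Young's inequality: the convolution is a weighted sum of shifts of \<open>u\<close>, all
  of the same norm.\<close>

lemma nrm_dconv:
  assumes "per u" "\<And>i j. \<bar>f i j\<bar> \<le> M"
  shows "nrm (dconv m n h f u) \<le> area * M * nrm u"
proof -
  have M: "0 \<le> M" using assms(2)[of 0 0] by linarith
  let ?K = "{1..int m} \<times> {1..int n}"
  have "dconv m n h f u = (\<lambda>i j. h\<^sup>2 * (\<Sum>k\<in>?K. f (fst k) (snd k) * shift (- fst k) (- snd k) u i j))"
    by (simp add: fun_eq_iff dconv_def shift_def sum.cartesian_product case_prod_unfold)
  then have "nrm (dconv m n h f u) = h\<^sup>2 * nrm (\<lambda>i j. \<Sum>k\<in>?K. f (fst k) (snd k) * shift (- fst k) (- snd k) u i j)"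
    by (simp only: nrm_scale) simp
  also have "\<dots> \<le> h\<^sup>2 * (\<Sum>k\<in>?K. nrm (\<lambda>i j. f (fst k) (snd k) * shift (- fst k) (- snd k) u i j))"
    by (intro mult_left_mono nrm_sum) auto
  also have "\<dots> \<le> h\<^sup>2 * (\<Sum>k\<in>?K. M * nrm u)"
    unfolding nrm_scale nrm_shift[OF assms(1)] using assms(2)
    by (intro mult_left_mono sum_mono mult_right_mono) auto
  also have "\<dots> = area * M * nrm u" by (simp add: power2_eq_square)
  finally show ?thesis .
qed

lemma dconv_sup:
  assumes "\<And>i j. \<bar>u i j\<bar> \<le> B" "\<And>i j. \<bar>f i j\<bar> \<le> M"
  shows "\<bar>dconv m n h f u i j\<bar> \<le> area * M * B"
proof -
  have M: "0 \<le> M" "0 \<le> B" using assms(1)[of 0 0] assms(2)[of 0 0] by linarith+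
  have *: "\<bar>f k l * u (i - k) (j - l)\<bar> \<le> M * B" for k l
    unfolding abs_mult using M assms by (intro mult_mono) auto
  have "dconv m n h f u i j \<le> gsum (\<lambda>k l. M * B)"
    unfolding dconv_gsum using * by (intro gsum_mono) (meson abs_le_D1)
  moreover have "gsum (\<lambda>k l. (-1) * (M * B)) \<le> dconv m n h f u i j"
    unfolding dconv_gsum using * by (intro gsum_mono) (smt (verit) abs_le_D2)
  ultimately show ?thesis unfolding gsum_scale unfolding gsum_const
    by (simp add: abs_le_iff algebra_simps)
qed

lemma sbound_dconv:
  assumes "sbound h k u B" "\<And>i j. \<bar>f i j\<bar> \<le> M"
  shows "sbound h k (dconv m n h f u) (area * M * B)"
  unfolding sbound_def fdiffs_dconv using assms
  by (auto intro!: dconv_sup sboundD)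

text \<open>Convolution gains one difference, because one may be moved to the kernel. In this way
  second differences of the errors control third differences of the nonlocal term.\<close>

lemma hbound_dconv:
  assumes u: "hbound k u B" and f: "per f" "\<And>i j. \<bar>f i j\<bar> \<le> M" "\<And>v i j. \<bar>fdiff h v f i j\<bar> \<le> M"
  shows "hbound (Suc k) (dconv m n h f u) (area * M * B)"
  unfolding hbound_def
proof (intro conjI allI impI)
  have M: "0 \<le> M" using f(2)[of 0 0] by linarith
  have pu: "per u" using u by (simp add: hbound_def)
  then show "per (dconv m n h f u)" by (rule per_dconv)
  have B: "area * M * nrm (fdiffs h ws u) \<le> area * M * B" if "length ws \<le> k" for ws
    using M hboundD[OF u that] h_pos by (intro mult_left_mono) auto
  fix vs :: "bool list" assume l: "length vs \<le> Suc k"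
  show "nrm (fdiffs h vs (dconv m n h f u)) \<le> area * M * B"
  proof (cases vs)
    case Nil
    then show ?thesis using order_trans[OF nrm_dconv[OF pu f(2)] B[of "[]", simplified]] by simp
  next
    case (Cons v ws)
    then have "fdiffs h vs (dconv m n h f u) = dconv m n h (fdiff h v f) (fdiffs h ws u)"
      using fdiff_dconv_kernel[OF f(1) per_fdiffs[OF pu]] by (simp add: fdiffs_dconv)
    moreover have "nrm (dconv m n h (fdiff h v f) (fdiffs h ws u)) \<le> area * M * nrm (fdiffs h ws u)"
      by (intro nrm_dconv per_fdiffs pu f)
    ultimately show ?thesis using B[of ws] l Cons by simp
  qed
qed

text \<open>
  With \<open>P = x + y\<close> and \<open>Q = z + x\<close>, the identity \<open>2 x P = P\<^sup>2 + x\<^sup>2 - y\<^sup>2\<close> makes the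
  extrapolated term \<open>Be (3 x - z) P / 2 = Be (4 x - Q) P / 2\<close> telescope up to
  \<open>Be (P\<^sup>2 - P Q / 2)\<close>, which \<open>Bc P\<^sup>2 / 2\<close> dominates when \<open>Bc > 3 Be\<close>.
\<close>

lemma energy_pointwise:
  fixes Bc Be \<alpha> A X Y Z R :: real
  assumes "3 * Be + \<alpha> \<le> Bc" "0 \<le> Be" "0 < \<alpha>" "0 \<le> A"
  defines "P \<equiv> X + Y" and "Q \<equiv> Z + X"
  shows "- ((A * (P / 2) + Bc * (P / 2) - Be * (3 / 2 * X - 1 / 2 * Z) + R) * P)
    \<le> Be / 4 * Q\<^sup>2 - Be / 4 * P\<^sup>2 + Be * X\<^sup>2 - Be * Y\<^sup>2 + R\<^sup>2 / (2 * \<alpha>)"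
proof -
  have 1: "(3 * Be + \<alpha>) / 2 * P\<^sup>2 \<le> Bc / 2 * P\<^sup>2" using assms(1) by (intro mult_right_mono) auto
  have 2: "0 \<le> A / 2 * P\<^sup>2" using assms(4) by simp
  have 3: "0 \<le> Be / 4 * (P + Q)\<^sup>2" using assms(2) by simp
  have 4: "- (R * P) \<le> \<alpha> / 2 * P\<^sup>2 + R\<^sup>2 / (2 * \<alpha>)"
  proof -
    have "0 \<le> (\<alpha> * P + R)\<^sup>2 / (2 * \<alpha>)" using assms(3) by simp
    also have "\<dots> = \<alpha> / 2 * P\<^sup>2 + R\<^sup>2 / (2 * \<alpha>) + R * P"
      using assms(3) by (simp add: field_simps power2_eq_square)
    finally show ?thesis by simp
  qed
  have "(A * (P / 2) + Bc * (P / 2) - Be * (3 / 2 * X - 1 / 2 * Z) + R) * P =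
     A / 2 * P\<^sup>2 + Bc / 2 * P\<^sup>2 - Be * (P\<^sup>2 + X\<^sup>2 - Y\<^sup>2) + Be / 4 * (P + Q)\<^sup>2
       - Be / 4 * P\<^sup>2 - Be / 4 * Q\<^sup>2 + R * P"
    unfolding P_def Q_def by (simp add: field_simps power2_eq_square)
  moreover have "(3 * Be + \<alpha>) / 2 * P\<^sup>2 = 3 * Be / 2 * P\<^sup>2 + \<alpha> / 2 * P\<^sup>2" by (simp add: field_simps)
  ultimately show ?thesis using 1 2 3 4 by (simp add: algebra_simps)
qed

definition dnrm2 :: "grid_fun \<Rightarrow> real" where
  "dnrm2 u = (nrm (fdiff h True u))\<^sup>2 + (nrm (fdiff h False u))\<^sup>2"

text \<open>Here \<open>z\<close>, \<open>x\<close>, \<open>y\<close> stand for a fixed word of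
  differences of the error at the levels \<open>k - 1\<close>, \<open>k\<close>,
  \<open>k + 1\<close>, and \<open>W\<close> for the same word of the error in the potential. Only
  the gradient of \<open>W\<close> enters, after summation by parts. Its part with coefficient
  \<open>A\<close> has a favourable sign; whatever does not have the displayed form is collected in
  a remainder of norm at most \<rho>, which Young's inequality pays from the margin
  \<alpha>.\<close>

lemma energy_inequality:
  assumes per: "per x" "per y" "per z" "per W" "per \<tau>" and s: "0 \<le> s"
    and eq: "\<And>i j. y i j - x i j = s * dlaplacian h W i j + s * \<tau> i j"
    and B: "3 * Be + \<alpha> \<le> Bc" "0 \<le> Be" "0 < \<alpha>" and A: "\<And>i j. 0 \<le> A i j"
    and R: "\<And>v. nrm (\<lambda>i j. fdiff h v W i j -
          (A i j * (fdiff h v (\<lambda>i j. x i j + y i j) i j / 2) + Bc * (fdiff h v (\<lambda>i j. x i j + y i j) i j / 2)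
            - Be * (3/2 * fdiff h v x i j - 1/2 * fdiff h v z i j))) \<le> \<rho>"
  shows "(nrm y)\<^sup>2 + s * (Be * dnrm2 y + Be / 4 * dnrm2 (\<lambda>i j. x i j + y i j))
      \<le> (nrm x)\<^sup>2 + s * (Be * dnrm2 x + Be / 4 * dnrm2 (\<lambda>i j. z i j + x i j))
        + s * (\<rho>\<^sup>2 / \<alpha>) + s * nrm \<tau> * nrm (\<lambda>i j. x i j + y i j)"
proof -
  let ?p = "\<lambda>i j. x i j + y i j" and ?q = "\<lambda>i j. z i j + x i j"
  have dir: "- gsum (\<lambda>i j. fdiff h v W i j * fdiff h v ?p i j)
    \<le> Be / 4 * (nrm (fdiff h v ?q))\<^sup>2 - Be / 4 * (nrm (fdiff h v ?p))\<^sup>2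
      + Be * (nrm (fdiff h v x))\<^sup>2 - Be * (nrm (fdiff h v y))\<^sup>2 + \<rho>\<^sup>2 / (2 * \<alpha>)" for v
  proof -
    define R' where "R' = (\<lambda>i j. fdiff h v W i j -
          (A i j * (fdiff h v ?p i j / 2) + Bc * (fdiff h v ?p i j / 2)
            - Be * (3/2 * fdiff h v x i j - 1/2 * fdiff h v z i j)))"
    have W: "fdiff h v W i j = A i j * (fdiff h v ?p i j / 2) + Bc * (fdiff h v ?p i j / 2)
            - Be * (3/2 * fdiff h v x i j - 1/2 * fdiff h v z i j) + R' i j" for i j
      by (simp add: R'_def)
    have "- gsum (\<lambda>i j. fdiff h v W i j * fdiff h v ?p i j)
       = gsum (\<lambda>i j. (-1) * (fdiff h v W i j * fdiff h v ?p i j))" unfolding gsum_scale by simp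
    also have "\<dots> \<le> gsum (\<lambda>i j. Be / 4 * (fdiff h v ?q i j)\<^sup>2 - Be / 4 * (fdiff h v ?p i j)\<^sup>2
      + Be * (fdiff h v x i j)\<^sup>2 - Be * (fdiff h v y i j)\<^sup>2 + 1 / (2 * \<alpha>) * (R' i j)\<^sup>2)"
      using energy_pointwise[OF B A]
      by (intro gsum_mono) (simp add: W fdiff_add)
    also have "\<dots> = Be / 4 * (nrm (fdiff h v ?q))\<^sup>2 - Be / 4 * (nrm (fdiff h v ?p))\<^sup>2
      + Be * (nrm (fdiff h v x))\<^sup>2 - Be * (nrm (fdiff h v y))\<^sup>2 + 1 / (2 * \<alpha>) * (nrm R')\<^sup>2"
      unfolding nrm_sq by (simp only: gsum_add gsum_diff gsum_scale)
    also have "\<dots> \<le> Be / 4 * (nrm (fdiff h v ?q))\<^sup>2 - Be / 4 * (nrm (fdiff h v ?p))\<^sup>2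
      + Be * (nrm (fdiff h v x))\<^sup>2 - Be * (nrm (fdiff h v y))\<^sup>2 + 1 / (2 * \<alpha>) * \<rho>\<^sup>2"
      using R[of v] B(3) unfolding R'_def[symmetric]
      by (intro add_left_mono mult_left_mono power_mono) auto
    finally show ?thesis by simp
  qed
  have "(nrm y)\<^sup>2 - (nrm x)\<^sup>2 = gsum (\<lambda>i j. (y i j - x i j) * ?p i j)"
    unfolding nrm_sq gsum_diff[symmetric] by (simp add: power2_eq_square algebra_simps)
  also have "\<dots> = gsum (\<lambda>i j. s * (dlaplacian h W i j * ?p i j) + s * (\<tau> i j * ?p i j))"
    unfolding eq by (simp add: algebra_simps)
  also have "\<dots> = s * gsum (\<lambda>i j. dlaplacian h W i j * ?p i j) + s * gsum (\<lambda>i j. \<tau> i j * ?p i j)"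
    by (simp only: gsum_add gsum_scale)
  also have "gsum (\<lambda>i j. dlaplacian h W i j * ?p i j) = - gsum (\<lambda>i j. fdiff h True W i j * fdiff h True ?p i j)
      + - gsum (\<lambda>i j. fdiff h False W i j * fdiff h False ?p i j)"
    using gsum_by_parts[OF per(4) per_comb2[of x y "(+)"]] per by simp
  also have "s * (- gsum (\<lambda>i j. fdiff h True W i j * fdiff h True ?p i j)
      + - gsum (\<lambda>i j. fdiff h False W i j * fdiff h False ?p i j)) + s * gsum (\<lambda>i j. \<tau> i j * ?p i j)
    \<le> s * ((Be / 4 * (nrm (fdiff h True ?q))\<^sup>2 - Be / 4 * (nrm (fdiff h True ?p))\<^sup>2
      + Be * (nrm (fdiff h True x))\<^sup>2 - Be * (nrm (fdiff h True y))\<^sup>2 + \<rho>\<^sup>2 / (2 * \<alpha>))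
      + (Be / 4 * (nrm (fdiff h False ?q))\<^sup>2 - Be / 4 * (nrm (fdiff h False ?p))\<^sup>2
      + Be * (nrm (fdiff h False x))\<^sup>2 - Be * (nrm (fdiff h False y))\<^sup>2 + \<rho>\<^sup>2 / (2 * \<alpha>)))
      + s * (nrm \<tau> * nrm ?p)"
    using s gsum_mult_le by (intro add_mono mult_left_mono dir) auto
  finally show ?thesis by (simp add: dnrm2_def algebra_simps)
qed

end

subsection \<open>The one-step energy estimate\<close>

text \<open>In the mean \<open>p\<close> and the half increment \<open>q\<close>, \<open>eta\<close>
  is \<open>p ^ 3 + p * q\<^sup>2\<close>. The coefficient of \<epsilon> that is split off is
  nonnegative; \<delta>, whose gradient the energy does not control, always comes with
  \<open>q\<close> or with another error factor.\<close>

lemma eta_diff: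
  "eta a b - eta (a - e0) (b - e1) =
     (let p = (a + b) / 2; q = (b - a) / 2; \<epsilon> = (e0 + e1) / 2; \<delta> = (e1 - e0) / 2
      in (3 * p\<^sup>2 + q\<^sup>2) * \<epsilon> + (2 * (p * q * \<delta>) - p * (3 * (\<epsilon> * \<epsilon>) + \<delta> * \<delta>)
          + \<epsilon> * (\<epsilon> * \<epsilon> + \<delta> * \<delta>) - 2 * (q * (\<epsilon> * \<delta>))))"
  unfolding eta_def Let_def by (simp add: field_simps power2_eq_square)

text \<open>The divided difference is a sum of squares, so \<open>eta\<close> increases in its
  second argument. This is the source of the coefficient \<mu> in the maximum principle.\<close>

lemma eta_diff_right:
  "eta a b - eta a c = ((a + b)\<^sup>2 + (b + c)\<^sup>2 + (a + c)\<^sup>2) / 8 * (b - c)"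
  unfolding eta_def by (simp add: field_simps power2_eq_square)

lemma eta_commute: "eta a b = eta b a"
  by (simp add: eta_def algebra_simps)

lemma sum_squares_le:
  fixes x y z :: real
  assumes "\<bar>x\<bar> \<le> K" "\<bar>y\<bar> \<le> K" "\<bar>z\<bar> \<le> K"
  shows "((x + y)\<^sup>2 + (y + z)\<^sup>2 + (x + z)\<^sup>2) / 8 \<le> (2 * K)\<^sup>2"
proof -
  have "(x + y)\<^sup>2 \<le> (2 * K)\<^sup>2" "(y + z)\<^sup>2 \<le> (2 * K)\<^sup>2" "(x + z)\<^sup>2 \<le> (2 * K)\<^sup>2"
    using assms unfolding abs_le_square_iff[symmetric] by linarith+
  moreover have "A \<le> c \<Longrightarrow> B \<le> c \<Longrightarrow> D \<le> c \<Longrightarrow> 0 \<le> c \<Longrightarrow> (A + B + D) / 8 \<le> c" for A B c D :: real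
    by (subst pos_divide_le_eq) auto
  ultimately show ?thesis using zero_le_power2 by blast
qed

text \<open>In order: the commutator with the coefficient of \<epsilon>, the four nonlinear terms of
  \<open>eta_diff\<close>, and the nonlocal term. \<open>R\<close> is the ratio of the errors to
  \<open>h\<close>, the only argument that changes between the two passes.\<close>

definition rem_const :: "real \<Rightarrow> real \<Rightarrow> real \<Rightarrow> real \<Rightarrow> real \<Rightarrow> real" where
  "rem_const M Cs R MJ a =
     384 * M\<^sup>2 + (256 * (M\<^sup>2 * Cs) + 512 * (M * R) + 1024 * R ^ 3 + 256 * (M * Cs * R) + 2 * (a * MJ))"

abbreviation vdiff :: "real \<Rightarrow> (real \<times> real \<Rightarrow> real) \<Rightarrow> (real \<times> real \<Rightarrow> real) \<Rightarrow> grid_fun" where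
  "vdiff h Jc Je \<equiv> \<lambda>i j. vertex_restr h Jc i j - vertex_restr h Je i j"

lemma dpotential_diff:
  fixes a b am e0 e1 em :: grid_fun
  assumes "0 < h" "0 < m" "0 < n"
  shows "dpotential m n h Jc Je \<gamma>c \<gamma>e am a b i j -
     dpotential m n h Jc Je \<gamma>c \<gamma>e (\<lambda>i j. am i j - em i j) (\<lambda>i j. a i j - e0 i j) (\<lambda>i j. b i j - e1 i j) i j
   = eta (a i j) (b i j) - eta (a i j - e0 i j) (b i j - e1 i j)
     + B_coeff m n h Jc \<gamma>c * ((e0 i j + e1 i j) / 2)
     - B_coeff m n h Je \<gamma>e * (3/2 * e0 i j - 1/2 * em i j)
     - dconv m n h (vdiff h Jc Je) (\<lambda>i j. 3/2 * e0 i j - 1/2 * em i j) i j"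
proof -
  interpret pgrid h m n using assms by unfold_locales
  let ?J = "vdiff h Jc Je"
  have 1: "dconv m n h ?J (\<lambda>i j. 3/2 * (a i j - e0 i j) - 1/2 * (am i j - em i j)) i j =
      dconv m n h ?J (\<lambda>i j. 3/2 * a i j - 1/2 * am i j) i j - dconv m n h ?J (\<lambda>i j. 3/2 * e0 i j - 1/2 * em i j) i j"
    unfolding dconv_diff[symmetric] by (simp add: algebra_simps diff_divide_distrib)
  show ?thesis unfolding dpotential_def Let_def 1 by (simp add: field_simps)
qed

context pgrid
begin

text \<open>Three differences on the left against two on the right: in the term linear in \<delta>
  the factor \<open>q\<close> of size O(h) cancels the \<open>2 / h\<close> of the inverse
  inequality; in the others \<open>hbound_small_mult\<close> does the same for products of
  errors.\<close>

lemma hbound_nonlinear: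
  assumes p: "sbound h 3 p M" "per p" and q: "sbound h 3 q (M * Cs * h)" "per q"
    and M: "1 \<le> M" "1 \<le> R" "0 \<le> Cs" "h \<le> 1"
    and \<epsilon>: "hbound 2 \<epsilon> B" "\<And>i j. \<bar>\<epsilon> i j\<bar> \<le> R * h"
    and \<delta>: "hbound 2 \<delta> B" "\<And>i j. \<bar>\<delta> i j\<bar> \<le> R * h"
  shows "hbound 3 (\<lambda>i j. 2 * (p i j * q i j * \<delta> i j) - p i j * (3 * (\<epsilon> i j * \<epsilon> i j) + \<delta> i j * \<delta> i j)
      + \<epsilon> i j * (\<epsilon> i j * \<epsilon> i j + \<delta> i j * \<delta> i j) - 2 * (q i j * (\<epsilon> i j * \<delta> i j)))
      ((256 * (M\<^sup>2 * Cs) + 512 * (M * R) + 1024 * R ^ 3 + 256 * (M * Cs * R)) * B)"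
proof -
  have B: "0 \<le> B" using \<epsilon> hbound_nonneg by auto
  have per: "per \<epsilon>" "per \<delta>" using \<epsilon> \<delta> by (simp_all add: hbound_def)
  have \<delta>3: "hbound 3 \<delta> (2 / h * B)"
    using hbound_inverse[OF \<delta>(1) M(4)] by (simp add: numeral_3_eq_3 numeral_2_eq_2)
  have 1: "hbound 3 (\<lambda>i j. 2 * (p i j * q i j * \<delta> i j)) (256 * (M\<^sup>2 * Cs) * B)"
  proof -
    have "hbound 3 (\<lambda>i j. 2 * (p i j * q i j * \<delta> i j)) (\<bar>2\<bar> * (2^3 * ((2^3 * (M * (M * Cs * h))) * (2 / h * B))))"
      by (intro hbound_scale hbound_mult sbound_mult p q \<delta>3 per_comb2[where F="(*)"])
    then show ?thesis using h_pos by (simp add: power2_eq_square mult.assoc)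
  qed
  have ee: "hbound 3 (\<lambda>i j. \<epsilon> i j * \<epsilon> i j) (16 * (R * B))"
    and dd: "hbound 3 (\<lambda>i j. \<delta> i j * \<delta> i j) (16 * (R * B))"
    and ed: "hbound 3 (\<lambda>i j. \<epsilon> i j * \<delta> i j) (16 * (R * B))"
    using \<epsilon> \<delta> M by (auto intro!: hbound_small_mult)
  have 2: "hbound 3 (\<lambda>i j. p i j * (3 * (\<epsilon> i j * \<epsilon> i j) + \<delta> i j * \<delta> i j)) (512 * (M * R) * B)"
  proof -
    have "hbound 3 (\<lambda>i j. p i j * (3 * (\<epsilon> i j * \<epsilon> i j) + \<delta> i j * \<delta> i j)) (2^3 * (M * (\<bar>3\<bar> * (16 * (R * B)) + 16 * (R * B))))"
      by (intro hbound_mult hbound_add hbound_scale p ee dd)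
    then show ?thesis by (simp add: algebra_simps)
  qed
  let ?g = "\<lambda>i j. \<epsilon> i j * \<epsilon> i j + \<delta> i j * \<delta> i j"
  have RB: "B \<le> 32 * (R * B)" using mult_right_mono[OF M(2) B] M(2) B by simp
  \<comment> \<open>The cubic term is read as a product of two functions of size O(h): a square of
    an O(h) function is again O(h) as \<open>h \<le> 1\<close>. The common bounds
    \<open>2 * R\<^sup>2 * h\<close> and \<open>32 * (R * B)\<close> dominate both factors because
    \<open>1 \<le> R\<close>.\<close>
  have 3: "hbound 3 (\<lambda>i j. \<epsilon> i j * ?g i j) (1024 * R ^ 3 * B)"
  proof -
    have g: "hbound 3 ?g (32 * (R * B))" using hbound_add[OF ee dd] by (simp add: mult.commute)
    have sq: "x * x \<le> R\<^sup>2 * h" if "\<bar>x\<bar> \<le> R * h" for x :: real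
    proof -
      have "\<bar>x\<bar> * \<bar>x\<bar> \<le> (R * h) * (R * h)" using that M h_pos by (intro mult_mono) auto
      also have "\<dots> = R\<^sup>2 * h * h" by (simp add: power2_eq_square)
      also have "\<dots> \<le> R\<^sup>2 * h * 1" using M h_pos by (intro mult_left_mono) auto
      finally show ?thesis by (simp add: abs_mult[symmetric])
    qed
    have gs: "\<bar>?g i j\<bar> \<le> (2 * R\<^sup>2) * h" for i j
      using sq[OF \<epsilon>(2)[of i j]] sq[OF \<delta>(2)[of i j]] by simp
    have "R \<le> 2 * R\<^sup>2" using M mult_left_mono[of 1 R R] by (simp add: power2_eq_square)
    then have "R * h \<le> (2 * R\<^sup>2) * h" using h_pos by (intro mult_right_mono) auto
    then have es: "\<bar>\<epsilon> i j\<bar> \<le> (2 * R\<^sup>2) * h" for i j using \<epsilon>(2)[of i j] by linarith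
    have "hbound 3 (\<lambda>i j. \<epsilon> i j * ?g i j) (16 * (2 * R\<^sup>2 * (32 * (R * B))))"
      using g RB by (intro hbound_small_mult hbound_mono[OF \<epsilon>(1)] hbound_mono[OF g] es gs M(4)) auto
    then show ?thesis by (simp add: power2_eq_square power3_eq_cube mult.assoc)
  qed
  have 4: "hbound 3 (\<lambda>i j. 2 * (q i j * (\<epsilon> i j * \<delta> i j))) (256 * (M * Cs * R) * B)"
  proof -
    have "hbound 3 (\<lambda>i j. 2 * (q i j * (\<epsilon> i j * \<delta> i j))) (\<bar>2\<bar> * (2^3 * (M * Cs * h * (16 * (R * B)))))"
      by (intro hbound_scale hbound_mult q ed)
    moreover have "M * Cs * (R * B) * h \<le> M * Cs * (R * B) * 1"
      using M B by (intro mult_left_mono) auto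
    ultimately show ?thesis by (elim hbound_mono) (auto simp: algebra_simps)
  qed
  show ?thesis using hbound_diff[OF hbound_add[OF hbound_diff[OF 1 2] 3] 4]
    by (simp add: algebra_simps)
qed

text \<open>What is subtracted from the potential error is the part that
  \<open>energy_inequality\<close> treats exactly. The rest is of lower order: three of its
  differences cost only two differences of the errors. For the principal coefficient
  \<open>A\<close> this is the commutator bound.\<close>

lemma potential_error_bound:
  fixes a b am e0 e1 em :: grid_fun and \<gamma>c \<gamma>e :: real
  assumes per: "per a" "per b" and a: "sbound h 3 a M" "sbound h 3 b M" "sbound h 3 (\<lambda>i j. b i j - a i j) (M * s)"
    and s: "0 \<le> s" "s \<le> Cs * h" and M: "1 \<le> M" "1 \<le> R" "0 \<le> Cs" "h \<le> 1"
    and e: "hbound 2 em B" "hbound 2 e0 B" "hbound 2 e1 B"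
    and es: "\<And>i j. \<bar>e0 i j\<bar> \<le> R * h" "\<And>i j. \<bar>e1 i j\<bar> \<le> R * h"
    and J: "per (vdiff h Jc Je)" "\<And>i j. \<bar>vdiff h Jc Je i j\<bar> \<le> MJ" "\<And>v i j. \<bar>fdiff h v (vdiff h Jc Je) i j\<bar> \<le> MJ"
  defines "W \<equiv> \<lambda>i j. dpotential m n h Jc Je \<gamma>c \<gamma>e am a b i j -
     dpotential m n h Jc Je \<gamma>c \<gamma>e (\<lambda>i j. am i j - em i j) (\<lambda>i j. a i j - e0 i j) (\<lambda>i j. b i j - e1 i j) i j"
    and "A \<equiv> \<lambda>i j. 3 * ((a i j + b i j) / 2)\<^sup>2 + ((b i j - a i j) / 2)\<^sup>2"
  assumes vs: "length vs \<le> 3"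
  shows "nrm (\<lambda>i j. fdiffs h vs W i j -
     (A i j * fdiffs h vs (\<lambda>i j. (e0 i j + e1 i j) / 2) i j
       + B_coeff m n h Jc \<gamma>c * fdiffs h vs (\<lambda>i j. (e0 i j + e1 i j) / 2) i j
       - B_coeff m n h Je \<gamma>e * fdiffs h vs (\<lambda>i j. 3/2 * e0 i j - 1/2 * em i j) i j))
     \<le> rem_const M Cs R MJ area * B"
    and "per W"
proof -
  have pere: "per em" "per e0" "per e1" using e by (simp_all add: hbound_def)
  define p where "p = (\<lambda>i j. (a i j + b i j) / 2)"
  define q where "q = (\<lambda>i j. (b i j - a i j) / 2)"
  define \<epsilon> where "\<epsilon> = (\<lambda>i j. (e0 i j + e1 i j) / 2)"
  define \<delta> where "\<delta> = (\<lambda>i j. (e1 i j - e0 i j) / 2)"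
  define g where "g = (\<lambda>i j. 3/2 * e0 i j - 1/2 * em i j)"
  let ?J = "vdiff h Jc Je"
  let ?c = "B_coeff m n h Jc \<gamma>c" and ?e = "B_coeff m n h Je \<gamma>e"
  have pp: "per p" "per q"
    unfolding p_def q_def using per per_comb2[where F="\<lambda>x y. (x + y) / 2" and u=a and w=b]
      per_comb2[where F="\<lambda>x y. (x - y) / 2" and u=b and w=a] by auto
  have sp: "sbound h 3 p M"
    using sbound_scale[OF sbound_add[OF a(1,2)], of "1/2"] by (simp add: p_def)
  have sq: "sbound h 3 q M"
    using sbound_scale[OF sbound_diff[OF a(2,1)], of "1/2"] by (simp add: q_def)
  have sq': "sbound h 3 q (M * Cs * h)"
  proof -
    have "M * s / 2 \<le> M * s" using M s by simp
    also have "\<dots> \<le> M * (Cs * h)" using M s by (intro mult_left_mono) auto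
    finally show ?thesis using sbound_mono[OF sbound_scale[OF a(3), of "1/2"]]
      by (simp add: q_def mult.assoc)
  qed
  have h\<epsilon>: "hbound 2 \<epsilon> B" using hbound_scale[OF hbound_add[OF e(2,3)], of "1/2"] by (simp add: \<epsilon>_def)
  have h\<delta>: "hbound 2 \<delta> B" using hbound_scale[OF hbound_diff[OF e(3,2)], of "1/2"] by (simp add: \<delta>_def)
  have hg: "hbound 2 g (2 * B)"
    using hbound_diff[OF hbound_scale[OF e(2), of "3/2"] hbound_scale[OF e(1), of "1/2"]] by (simp add: g_def)
  have s\<epsilon>: "\<bar>\<epsilon> i j\<bar> \<le> R * h" "\<bar>\<delta> i j\<bar> \<le> R * h" for i j
    using es[of i j] unfolding \<epsilon>_def \<delta>_def by (simp_all add: abs_le_iff)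
  let ?N = "\<lambda>i j. 2 * (p i j * q i j * \<delta> i j) - p i j * (3 * (\<epsilon> i j * \<epsilon> i j) + \<delta> i j * \<delta> i j)
      + \<epsilon> i j * (\<epsilon> i j * \<epsilon> i j + \<delta> i j * \<delta> i j) - 2 * (q i j * (\<epsilon> i j * \<delta> i j))"
  have eta: "eta (a i j) (b i j) - eta (a i j - e0 i j) (b i j - e1 i j) = A i j * \<epsilon> i j + ?N i j" for i j
    unfolding eta_diff Let_def A_def p_def q_def \<epsilon>_def \<delta>_def by (rule refl)
  define N where "N = (\<lambda>i j. ?N i j - dconv m n h ?J g i j)"
  have W: "W = (\<lambda>i j. A i j * \<epsilon> i j + ?c * \<epsilon> i j - ?e * g i j + N i j)"
  proof (intro ext)
    fix i j
    have "W i j = (eta (a i j) (b i j) - eta (a i j - e0 i j) (b i j - e1 i j))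
        + ?c * \<epsilon> i j - ?e * g i j - dconv m n h ?J g i j"
      unfolding W_def dpotential_diff[OF h_pos m_pos n_pos] \<epsilon>_def g_def by (rule refl)
    then show "W i j = A i j * \<epsilon> i j + ?c * \<epsilon> i j - ?e * g i j + N i j"
      unfolding eta N_def by simp
  qed
  have rest: "hbound 3 N
     ((256 * (M\<^sup>2 * Cs) + 512 * (M * R) + 1024 * R ^ 3 + 256 * (M * Cs * R)) * B + area * MJ * (2 * B))"
  proof -
    have "hbound 3 (dconv m n h ?J g) (area * MJ * (2 * B))"
      using hbound_dconv[OF hg J] by (simp add: numeral_3_eq_3 numeral_2_eq_2)
    from hbound_diff[OF hbound_nonlinear[OF sp pp(1) sq' pp(2) M h\<epsilon> s\<epsilon>(1) h\<delta> s\<epsilon>(2)] this]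
    show ?thesis unfolding N_def .
  qed
  have A: "sbound h 3 A (32 * M\<^sup>2)"
    using sbound_add[OF sbound_scale[OF sbound_mult[OF sp sp], of 3] sbound_mult[OF sq sq]]
    by (simp add: A_def p_def q_def power2_eq_square)
  have pA: "per A"
    unfolding A_def using per_comb2[where F="\<lambda>x y. 3 * ((x + y) / 2)\<^sup>2 + ((y - x) / 2)\<^sup>2", OF per] .
  have comm: "nrm (\<lambda>i j. fdiffs h vs (\<lambda>i j. A i j * \<epsilon> i j) i j - A i j * fdiffs h vs \<epsilon> i j) \<le> 384 * M\<^sup>2 * B"
    using commutator_bound[of 2 A "32 * M\<^sup>2" \<epsilon> B vs] A h\<epsilon> pA vs by (simp add: numeral_3_eq_3)
  have split: "(\<lambda>i j. fdiffs h vs W i j - (A i j * fdiffs h vs \<epsilon> i j + ?c * fdiffs h vs \<epsilon> i j - ?e * fdiffs h vs g i j))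
     = (\<lambda>i j. (fdiffs h vs (\<lambda>i j. A i j * \<epsilon> i j) i j - A i j * fdiffs h vs \<epsilon> i j) + fdiffs h vs N i j)"
    unfolding W fdiffs_add[where u="\<lambda>i j. A i j * \<epsilon> i j + ?c * \<epsilon> i j - ?e * g i j"]
      fdiffs_diff[where u="\<lambda>i j. A i j * \<epsilon> i j + ?c * \<epsilon> i j"] fdiffs_add[where u="\<lambda>i j. A i j * \<epsilon> i j"]
      fdiffs_scale by (simp add: fun_eq_iff)
  have "nrm (fdiffs h vs N) \<le>
     (256 * (M\<^sup>2 * Cs) + 512 * (M * R) + 1024 * R ^ 3 + 256 * (M * Cs * R)) * B + area * MJ * (2 * B)"
    by (rule hboundD[OF rest vs])
  then have "nrm (\<lambda>i j. fdiffs h vs W i j - (A i j * fdiffs h vs \<epsilon> i j + ?c * fdiffs h vs \<epsilon> i j - ?e * fdiffs h vs g i j))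
     \<le> 384 * M\<^sup>2 * B + ((256 * (M\<^sup>2 * Cs) + 512 * (M * R) + 1024 * R ^ 3 + 256 * (M * Cs * R)) * B + area * MJ * (2 * B))"
    unfolding split by (intro order_trans[OF nrm_add add_mono[OF comm]])
  also have "\<dots> = rem_const M Cs R MJ area * B"
    by (simp add: rem_const_def distrib_left distrib_right)
  finally show "nrm (\<lambda>i j. fdiffs h vs W i j -
     (A i j * fdiffs h vs (\<lambda>i j. (e0 i j + e1 i j) / 2) i j
       + ?c * fdiffs h vs (\<lambda>i j. (e0 i j + e1 i j) / 2) i j
       - ?e * fdiffs h vs (\<lambda>i j. 3/2 * e0 i j - 1/2 * em i j) i j))
     \<le> rem_const M Cs R MJ area * B"
    unfolding \<epsilon>_def g_def .
  have "per N" using rest by (simp add: hbound_def)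
  moreover have "per \<epsilon>" "per g" using h\<epsilon> hg by (simp_all add: hbound_def)
  ultimately show "per W" unfolding W using pA by (simp add: per_iff)
qed

lemma finite_words: "finite {vs :: bool list. length vs \<le> 2}"
  using finite_lists_length_le[of "UNIV :: bool set" 2] by simp

lemma card_words: "card {vs :: bool list. length vs \<le> 2} = 7"
  using card_lists_length_le[of "UNIV :: bool set" 2] by (simp add: numeral_2_eq_2)

definition sob2 :: "grid_fun \<Rightarrow> real" where
  "sob2 u = (\<Sum>vs | length vs \<le> 2. (nrm (fdiffs h vs u))\<^sup>2)"

text \<open>The terms with factor \<open>s\<close> are those that telescope in
  \<open>energy_inequality\<close>. They are nonnegative and are discarded when the energy is
  compared with \<open>sob2\<close>. The sum runs over 1 + 2 + 4 = 7 words, so the mixed second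
  difference counts twice.\<close>

definition energy :: "real \<Rightarrow> real \<Rightarrow> grid_fun \<Rightarrow> grid_fun \<Rightarrow> real" where
  "energy s Be z x = (\<Sum>vs | length vs \<le> 2. (nrm (fdiffs h vs x))\<^sup>2
     + s * (Be * dnrm2 (fdiffs h vs x) + Be / 4 * dnrm2 (fdiffs h vs (\<lambda>i j. z i j + x i j))))"

lemma sob2_nonneg: "0 \<le> sob2 u"
  unfolding sob2_def by (intro sum_nonneg) auto

lemma sob2_le_energy: "0 \<le> s \<Longrightarrow> 0 \<le> Be \<Longrightarrow> sob2 x \<le> energy s Be z x"
  unfolding sob2_def energy_def by (intro sum_mono) (simp add: dnrm2_def)

lemma hbound_sob2: 
  assumes "per u" "sob2 u \<le> B\<^sup>2" "0 \<le> B" shows "hbound 2 u B"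
  unfolding hbound_def
proof (intro conjI allI impI)
  fix vs :: "bool list" assume "length vs \<le> 2"
  then have "(nrm (fdiffs h vs u))\<^sup>2 \<le> sob2 u"
    unfolding sob2_def by (intro member_le_sum finite_words) auto
  then have "(nrm (fdiffs h vs u))\<^sup>2 \<le> B\<^sup>2" using assms by linarith
  then show "nrm (fdiffs h vs u) \<le> B" using assms(3) by (rule power2_le_imp_le)
qed (rule assms)

lemma energy_step:
  fixes a b am e0 e1 em \<tau> :: grid_fun
  assumes per: "per a" "per b" and a: "sbound h 3 a M" "sbound h 3 b M" "sbound h 3 (\<lambda>i j. b i j - a i j) (M * s)"
    and s: "0 \<le> s" "s \<le> Cs * h" and M: "1 \<le> M" "1 \<le> R" "0 \<le> Cs" "h \<le> 1"
    and pe: "per em" "per e0" "per e1" "per \<tau>"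
    and es: "\<And>i j. \<bar>e0 i j\<bar> \<le> R * h" "\<And>i j. \<bar>e1 i j\<bar> \<le> R * h"
    and J: "per (vdiff h Jc Je)" "\<And>i j. \<bar>vdiff h Jc Je i j\<bar> \<le> MJ" "\<And>v i j. \<bar>fdiff h v (vdiff h Jc Je) i j\<bar> \<le> MJ"
    and B: "3 * B_coeff m n h Je \<gamma>e + \<alpha> \<le> B_coeff m n h Jc \<gamma>c" "0 \<le> B_coeff m n h Je \<gamma>e" "0 < \<alpha>"
    and eq: "\<And>i j. e1 i j - e0 i j = s * dlaplacian h (\<lambda>i j. dpotential m n h Jc Je \<gamma>c \<gamma>e am a b i j -
     dpotential m n h Jc Je \<gamma>c \<gamma>e (\<lambda>i j. am i j - em i j) (\<lambda>i j. a i j - e0 i j) (\<lambda>i j. b i j - e1 i j) i j) i j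
       + s * \<tau> i j"
    and \<theta>: "hbound 2 \<tau> \<theta>"
  shows "energy s (B_coeff m n h Je \<gamma>e) e0 e1 \<le> energy s (B_coeff m n h Je \<gamma>e) em e0
     + s * (7 * ((rem_const M Cs R MJ area)\<^sup>2 / \<alpha>) * (sob2 em + sob2 e0 + sob2 e1))
     + s * \<theta> * (\<Sum>vs | length vs \<le> 2. nrm (fdiffs h vs (\<lambda>i j. e0 i j + e1 i j)))"
proof -
  define W where "W = (\<lambda>i j. dpotential m n h Jc Je \<gamma>c \<gamma>e am a b i j -
     dpotential m n h Jc Je \<gamma>c \<gamma>e (\<lambda>i j. am i j - em i j) (\<lambda>i j. a i j - e0 i j) (\<lambda>i j. b i j - e1 i j) i j)"
  define A where "A = (\<lambda>i j. 3 * ((a i j + b i j) / 2)\<^sup>2 + ((b i j - a i j) / 2)\<^sup>2)"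
  let ?c = "B_coeff m n h Jc \<gamma>c" and ?e = "B_coeff m n h Je \<gamma>e"
  let ?H = "sob2 em + sob2 e0 + sob2 e1"
  \<comment> \<open>One number for all three levels. It contains the new level \<open>e1\<close>, so
    the resulting inequality is implicit; the factor \<open>s\<close> allows this to be absorbed
    later.\<close>
  define H where "H = sqrt ?H"
  have H0: "0 \<le> ?H" using sob2_nonneg by (simp add: add_nonneg_nonneg)
  then have H: "0 \<le> H" "H\<^sup>2 = ?H" by (simp_all add: H_def)
  have hb: "hbound 2 em H" "hbound 2 e0 H" "hbound 2 e1 H"
    using sob2_nonneg[of em] sob2_nonneg[of e0] sob2_nonneg[of e1] H pe
    by (auto intro!: hbound_sob2)
  note pb = potential_error_bound[OF per a s M hb es J, where am=am and \<gamma>c=\<gamma>c and \<gamma>e=\<gamma>e, folded W_def A_def]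
  have pW: "per W" using pb(2)[of "[]"] by simp
  have one: "(nrm (fdiffs h vs e1))\<^sup>2 + s * (?e * dnrm2 (fdiffs h vs e1) + ?e / 4 * dnrm2 (fdiffs h vs (\<lambda>i j. e0 i j + e1 i j)))
    \<le> (nrm (fdiffs h vs e0))\<^sup>2 + s * (?e * dnrm2 (fdiffs h vs e0) + ?e / 4 * dnrm2 (fdiffs h vs (\<lambda>i j. em i j + e0 i j)))
      + s * ((rem_const M Cs R MJ area * H)\<^sup>2 / \<alpha>) + s * \<theta> * nrm (fdiffs h vs (\<lambda>i j. e0 i j + e1 i j))"
    if vs: "length vs \<le> 2" for vs
  proof -
    have "(nrm (fdiffs h vs e1))\<^sup>2 + s * (?e * dnrm2 (fdiffs h vs e1) + ?e / 4 * dnrm2 (\<lambda>i j. fdiffs h vs e0 i j + fdiffs h vs e1 i j))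
    \<le> (nrm (fdiffs h vs e0))\<^sup>2 + s * (?e * dnrm2 (fdiffs h vs e0) + ?e / 4 * dnrm2 (\<lambda>i j. fdiffs h vs em i j + fdiffs h vs e0 i j))
      + s * ((rem_const M Cs R MJ area * H)\<^sup>2 / \<alpha>) + s * nrm (fdiffs h vs \<tau>) * nrm (\<lambda>i j. fdiffs h vs e0 i j + fdiffs h vs e1 i j)"
    proof (rule energy_inequality[where W="fdiffs h vs W" and A=A and Bc="?c"])
      show "per (fdiffs h vs e0)" "per (fdiffs h vs e1)" "per (fdiffs h vs em)" "per (fdiffs h vs W)" "per (fdiffs h vs \<tau>)"
        by (intro per_fdiffs pe pW)+
      have "(\<lambda>i j. e1 i j - e0 i j) = (\<lambda>i j. s * dlaplacian h W i j + s * \<tau> i j)"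
        using eq by (simp add: W_def fun_eq_iff)
      then have "fdiffs h vs (\<lambda>i j. e1 i j - e0 i j) = fdiffs h vs (\<lambda>i j. s * dlaplacian h W i j + s * \<tau> i j)" by simp
      then show "fdiffs h vs e1 i j - fdiffs h vs e0 i j = s * dlaplacian h (fdiffs h vs W) i j + s * fdiffs h vs \<tau> i j" for i j
        unfolding fdiffs_diff fdiffs_add fdiffs_scale fdiffs_dlaplacian by (simp add: fun_eq_iff)
      show "0 \<le> A i j" for i j by (simp add: A_def)
      fix v
      have "length (v # vs) \<le> 3" using vs by simp
      moreover have "fdiffs h (v # vs) (\<lambda>i j. (e0 i j + e1 i j) / 2) =
          (\<lambda>i j. fdiff h v (\<lambda>i j. fdiffs h vs e0 i j + fdiffs h vs e1 i j) i j / 2)"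
        using fdiffs_scale[of h "v # vs" "1/2" "\<lambda>i j. e0 i j + e1 i j"]
        by (simp add: fdiffs_add fdiff_add)
      moreover have "fdiffs h (v # vs) (\<lambda>i j. 3/2 * e0 i j - 1/2 * em i j) =
          (\<lambda>i j. 3/2 * fdiff h v (fdiffs h vs e0) i j - 1/2 * fdiff h v (fdiffs h vs em) i j)"
        unfolding fdiffs_diff fdiffs_scale by simp
      ultimately show "nrm (\<lambda>i j. fdiff h v (fdiffs h vs W) i j -
          (A i j * (fdiff h v (\<lambda>i j. fdiffs h vs e0 i j + fdiffs h vs e1 i j) i j / 2)
            + ?c * (fdiff h v (\<lambda>i j. fdiffs h vs e0 i j + fdiffs h vs e1 i j) i j / 2)
            - ?e * (3/2 * fdiff h v (fdiffs h vs e0) i j - 1/2 * fdiff h v (fdiffs h vs em) i j)))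
          \<le> rem_const M Cs R MJ area * H"
        using pb(1)[of "v # vs"] unfolding A_def by (simp only: fdiffs.simps)
    qed (use s B in auto)
    moreover have "s * nrm (fdiffs h vs \<tau>) * nrm (\<lambda>i j. fdiffs h vs e0 i j + fdiffs h vs e1 i j)
      \<le> s * \<theta> * nrm (\<lambda>i j. fdiffs h vs e0 i j + fdiffs h vs e1 i j)"
      using s hboundD[OF \<theta> vs] by (intro mult_right_mono mult_left_mono) auto
    ultimately show ?thesis unfolding fdiffs_add by linarith
  qed
  have "energy s ?e e0 e1 \<le> (\<Sum>vs | length vs \<le> 2. (nrm (fdiffs h vs e0))\<^sup>2 + s * (?e * dnrm2 (fdiffs h vs e0) + ?e / 4 * dnrm2 (fdiffs h vs (\<lambda>i j. em i j + e0 i j)))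
      + s * ((rem_const M Cs R MJ area * H)\<^sup>2 / \<alpha>) + s * \<theta> * nrm (fdiffs h vs (\<lambda>i j. e0 i j + e1 i j)))"
    unfolding energy_def using one by (intro sum_mono) simp
  also have "\<dots> = energy s ?e em e0 + 7 * (s * ((rem_const M Cs R MJ area * H)\<^sup>2 / \<alpha>))
     + s * \<theta> * (\<Sum>vs | length vs \<le> 2. nrm (fdiffs h vs (\<lambda>i j. e0 i j + e1 i j)))"
    unfolding energy_def sum.distrib sum_distrib_left[symmetric] by (simp add: card_words)
  finally show ?thesis by (simp add: power_mult_distrib H(2) mult_ac)
qed

end

lemma nat_le_of_mult_le:
  assumes "real k * s \<le> T" "j \<le> k" "0 \<le> (s :: real)"
  shows "real j * s \<le> T"
  by (rule order_trans[OF mult_right_mono assms(1)]) (use assms in auto)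

subsection \<open>The error estimate on the grid\<close>

text \<open>From \<open>5 * x \<le> 1\<close> follow both
  \<open>1 + 3 * x \<le> (1 + 5 * x) * (1 - x)\<close> and
  \<open>1 + 3 * x \<le> 2 * (1 - x)\<close>. The first conclusion can be iterated over all time
  steps; the second is a loss independent of \<open>x\<close>, affordable in a single provisional
  step.\<close>

lemma gronwall_factor:
  fixes x F E :: real
  assumes "F * (1 - x) \<le> E * (1 + 3 * x)" "0 \<le> x" "5 * x \<le> 1" "0 \<le> E"
  shows "F \<le> E * exp (5 * x)" and "F \<le> 2 * E"
proof -
  have x: "0 < 1 - x" using assms by linarith
  have F: "F \<le> E * (1 + 3 * x) / (1 - x)" using assms(1) x by (simp add: pos_le_divide_eq)
  have "(1 + 3 * x) \<le> (1 + 5 * x) * (1 - x)"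
    using mult_left_mono[OF assms(3,2)] by (simp add: algebra_simps)
  also have "\<dots> \<le> exp (5 * x) * (1 - x)"
    using x exp_ge_add_one_self[of "5 * x"] by (intro mult_right_mono) auto
  finally have "E * (1 + 3 * x) / (1 - x) \<le> E * exp (5 * x)"
    using x assms(4) by (simp add: pos_divide_le_eq mult_left_mono mult.assoc)
  with F show "F \<le> E * exp (5 * x)" by linarith
  have "E * (1 + 3 * x) \<le> E * (2 * (1 - x))" using assms by (intro mult_left_mono) auto
  then have "E * (1 + 3 * x) / (1 - x) \<le> 2 * E" using x by (simp add: pos_divide_le_eq mult_ac)
  with F show "F \<le> 2 * E" by linarith
qed

lemma abs_dlaplacian_le:
  assumes "\<And>i j. \<bar>u i j\<bar> \<le> C"
  shows "\<bar>dlaplacian h u i j\<bar> \<le> 8 * C / h\<^sup>2"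
proof -
  have "\<bar>u (i + 1) j + u (i - 1) j + u i (j + 1) + u i (j - 1) - 4 * u i j\<bar> \<le> 8 * C"
    using assms[of "i+1" j] assms[of "i-1" j] assms[of i "j+1"] assms[of i "j-1"] assms[of i j]
    by linarith
  then show ?thesis by (simp add: dlaplacian_def abs_divide divide_right_mono)
qed

context pgrid
begin

text \<open>No bound on \<open>e1\<close> is presupposed. The error in the potential is
  \<open>\<mu> * e1 + \<kappa>\<close>, where \<kappa> involves only errors of earlier levels and is
  O(\<open>h\<^sup>2\<close>). Although \<mu> depends on \<open>e1\<close>, it is bounded below by
  half of \<open>B_coeff\<close> for \<open>Jc\<close>, and above wherever
  \<open>\<bar>e1\<bar> \<le> g * h \<le> 1\<close>, which is all that \<open>max_principle\<close>
  asks.\<close>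

lemma a_priori_bound:
  fixes a b am e0 e1 em \<tau> :: grid_fun and \<gamma>c \<gamma>e :: real
  assumes per: "per a" "per b" "per e0" "per e1"
    and ab: "\<And>i j. \<bar>a i j\<bar> \<le> M" "\<And>i j. \<bar>b i j\<bar> \<le> M"
    and e: "\<And>i j. \<bar>em i j\<bar> \<le> K * h\<^sup>2" "\<And>i j. \<bar>e0 i j\<bar> \<le> K * h\<^sup>2" and K: "0 \<le> K" "K * h\<^sup>2 \<le> 1"
    and J: "\<And>i j. \<bar>vdiff h Jc Je i j\<bar> \<le> MJ"
    and B: "B_coeff m n h Jc \<gamma>c \<le> MB" "\<bar>B_coeff m n h Je \<gamma>e\<bar> \<le> MB" "\<alpha> \<le> B_coeff m n h Jc \<gamma>c" "0 < \<alpha>"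
    and s: "0 \<le> s" "s \<le> Cs * h" "h \<le> 1"
    and \<tau>: "\<And>i j. \<bar>\<tau> i j\<bar> \<le> \<theta>"
    and g: "K + Cs * \<theta> + 8 * Cs * (4 * (M + 1)\<^sup>2 + 3 * MB + 2 * (area * MJ)) * K \<le> g" "g * h \<le> 1"
    and eq: "\<And>i j. e1 i j - e0 i j = s * dlaplacian h (\<lambda>i j. dpotential m n h Jc Je \<gamma>c \<gamma>e am a b i j -
     dpotential m n h Jc Je \<gamma>c \<gamma>e (\<lambda>i j. am i j - em i j) (\<lambda>i j. a i j - e0 i j) (\<lambda>i j. b i j - e1 i j) i j) i j
       + s * \<tau> i j"
  shows "\<bar>e1 i j\<bar> \<le> (4 * (M + 1)\<^sup>2 + MB) * (g * h) / (\<alpha> / 2)"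
proof -
  let ?c = "B_coeff m n h Jc \<gamma>c" and ?e = "B_coeff m n h Je \<gamma>e"
  let ?r = "K * h\<^sup>2"
  define c\<kappa> where "c\<kappa> = 4 * (M + 1)\<^sup>2 + 3 * MB + 2 * (area * MJ)"
  define a' where "a' = (\<lambda>i j. a i j - e0 i j)"
  define c where "c = (\<lambda>i j. b i j - e1 i j)"
  define \<mu> where "\<mu> = (\<lambda>i j. ((a' i j + b i j)\<^sup>2 + (b i j + c i j)\<^sup>2 + (a' i j + c i j)\<^sup>2) / 8 + ?c / 2)"
  define f where "f = (\<lambda>i j. 3/2 * e0 i j - 1/2 * em i j)"
  define \<kappa> where "\<kappa> = (\<lambda>i j. ((b i j + a i j)\<^sup>2 + (a i j + a' i j)\<^sup>2 + (b i j + a' i j)\<^sup>2) / 8 * e0 i j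
      + ?c * (e0 i j / 2) - ?e * f i j - dconv m n h (vdiff h Jc Je) f i j)"
  have M: "0 \<le> M" "0 \<le> MJ" "0 \<le> MB" using ab(1)[of 0 0] J[of 0 0] B(2) by linarith+
  have \<theta>0: "0 \<le> \<theta>" using \<tau>[of 0 0] by linarith
  have "0 \<le> Cs * h" using s by linarith
  then have Cs: "0 \<le> Cs" using h_pos by (simp add: zero_le_mult_iff)
  have r0: "0 \<le> ?r" using K by simp
  have c\<kappa>0: "0 \<le> c\<kappa>" unfolding c\<kappa>_def using M h_pos by (intro add_nonneg_nonneg) auto
  have pot: "dpotential m n h Jc Je \<gamma>c \<gamma>e am a b i j -
     dpotential m n h Jc Je \<gamma>c \<gamma>e (\<lambda>i j. am i j - em i j) (\<lambda>i j. a i j - e0 i j) (\<lambda>i j. b i j - e1 i j) i j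
     = \<mu> i j * e1 i j + \<kappa> i j" for i j
  proof -
    \<comment> \<open>The first argument is changed first, at the known second argument
      \<open>b\<close>; thus the coefficient of \<open>e0\<close> does not involve the unknown
      \<open>c\<close>.\<close>
    have "eta (a i j) (b i j) - eta (a' i j) (c i j)
      = (eta (b i j) (a i j) - eta (b i j) (a' i j)) + (eta (a' i j) (b i j) - eta (a' i j) (c i j))"
      by (simp add: eta_commute[of "b i j"])
    also have "\<dots> = ((b i j + a i j)\<^sup>2 + (a i j + a' i j)\<^sup>2 + (b i j + a' i j)\<^sup>2) / 8 * e0 i j
       + ((a' i j + b i j)\<^sup>2 + (b i j + c i j)\<^sup>2 + (a' i j + c i j)\<^sup>2) / 8 * e1 i j"
      unfolding eta_diff_right by (simp add: a'_def c_def)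
    finally have eta: "eta (a i j) (b i j) - eta (a i j - e0 i j) (b i j - e1 i j) = \<dots>"
      by (simp add: a'_def c_def)
    show ?thesis
      unfolding dpotential_diff[OF h_pos m_pos n_pos] eta
      by (simp add: \<mu>_def \<kappa>_def f_def algebra_simps)
  qed
  have f: "\<bar>f i j\<bar> \<le> 2 * ?r" for i j
    using e[of i j] unfolding f_def by linarith
  have a': "\<bar>a' i j\<bar> \<le> M + 1" for i j
    using ab(1)[of i j] e(2)[of i j] K unfolding a'_def by linarith
  have \<kappa>: "\<bar>\<kappa> i j\<bar> \<le> c\<kappa> * ?r" for i j
  proof -
    have "((b i j + a i j)\<^sup>2 + (a i j + a' i j)\<^sup>2 + (b i j + a' i j)\<^sup>2) / 8 \<le> (2 * (M + 1))\<^sup>2"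
      using ab[of i j] a'[of i j] by (intro sum_squares_le) auto
    then have "\<bar>((b i j + a i j)\<^sup>2 + (a i j + a' i j)\<^sup>2 + (b i j + a' i j)\<^sup>2) / 8\<bar> \<le> 4 * (M + 1)\<^sup>2"
      unfolding power_mult_distrib by simp
    then have 1: "\<bar>((b i j + a i j)\<^sup>2 + (a i j + a' i j)\<^sup>2 + (b i j + a' i j)\<^sup>2) / 8 * e0 i j\<bar> \<le> 4 * (M + 1)\<^sup>2 * ?r"
      unfolding abs_mult using e(2)[of i j] by (intro mult_mono) auto
    have 2: "\<bar>?c * (e0 i j / 2)\<bar> \<le> MB * ?r"
      unfolding abs_mult using e(2)[of i j] B r0 by (intro mult_mono) auto
    have 3: "\<bar>?e * f i j\<bar> \<le> MB * (2 * ?r)"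
      unfolding abs_mult using f[of i j] B M by (intro mult_mono) auto
    have 4: "\<bar>dconv m n h (vdiff h Jc Je) f i j\<bar> \<le> area * MJ * (2 * ?r)"
      by (rule dconv_sup[OF f J])
    have "\<bar>\<kappa> i j\<bar> \<le> 4 * (M + 1)\<^sup>2 * ?r + MB * ?r + MB * (2 * ?r) + area * MJ * (2 * ?r)"
      unfolding \<kappa>_def using 1 2 3 4 by linarith
    also have "\<dots> = c\<kappa> * ?r" unfolding c\<kappa>_def by (simp add: distrib_right)
    finally show ?thesis .
  qed
  define G where "G = (\<lambda>i j. e0 i j + s * dlaplacian h \<kappa> i j + s * \<tau> i j)"
  have G: "\<bar>G i j\<bar> \<le> g * h" for i j
  proof -
    \<comment> \<open>The Laplacian costs all of the factor \<open>h\<^sup>2\<close> in \<kappa>;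
      one power of \<open>h\<close> is regained from \<open>s \<le> Cs * h\<close>.\<close>
    have "\<bar>dlaplacian h \<kappa> i j\<bar> \<le> 8 * (c\<kappa> * ?r) / h\<^sup>2" by (rule abs_dlaplacian_le[OF \<kappa>])
    also have "\<dots> = 8 * c\<kappa> * K" using h_pos by simp
    finally have "\<bar>s * dlaplacian h \<kappa> i j\<bar> \<le> (Cs * h) * (8 * c\<kappa> * K)"
      unfolding abs_mult using s by (intro mult_mono) auto
    moreover have "\<bar>s * \<tau> i j\<bar> \<le> (Cs * h) * \<theta>"
      unfolding abs_mult using s \<tau> by (intro mult_mono) auto
    moreover have "?r \<le> K * h" using K h_pos s by (intro mult_left_mono) (auto simp: power2_eq_square)
    ultimately have "\<bar>G i j\<bar> \<le> K * h + (Cs * h) * (8 * c\<kappa> * K) + (Cs * h) * \<theta>"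
      unfolding G_def using e(2)[of i j] by linarith
    also have "\<dots> = (K + Cs * \<theta> + 8 * Cs * c\<kappa> * K) * h" by (simp add: algebra_simps)
    also have "\<dots> \<le> g * h" using g(1) h_pos unfolding c\<kappa>_def by (intro mult_right_mono) auto
    finally show ?thesis .
  qed
  have "per \<mu>" unfolding \<mu>_def a'_def c_def using per by (simp add: per_iff)
  moreover have "e1 i j - s * dlaplacian h (\<lambda>i j. \<mu> i j * e1 i j) i j = G i j" for i j
    using eq[of i j] unfolding pot dlaplacian_add G_def by (simp add: algebra_simps)
  moreover have "\<alpha> / 2 \<le> \<mu> i j" for i j
    unfolding \<mu>_def using B(3) by (simp add: add_increasing)
  moreover have "\<mu> i j \<le> 4 * (M + 1)\<^sup>2 + MB" if "\<bar>e1 i j\<bar> \<le> g * h" for i j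
  proof -
    have "\<bar>c i j\<bar> \<le> M + 1" using that g(2) ab(2)[of i j] unfolding c_def by linarith
    then have "((a' i j + b i j)\<^sup>2 + (b i j + c i j)\<^sup>2 + (a' i j + c i j)\<^sup>2) / 8 \<le> (2 * (M + 1))\<^sup>2"
      using ab(2)[of i j] a'[of i j] by (intro sum_squares_le) auto
    then have "((a' i j + b i j)\<^sup>2 + (b i j + c i j)\<^sup>2 + (a' i j + c i j)\<^sup>2) / 8 \<le> 4 * (M + 1)\<^sup>2"
      by (simp only: power_mult_distrib) simp
    moreover have "?c / 2 \<le> MB" using B by linarith
    ultimately show ?thesis unfolding \<mu>_def by linarith
  qed
  ultimately show ?thesis
    using per(4) s(1) G B(4) by (intro max_principle[where \<mu>=\<mu> and G=G]) auto
qed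

lemma nrm_sq_add: "(nrm (\<lambda>i j. x i j + y i j))\<^sup>2 \<le> 2 * (nrm x)\<^sup>2 + 2 * (nrm y)\<^sup>2"
proof -
  have "(nrm (\<lambda>i j. x i j + y i j))\<^sup>2 \<le> (nrm x + nrm y)\<^sup>2"
    using nrm_add by (intro power_mono) auto
  also have "\<dots> \<le> 2 * (nrm x)\<^sup>2 + 2 * (nrm y)\<^sup>2"
    using zero_le_power2[of "nrm x - nrm y"] by (simp add: power2_eq_square algebra_simps)
  finally show ?thesis .
qed

text \<open>Young's inequality for each of the 7 words, with weights that leave only a quarter of
  the errors. In the first time step no factor \<open>s\<close> stands in front of them, and a
  quarter can still be absorbed.\<close>

lemma source_sum_le:
  "\<theta> * (\<Sum>vs | length vs \<le> 2. nrm (fdiffs h vs (\<lambda>i j. x i j + y i j))) \<le> 14 * \<theta>\<^sup>2 + (sob2 x + sob2 y) / 4"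
proof -
  have one: "\<theta> * nrm (fdiffs h vs (\<lambda>i j. x i j + y i j)) \<le> 2 * \<theta>\<^sup>2 + ((nrm (fdiffs h vs x))\<^sup>2 + (nrm (fdiffs h vs y))\<^sup>2) / 4" for vs
  proof -
    have "0 \<le> (4 * \<theta> - nrm (fdiffs h vs (\<lambda>i j. x i j + y i j)))\<^sup>2 / 8" by simp
    also have "\<dots> = 2 * \<theta>\<^sup>2 + (nrm (fdiffs h vs (\<lambda>i j. x i j + y i j)))\<^sup>2 / 8
        - \<theta> * nrm (fdiffs h vs (\<lambda>i j. x i j + y i j))"
      by (simp add: power2_eq_square field_simps)
    finally show ?thesis using nrm_sq_add[of "fdiffs h vs x" "fdiffs h vs y"] unfolding fdiffs_add add_divide_distrib by linarith
  qed
  have "\<theta> * (\<Sum>vs | length vs \<le> 2. nrm (fdiffs h vs (\<lambda>i j. x i j + y i j))) \<le>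
     (\<Sum>vs :: bool list | length vs \<le> 2. 2 * \<theta>\<^sup>2 + ((nrm (fdiffs h vs x))\<^sup>2 + (nrm (fdiffs h vs y))\<^sup>2) / 4)"
    unfolding sum_distrib_left using one by (intro sum_mono)
  also have "\<dots> = 14 * \<theta>\<^sup>2 + (sob2 x + sob2 y) / 4"
    unfolding sum.distrib sum_divide_distrib[symmetric] sob2_def by (simp add: card_words)
  finally show ?thesis .
qed

lemma sob2_zero: "sob2 (\<lambda>i j. 0) = 0" and energy_zero: "energy s Be (\<lambda>i j. 0) (\<lambda>i j. 0) = 0"
proof -
  have "fdiffs h vs (\<lambda>i j. 0) = (\<lambda>i j. 0)" for vs
    using fdiffs_scale[of h vs 0 "\<lambda>i j. 0"] by simp
  then show "sob2 (\<lambda>i j. 0) = 0" "energy s Be (\<lambda>i j. 0) (\<lambda>i j. 0) = 0"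
    by (simp_all add: sob2_def energy_def dnrm2_def nrm_def gsum_def fdiff_def shift_def)
qed

text \<open>The constants are ordered so that no circle arises: \<open>k1\<close> is formed with
  ratio 1 and fixes the growth, hence \<open>K\<close>, then \<open>g\<close>, \<open>R2\<close> and
  \<open>k2\<close>. The last three depend on the growth, but they only restrict \<open>h\<close>
  and \<open>s\<close>. Truncated subtraction makes \<open>k - 1\<close> equal to 0 at
  \<open>k = 0\<close>, which is the convention for the level before the initial one.\<close>

lemma error_estimate:
  fixes u \<phi> \<tau> :: "nat \<Rightarrow> grid_fun" and \<gamma>c \<gamma>e :: real and Jc Je :: "real \<times> real \<Rightarrow> real"
  defines "Be \<equiv> B_coeff m n h Je \<gamma>e" and "Bc \<equiv> B_coeff m n h Jc \<gamma>c"
  assumes s: "0 < s" "s \<le> 1" "s \<le> Cs * h" "h \<le> 1" "1 \<le> M"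
    and per: "\<And>k. per (u k)" "\<And>k. per (\<phi> k)" "\<And>k. per (\<tau> k)"
    and u: "\<And>k. real k * s \<le> T \<Longrightarrow> sbound h 3 (u k) M"
      "\<And>k. real (Suc k) * s \<le> T \<Longrightarrow> sbound h 3 (\<lambda>i j. u (Suc k) i j - u k i j) (M * s)"
    and eq_u: "\<And>k i j. real (Suc k) * s \<le> T \<Longrightarrow> u (Suc k) i j - u k i j =
       s * dlaplacian h (dpotential m n h Jc Je \<gamma>c \<gamma>e (u (k - 1)) (u k) (u (Suc k))) i j + s * \<tau> k i j"
    and \<tau>0: "sbound h 2 (\<tau> 0) (Mt * (s + h\<^sup>2))"
    and \<tau>: "\<And>k. 0 < k \<Longrightarrow> real (Suc k) * s \<le> T \<Longrightarrow> sbound h 2 (\<tau> k) (Mt * (s\<^sup>2 + h\<^sup>2))"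
    and eq_\<phi>: "\<And>k i j. \<phi> (Suc k) i j - \<phi> k i j =
       s * dlaplacian h (dpotential m n h Jc Je \<gamma>c \<gamma>e (\<phi> (k - 1)) (\<phi> k) (\<phi> (Suc k))) i j"
    and init: "\<phi> 0 = u 0"
    and J: "per (vdiff h Jc Je)" "\<And>i j. \<bar>vdiff h Jc Je i j\<bar> \<le> MJ" "\<And>v i j. \<bar>fdiff h v (vdiff h Jc Je) i j\<bar> \<le> MJ"
    and B: "3 * Be + \<alpha> \<le> Bc" "0 \<le> Be" "0 < \<alpha>" "Bc \<le> MB"
    and k1: "7 * ((rem_const M Cs 1 MJ area)\<^sup>2 / \<alpha>) + 1 \<le> k1" "5 * (s * k1) \<le> 1"
    and \<Theta>: "28 * (area * Mt\<^sup>2) + 1 \<le> \<Theta>"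
    and CS: "sqrt area * ((1 + 1 / (real m * h)) * (1 + 1 / (real n * h))) \<le> CS"
    and K: "CS * sqrt (\<Theta> * exp (5 * k1 * T)) * (Cs\<^sup>2 + 1) \<le> K" "2 * K * h \<le> 1"
    and g: "K + Cs * (2 * Mt) + 8 * Cs * (4 * (M + 1)\<^sup>2 + 3 * MB + 2 * (area * MJ)) * K \<le> g" "g * h \<le> 1"
    and R2: "(4 * (M + 1)\<^sup>2 + MB) * g / (\<alpha> / 2) \<le> R2" "1 \<le> R2"
    and k2: "7 * ((rem_const M Cs R2 MJ area)\<^sup>2 / \<alpha>) + 1 \<le> k2" "5 * (s * k2) \<le> 1"
    and l: "real l * s \<le> T"
  shows "\<bar>u l i j - \<phi> l i j\<bar> \<le> CS * sqrt (\<Theta> * exp (5 * k1 * T)) * (s\<^sup>2 + h\<^sup>2)"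
proof -
  define e where "e = (\<lambda>k i j. u k i j - \<phi> k i j)"
  define F where "F = (\<lambda>k. energy s Be (e (k - 1)) (e k))"
  define Z where "Z = (s\<^sup>2 + h\<^sup>2)\<^sup>2"
  \<comment> \<open>Majorant of \<open>F\<close>. It starts at \<open>\<Theta> * Z\<close> although
    \<open>F 0 = 0\<close>, so that every source term is a multiple of \<open>E k\<close>.\<close>
  define E where "E = (\<lambda>k :: nat. \<Theta> * Z * exp (5 * (s * k1)) ^ k)"
  define D where "D = CS * sqrt (\<Theta> * exp (5 * k1 * T))"
  have "0 \<le> Cs * h" using s by linarith
  then have Cs: "0 \<le> Cs" using h_pos by (simp add: zero_le_mult_iff)
  have k10: "1 \<le> k1" "1 \<le> k2" using k1 k2 B(3) by (auto intro: order_trans[rotated])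
  have \<Theta>0: "1 \<le> \<Theta>" 
  proof -
    have "0 \<le> area * Mt\<^sup>2" using h_pos by (intro mult_nonneg_nonneg) auto
    then show ?thesis using \<Theta> by linarith
  qed
  have Z0: "0 \<le> Z" by (simp add: Z_def)
  have CS0: "0 \<le> CS" using CS area_pos h_pos by (intro order_trans[OF _ CS]) auto
  have D0: "0 \<le> D" unfolding D_def using CS0 \<Theta>0 by simp
  have pere: "per (e k)" for k unfolding e_def using per by (simp add: per_iff)
  have E0: "0 \<le> E k" for k unfolding E_def using Z0 \<Theta>0 by simp
  have E_Suc: "E (Suc k) = E k * exp (5 * (s * k1))" for k by (simp add: E_def mult_ac)
  have ZE: "\<Theta> * Z \<le> E k" for k
  proof -
    have "\<Theta> * Z * 1 \<le> \<Theta> * Z * exp (5 * (s * k1)) ^ k"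
      using \<Theta>0 Z0 s k10 by (intro mult_left_mono one_le_power) auto
    then show ?thesis by (simp add: E_def)
  qed
  have E_mono: "E j \<le> E k" if "j \<le> k" for j k
    unfolding E_def using \<Theta>0 Z0 s k10 that by (intro mult_left_mono power_increasing) auto
  have E_T: "E k \<le> \<Theta> * exp (5 * k1 * T) * Z" if "real k * s \<le> T" for k
  proof -
    have "exp (5 * (s * k1)) ^ k = exp (5 * k1 * (real k * s))"
      by (simp add: exp_of_nat_mult[symmetric] mult_ac)
    also have "\<dots> \<le> exp (5 * k1 * T)" using that k10 by (simp add: mult_left_mono)
    finally have "exp (5 * (s * k1)) ^ k \<le> exp (5 * k1 * T)" .
    then have "\<Theta> * Z * exp (5 * (s * k1)) ^ k \<le> \<Theta> * Z * exp (5 * k1 * T)"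
      using \<Theta>0 Z0 by (intro mult_left_mono) auto
    then show ?thesis by (simp add: E_def mult_ac)
  qed
  have Fsob: "sob2 (e k) \<le> F k" for k
    unfolding F_def using s B by (intro sob2_le_energy) auto
  \<comment> \<open>The slack \<open>c\<close> is 1 on levels already settled and 4 for the
    provisional bound on the new level.\<close>
  have sup: "\<bar>e k i j\<bar> \<le> sqrt c * D * (s\<^sup>2 + h\<^sup>2)" if "F k \<le> c * (\<Theta> * exp (5 * k1 * T) * Z)" "0 \<le> c" for k i j c
  proof -
    let ?B = "sqrt c * sqrt (\<Theta> * exp (5 * k1 * T)) * (s\<^sup>2 + h\<^sup>2)"
    have "?B\<^sup>2 = c * (\<Theta> * exp (5 * k1 * T) * Z)" using that \<Theta>0 by (simp add: power_mult_distrib Z_def)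
    then have hb: "hbound 2 (e k) ?B"
      using Fsob[of k] that \<Theta>0 by (intro hbound_sob2 pere) auto
    have "\<bar>e k i j\<bar> \<le> CS * ?B"
      by (rule order_trans[OF sobolev_sup[OF hb] mult_right_mono[OF CS hbound_nonneg[OF hb]]])
    then show ?thesis by (simp add: D_def mult_ac)
  qed
  have eq: "e (Suc k) i j - e k i j = s * dlaplacian h (\<lambda>i j. dpotential m n h Jc Je \<gamma>c \<gamma>e (u (k - 1)) (u k) (u (Suc k)) i j -
     dpotential m n h Jc Je \<gamma>c \<gamma>e (\<lambda>i j. u (k - 1) i j - e (k - 1) i j) (\<lambda>i j. u k i j - e k i j) (\<lambda>i j. u (Suc k) i j - e (Suc k) i j) i j) i j
       + s * \<tau> k i j" if "real (Suc k) * s \<le> T" for k i j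
    unfolding dlaplacian_diff using eq_u[OF that, of i j] eq_\<phi>[of k i j] by (simp add: e_def right_diff_distrib)
  have T_le: "real k * s \<le> T" if "real (Suc k) * s \<le> T" for k
    using nat_le_of_mult_le[OF that, of k] s by simp
  have e_init: "e 0 = (\<lambda>i j. 0)" by (simp add: e_def init)
  define \<theta> where "\<theta> = (\<lambda>k :: nat. sqrt area * (Mt * (if k = 0 then s + h\<^sup>2 else s\<^sup>2 + h\<^sup>2)))"
  have \<theta>: "hbound 2 (\<tau> k) (\<theta> k)" if "real (Suc k) * s \<le> T" for k
  proof -
    have "sbound h 2 (\<tau> k) (Mt * (if k = 0 then s + h\<^sup>2 else s\<^sup>2 + h\<^sup>2))"
      using \<tau>0 \<tau>[of k] that by (cases "k = 0") auto
    then show ?thesis unfolding hbound_def \<theta>_def using per(3)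
      by (auto intro!: nrm_const_le elim: sboundD)
  qed
  \<comment> \<open>One energy step for any ratio \<open>R\<close> of the errors to
    \<open>h\<close>. It serves both passes, with \<open>R2\<close>, \<open>k2\<close> and then with
    1, \<open>k1\<close>.\<close>
  have gain: "F (Suc k) * (1 - s * \<kappa>) \<le> E k * (1 + 3 * (s * \<kappa>))"
    if k: "real (Suc k) * s \<le> T" and IH: "\<And>j. j \<le> k \<Longrightarrow> F j \<le> E j"
      and R: "1 \<le> R" "\<And>i j. \<bar>e k i j\<bar> \<le> R * h" "\<And>i j. \<bar>e (Suc k) i j\<bar> \<le> R * h"
      and \<kappa>: "7 * ((rem_const M Cs R MJ area)\<^sup>2 / \<alpha>) + 1 \<le> \<kappa>" "5 * (s * \<kappa>) \<le> 1" for k R \<kappa>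
  proof -
    let ?S = "sob2 (e (k - 1)) + sob2 (e k) + sob2 (e (Suc k))"
    have S0: "0 \<le> ?S" using sob2_nonneg by (simp add: add_nonneg_nonneg)
    have \<kappa>0: "1 \<le> \<kappa>" using \<kappa>(1) B(3) by (auto intro: order_trans[rotated])
    have step: "F (Suc k) \<le> F k + s * (7 * ((rem_const M Cs R MJ area)\<^sup>2 / \<alpha>) * ?S)
        + s * \<theta> k * (\<Sum>vs | length vs \<le> 2. nrm (fdiffs h vs (\<lambda>i j. e k i j + e (Suc k) i j)))"
      using energy_step[where ?e0.0="e k" and ?e1.0="e (Suc k)" and em="e (k - 1)" and am="u (k - 1)"
          and \<gamma>c=\<gamma>c and \<gamma>e=\<gamma>e and \<alpha>=\<alpha> and \<tau>="\<tau> k",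
          OF per(1)[of k] per(1)[of "Suc k"] u(1)[OF T_le[OF k]] u(1)[OF k] u(2)[OF k] less_imp_le[OF s(1)] s(3,5) R(1) Cs s(4)
          pere pere pere per(3) R(2,3) J B(1-3)[unfolded Be_def Bc_def] eq[OF k] \<theta>[OF k]]
      unfolding F_def Be_def by simp
    have "7 * ((rem_const M Cs R MJ area)\<^sup>2 / \<alpha>) * ?S \<le> (\<kappa> - 1) * ?S"
      using \<kappa>(1) S0 by (intro mult_right_mono) auto
    then have *: "s * (7 * ((rem_const M Cs R MJ area)\<^sup>2 / \<alpha>) * ?S) \<le> s * ((\<kappa> - 1) * ?S)"
      using s by (intro mult_left_mono) auto
    show ?thesis
    proof (cases "k = 0")
      case True
      have z: "sob2 (e 0) = 0" "F 0 = 0" by (simp_all add: F_def e_init sob2_zero energy_zero)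
      \<comment> \<open>The source is O(\<open>s + h\<^sup>2\<close>) here, but \<open>s\<close>
        times it is O(\<open>s\<^sup>2 + h\<^sup>2\<close>), so Young's inequality is applied to the
        product \<open>s * \<theta> 0\<close> as a whole. Of \<open>F 1\<close>, a quarter and a
        fifth are absorbed; more than half remains, whence \<open>28 = 2 * 14\<close>.\<close>
      have "s * \<theta> 0 * (\<Sum>vs | length vs \<le> 2. nrm (fdiffs h vs (\<lambda>i j. e 0 i j + e (Suc 0) i j)))
          \<le> 14 * (s * \<theta> 0)\<^sup>2 + sob2 (e (Suc 0)) / 4"
        using source_sum_le[of "s * \<theta> 0" "e 0" "e (Suc 0)"] z by simp
      then have "F 1 \<le> s * ((\<kappa> - 1) * sob2 (e 1)) + 14 * (s * \<theta> 0)\<^sup>2 + sob2 (e 1) / 4"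
        using step * True z by simp
      also have "s * ((\<kappa> - 1) * sob2 (e 1)) \<le> s * (\<kappa> * F 1)"
        using s \<kappa>0 Fsob[of 1] sob2_nonneg by (intro mult_left_mono mult_mono) auto
      finally have "F 1 \<le> s * (\<kappa> * F 1) + 14 * (s * \<theta> 0)\<^sup>2 + F 1 / 4" using Fsob[of 1] by simp
      moreover have "s * (\<kappa> * F 1) \<le> 1 / 5 * F 1"
        using \<kappa>(2) order_trans[OF sob2_nonneg Fsob[of 1]]
        unfolding mult.assoc[symmetric] by (intro mult_right_mono) auto
      ultimately have "F 1 \<le> 28 * (s * \<theta> 0)\<^sup>2" using order_trans[OF sob2_nonneg Fsob[of 1]] by simp
      also have "(s * \<theta> 0)\<^sup>2 = area * Mt\<^sup>2 * (s * (s + h\<^sup>2))\<^sup>2"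
        using area_pos by (simp add: \<theta>_def power_mult_distrib)
      also have "\<dots> \<le> area * Mt\<^sup>2 * Z"
      proof -
        have "s * h\<^sup>2 \<le> 1 * h\<^sup>2" using s by (intro mult_right_mono) auto
        then have "s * (s + h\<^sup>2) \<le> s\<^sup>2 + h\<^sup>2" by (simp add: power2_eq_square algebra_simps)
        then show ?thesis unfolding Z_def using s area_pos by (intro mult_left_mono power_mono) auto
      qed
      also have "28 * (area * Mt\<^sup>2 * Z) \<le> \<Theta> * Z"
        using mult_right_mono[OF \<Theta> Z0] Z0 by (simp add: algebra_simps)
      also have "\<dots> \<le> E 0" by (rule ZE)
      finally have F1: "F 1 \<le> E 0" by simp
      have x: "0 \<le> s * \<kappa>" using s \<kappa>0 by simp
      have "F 1 * (1 - s * \<kappa>) \<le> E 0 * (1 - s * \<kappa>)" using F1 \<kappa>(2) by (intro mult_right_mono) auto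
      also have "\<dots> \<le> E 0 * (1 + 3 * (s * \<kappa>))" using x E0 by (intro mult_left_mono) linarith+
      finally show ?thesis using True by simp
    next
      case False
      have "s * \<theta> k * (\<Sum>vs | length vs \<le> 2. nrm (fdiffs h vs (\<lambda>i j. e k i j + e (Suc k) i j)))
          \<le> s * (14 * (\<theta> k)\<^sup>2 + ?S)"
        unfolding mult.assoc using s sob2_nonneg
        by (intro mult_left_mono order_trans[OF source_sum_le]) (auto simp: add_nonneg_nonneg)
      then have "F (Suc k) \<le> F k + s * ((\<kappa> - 1) * ?S) + s * (14 * (\<theta> k)\<^sup>2 + ?S)"
        using step * by linarith
      also have "\<dots> = F k + s * (\<kappa> * ?S) + s * (14 * (\<theta> k)\<^sup>2)" by (simp add: algebra_simps)
      \<comment> \<open>Both old levels are below \<open>E k\<close> as \<open>E\<close> is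
        increasing. Together with the source this makes three copies of \<open>E k\<close>, the
        \<open>3\<close> in \<open>gronwall_factor\<close>; the new level goes to the left.\<close>
      also have "s * (\<kappa> * ?S) \<le> s * (\<kappa> * (E k + E k + F (Suc k)))"
      proof -
        have "sob2 (e (k - 1)) \<le> E k" using Fsob[of "k - 1"] IH[of "k - 1"] E_mono[of "k - 1" k] by linarith
        moreover have "sob2 (e k) \<le> E k" using Fsob[of k] IH[of k] by simp
        ultimately show ?thesis using s \<kappa>0 Fsob[of "Suc k"] by (intro mult_left_mono) auto
      qed
      also have "14 * (\<theta> k)\<^sup>2 \<le> \<kappa> * E k"
      proof -
        have "14 * (\<theta> k)\<^sup>2 = 14 * (area * Mt\<^sup>2) * Z"
          using area_pos False by (simp add: \<theta>_def power_mult_distrib Z_def)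
        also have "\<dots> \<le> \<Theta> * Z"
        proof (rule mult_right_mono[OF _ Z0])
          have "0 \<le> area * Mt\<^sup>2" using h_pos by (intro mult_nonneg_nonneg) auto
          then show "14 * (area * Mt\<^sup>2) \<le> \<Theta>" using \<Theta> by linarith
        qed
        also have "\<dots> \<le> 1 * E k" using ZE by simp
        also have "\<dots> \<le> \<kappa> * E k" using \<kappa>0 E0 by (intro mult_right_mono) auto
        finally show ?thesis .
      qed
      finally have "F (Suc k) \<le> F k + s * (\<kappa> * (E k + E k + F (Suc k))) + s * (\<kappa> * E k)"
        using s by (simp add: mult_left_mono)
      then show ?thesis using IH[of k] by (simp add: algebra_simps)
    qed
  qed
  have DK: "D * (s\<^sup>2 + h\<^sup>2) \<le> K * h\<^sup>2"
  proof -
    have "s\<^sup>2 \<le> (Cs * h)\<^sup>2" using s by (intro power_mono) auto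
    then have "D * (s\<^sup>2 + h\<^sup>2) \<le> D * ((Cs\<^sup>2 + 1) * h\<^sup>2)"
      using D0 by (intro mult_left_mono) (auto simp: power_mult_distrib algebra_simps)
    also have "\<dots> = D * (Cs\<^sup>2 + 1) * h\<^sup>2" by simp
    also have "\<dots> \<le> K * h\<^sup>2" using K(1) unfolding D_def by (intro mult_right_mono) auto
    finally show ?thesis .
  qed
  have "0 \<le> D * (Cs\<^sup>2 + 1)" using D0 by simp
  then have K0: "0 \<le> K" using K(1) unfolding D_def by linarith
  \<comment> \<open>The factor 2 gained here is the square root of the slack 4 of the provisional
    bound.\<close>
  have "K * h\<^sup>2 = K * h * h" by (simp add: power2_eq_square)
  also have "\<dots> \<le> 1 / 2 * h" using K(2) h_pos by (intro mult_right_mono) auto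
  finally have Kh: "2 * (K * h\<^sup>2) \<le> h" by simp
  have Mt0: "0 \<le> Mt"
  proof -
    have "0 \<le> Mt * (s + h\<^sup>2)" by (rule sbound_nonneg[OF \<tau>0])
    moreover have "0 < s + h\<^sup>2" using s by (simp add: add_pos_nonneg)
    ultimately show ?thesis by (simp add: zero_le_mult_iff)
  qed
  have main: "\<forall>j\<le>k. F j \<le> E j" if "real k * s \<le> T" for k
    using that
  proof (induction k)
    case 0
    then show ?case using E0[of 0] by (simp add: F_def e_init energy_zero)
  next
    case (Suc k)
    have IH: "F j \<le> E j" if "j \<le> k" for j using Suc.IH[OF T_le[OF Suc.prems]] that by blast
    have small: "\<bar>e j i j'\<bar> \<le> K * h\<^sup>2" if "j \<le> k" for j i j'
    proof -
      have "F j \<le> 1 * (\<Theta> * exp (5 * k1 * T) * Z)"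
        using IH[OF that] E_T[OF nat_le_of_mult_le[OF Suc.prems, of j]] that s by simp
      from sup[OF this, of i j'] show ?thesis using DK by simp
    qed
    have \<tau>sup: "\<bar>\<tau> k i j\<bar> \<le> 2 * Mt" for i j
    proof -
      have "s\<^sup>2 \<le> 1" "h\<^sup>2 \<le> 1" using s h_pos by (auto intro: power_le_one)
      moreover have "\<bar>\<tau> k i j\<bar> \<le> Mt * (if k = 0 then s + h\<^sup>2 else s\<^sup>2 + h\<^sup>2)"
        using sbound_point[OF \<tau>0] sbound_point[OF \<tau>[of k]] Suc.prems by (cases "k = 0") auto
      moreover have "(if k = 0 then s + h\<^sup>2 else s\<^sup>2 + h\<^sup>2) \<le> 2" using calculation s by auto
      ultimately show ?thesis using mult_left_mono[OF _ Mt0] by (metis mult.commute order_trans)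
    qed
    have apriori: "\<bar>e (Suc k) i j\<bar> \<le> R2 * h" for i j
    proof -
      have "\<bar>e (Suc k) i j\<bar> \<le> (4 * (M + 1)\<^sup>2 + MB) * (g * h) / (\<alpha> / 2)"
      proof (rule a_priori_bound[where a="u k" and b="u (Suc k)" and am="u (k - 1)" and em="e (k - 1)"
            and ?e0.0="e k" and \<tau>="\<tau> k" and K=K and \<theta>="2 * Mt" and Cs=Cs and s=s and \<gamma>c=\<gamma>c and \<gamma>e=\<gamma>e])
        show "\<bar>u k i j\<bar> \<le> M" "\<bar>u (Suc k) i j\<bar> \<le> M" for i j
          using sbound_point[OF u(1)[OF T_le[OF Suc.prems]]] sbound_point[OF u(1)[OF Suc.prems]] by auto
        show "K * h\<^sup>2 \<le> 1" using Kh s K0 by simp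
        show "\<bar>B_coeff m n h Je \<gamma>e\<bar> \<le> MB" "\<alpha> \<le> B_coeff m n h Jc \<gamma>c" "B_coeff m n h Jc \<gamma>c \<le> MB"
          using B unfolding Be_def Bc_def by auto
      qed (rule per pere small K0 J B(3) s(3,4) less_imp_le[OF s(1)] \<tau>sup g eq[OF Suc.prems] | simp)+
      also have "\<dots> = (4 * (M + 1)\<^sup>2 + MB) * g / (\<alpha> / 2) * h" by simp
      also have "\<dots> \<le> R2 * h" using R2 h_pos by (intro mult_right_mono) auto
      finally show ?thesis .
    qed
    have small': "\<bar>e k i j\<bar> \<le> 1 * h" for i j
      using small[of k i j] Kh mult_nonneg_nonneg[OF K0 zero_le_power2[of h]] by simp
    have hR2: "1 * h \<le> R2 * h" using R2 h_pos by (intro mult_right_mono) auto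
    \<comment> \<open>First pass, with the crude ratio \<open>R2\<close>. Since
      \<open>s * k2\<close> is small, the loss is a factor 2 whatever the size of \<open>k2\<close>;
      it is rounded up to 4 so that the square root is rational.\<close>
    have "F (Suc k) \<le> 2 * E k"
    proof (rule gronwall_factor(2)[where x="s * k2"])
      show "F (Suc k) * (1 - s * k2) \<le> E k * (1 + 3 * (s * k2))"
        by (rule gain[OF Suc.prems IH R2(2) order_trans[OF small' hR2] apriori k2])
    qed (use s k10 k2 E0 in auto)
    also have "\<dots> \<le> 4 * (\<Theta> * exp (5 * k1 * T) * Z)"
      using E_T[OF T_le[OF Suc.prems]] E0[of k] by linarith
    finally have F4: "F (Suc k) \<le> 4 * (\<Theta> * exp (5 * k1 * T) * Z)" .
    have new: "\<bar>e (Suc k) i j\<bar> \<le> 1 * h" for i j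
      using sup[OF F4, of i j] DK Kh by simp
    \<comment> \<open>Second pass: the errors are now known to be at most \<open>h\<close>, so the
      step grows at the rate \<open>k1\<close> for which \<open>E\<close> was defined.\<close>
    have "F (Suc k) * (1 - s * k1) \<le> E k * (1 + 3 * (s * k1))"
      by (rule gain[OF Suc.prems IH order_refl small' new k1])
    then have "F (Suc k) \<le> E k * exp (5 * (s * k1))"
      using s k10 k1 E0 by (intro gronwall_factor(1)) auto
    then have "F (Suc k) \<le> E (Suc k)" by (simp add: E_Suc)
    then show ?case using IH by (auto simp: le_Suc_eq)
  qed
  have "F l \<le> 1 * (\<Theta> * exp (5 * k1 * T) * Z)" using main[OF l] E_T[OF l] by fastforce
  from sup[OF this] show ?thesis by (simp add: e_def D_def)
qed

end

subsection \<open>Partial derivatives in the plane\<close>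

declare split_paired_All [simp del] split_paired_Ex [simp del]

definition dir :: "bool \<Rightarrow> real \<times> real" where
  "dir v = (if v then (1, 0) else (0, 1))"

text \<open>A relation between functions instead of \<open>deriv\<close>, so that existence is
  carried along through translations, differences and convolutions.\<close>

definition has_pderiv :: "bool \<Rightarrow> (real \<times> real \<Rightarrow> real) \<Rightarrow> (real \<times> real \<Rightarrow> real) \<Rightarrow> bool" where
  "has_pderiv v f g \<longleftrightarrow> (\<forall>x. ((\<lambda>r. f (x + r *\<^sub>R dir v)) has_real_derivative g x) (at 0))"

lemma has_pderiv_at:
  assumes "has_pderiv v f g"
  shows "((\<lambda>r. f (x + r *\<^sub>R dir v)) has_real_derivative g (x + r0 *\<^sub>R dir v)) (at r0)"
proof -
  have "((\<lambda>r. f ((x + r0 *\<^sub>R dir v) + r *\<^sub>R dir v)) has_real_derivative g (x + r0 *\<^sub>R dir v)) (at 0)"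
    using assms by (simp add: has_pderiv_def)
  then have "((\<lambda>r. f (x + (r + r0) *\<^sub>R dir v)) has_real_derivative g (x + r0 *\<^sub>R dir v)) (at 0)"
    by (simp add: algebra_simps)
  then show ?thesis using DERIV_shift[of "\<lambda>r. f (x + r *\<^sub>R dir v)" _ 0 r0] by simp
qed

lemma has_pderiv_unique: "has_pderiv v f g \<Longrightarrow> has_pderiv v f g' \<Longrightarrow> g = g'"
  unfolding has_pderiv_def using DERIV_unique by blast

lemma has_pderiv_add:
  "has_pderiv v f f' \<Longrightarrow> has_pderiv v g g' \<Longrightarrow> has_pderiv v (\<lambda>x. f x + g x) (\<lambda>x. f' x + g' x)"
  unfolding has_pderiv_def by (auto intro!: derivative_intros)

lemma has_pderiv_diff:
  "has_pderiv v f f' \<Longrightarrow> has_pderiv v g g' \<Longrightarrow> has_pderiv v (\<lambda>x. f x - g x) (\<lambda>x. f' x - g' x)"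
  unfolding has_pderiv_def by (auto intro!: derivative_intros)

lemma has_pderiv_scale: "has_pderiv v f f' \<Longrightarrow> has_pderiv v (\<lambda>x. c * f x) (\<lambda>x. c * f' x)"
  unfolding has_pderiv_def by (simp add: DERIV_cmult)

lemma has_pderiv_mult:
  assumes "has_pderiv v f f'" "has_pderiv v g g'"
  shows "has_pderiv v (\<lambda>x. f x * g x) (\<lambda>x. f' x * g x + f x * g' x)"
  unfolding has_pderiv_def
proof
  fix x
  have "((\<lambda>r. f (x + r *\<^sub>R dir v) * g (x + r *\<^sub>R dir v)) has_real_derivative
     f' x * g (x + 0 *\<^sub>R dir v) + g' x * f (x + 0 *\<^sub>R dir v)) (at 0)"
    using assms unfolding has_pderiv_def by (intro DERIV_mult) auto
  then show "((\<lambda>r. f (x + r *\<^sub>R dir v) * g (x + r *\<^sub>R dir v)) has_real_derivative f' x * g x + f x * g' x) (at 0)"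
    by (simp add: mult.commute)
qed

lemma has_pderiv_translate: "has_pderiv v f g \<Longrightarrow> has_pderiv v (\<lambda>x. f (x + a)) (\<lambda>x. g (x + a))"
  unfolding has_pderiv_def
proof
  fix x assume "\<forall>x. ((\<lambda>r. f (x + r *\<^sub>R dir v)) has_real_derivative g x) (at 0)"
  from this[rule_format, of "x + a"]
  show "((\<lambda>r. f (x + r *\<^sub>R dir v + a)) has_real_derivative g (x + a)) (at 0)"
    by (simp add: algebra_simps)
qed

lemma has_pderiv_reflect: "has_pderiv v f g \<Longrightarrow> has_pderiv v (\<lambda>x. f (a - x)) (\<lambda>x. (-1) * g (a - x))"
  unfolding has_pderiv_def
proof
  fix x assume "\<forall>x. ((\<lambda>r. f (x + r *\<^sub>R dir v)) has_real_derivative g x) (at 0)"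
  from this[rule_format, of "a - x"]
  have "((\<lambda>r. f (a - x + r *\<^sub>R dir v)) has_real_derivative g (a - x)) (at (- 0))" by simp
  then have "((\<lambda>r. f (a - x + (- r) *\<^sub>R dir v)) has_real_derivative - g (a - x)) (at 0)"
    using DERIV_mirror[of "\<lambda>r. f (a - x + r *\<^sub>R dir v)" "g (a - x)" 0] by simp
  then show "((\<lambda>r. f (a - (x + r *\<^sub>R dir v))) has_real_derivative (-1) * g (a - x)) (at 0)"
    by (simp add: algebra_simps)
qed

text \<open>Counterpart of \<open>sbound\<close> in the plane, with one constant for all orders.
  Each sequence of directions has its own chain of derivatives; continuity is carried along for the
  convolution integrals.\<close>

primrec Cbound :: "nat \<Rightarrow> (real \<times> real \<Rightarrow> real) \<Rightarrow> real \<Rightarrow> bool" where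
  "Cbound 0 f M \<longleftrightarrow> continuous_on UNIV f \<and> (\<forall>x. \<bar>f x\<bar> \<le> M)"
| "Cbound (Suc k) f M \<longleftrightarrow> continuous_on UNIV f \<and> (\<forall>x. \<bar>f x\<bar> \<le> M) \<and>
     (\<forall>v. \<exists>g. has_pderiv v f g \<and> Cbound k g M)"

lemma Cbound_continuous: "Cbound k f M \<Longrightarrow> continuous_on UNIV f"
  by (cases k) auto

lemma Cbound_abs_le: "Cbound k f M \<Longrightarrow> \<bar>f x\<bar> \<le> M"
  by (cases k) auto

lemma Cbound_mono: "Cbound k f M \<Longrightarrow> l \<le> k \<Longrightarrow> M \<le> M' \<Longrightarrow> Cbound l f M'"
proof (induction k arbitrary: l f)
  case 0
  then show ?case by (auto intro: order_trans)
next
  case (Suc k)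
  show ?case
  proof (cases l)
    case 0
    then show ?thesis using Suc.prems by (auto intro: order_trans)
  next
    case (Suc l')
    have "\<exists>g. has_pderiv v f g \<and> Cbound l' g M'" for v
      using Suc Suc.prems Suc.IH[of _ l'] by (metis Cbound.simps(2) Suc_le_mono)
    then show ?thesis using Suc Suc.prems by (auto intro: order_trans)
  qed
qed

lemma Cbound_add:
  "Cbound k f M \<Longrightarrow> Cbound k g M' \<Longrightarrow> Cbound k (\<lambda>x. f x + g x) (M + M')"
proof (induction k arbitrary: f g)
  case 0
  then show ?case by (auto intro!: continuous_intros order_trans[OF abs_triangle_ineq] add_mono)
next
  case (Suc k)
  have "\<exists>u. has_pderiv v (\<lambda>x. f x + g x) u \<and> Cbound k u (M + M')" for v
    using Suc by (metis (mono_tags, lifting) Cbound.simps(2) has_pderiv_add)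
  then show ?case using Suc.prems by (auto intro!: continuous_intros order_trans[OF abs_triangle_ineq] add_mono)
qed

lemma Cbound_scale: "Cbound k f M \<Longrightarrow> Cbound k (\<lambda>x. c * f x) (\<bar>c\<bar> * M)"
proof (induction k arbitrary: f)
  case 0
  then show ?case by (auto intro!: continuous_intros mult_left_mono simp: abs_mult)
next
  case (Suc k)
  have "\<exists>u. has_pderiv v (\<lambda>x. c * f x) u \<and> Cbound k u (\<bar>c\<bar> * M)" for v
    using Suc by (metis (mono_tags, lifting) Cbound.simps(2) has_pderiv_scale)
  then show ?case using Suc.prems by (auto intro!: continuous_intros mult_left_mono simp: abs_mult)
qed

lemma Cbound_diff:
  "Cbound k f M \<Longrightarrow> Cbound k g M' \<Longrightarrow> Cbound k (\<lambda>x. f x - g x) (M + M')"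
  using Cbound_add[of k f M "\<lambda>x. (-1) * g x" M'] Cbound_scale[of k g M' "-1"] by simp

lemma Cbound_mult:
  "Cbound k f M \<Longrightarrow> Cbound k g M' \<Longrightarrow> Cbound k (\<lambda>x. f x * g x) (2 ^ k * (M * M'))"
proof (induction k arbitrary: f g)
  case 0
  then have "0 \<le> M" using abs_ge_zero order_trans by (metis Cbound.simps(1))
  then show ?case using 0 by (auto intro!: continuous_intros mult_mono simp: abs_mult)
next
  case (Suc k)
  have M: "0 \<le> M" "0 \<le> M'"
    using Suc.prems Cbound_abs_le[of "Suc k" f M 0] Cbound_abs_le[of "Suc k" g M' 0] by linarith+
  have "\<exists>u. has_pderiv v (\<lambda>x. f x * g x) u \<and> Cbound k u (2 ^ Suc k * (M * M'))" for v
  proof -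
    obtain f' g' where d: "has_pderiv v f f'" "Cbound k f' M" "has_pderiv v g g'" "Cbound k g' M'"
      using Suc.prems by (meson Cbound.simps(2))
    have "Cbound k f M" "Cbound k g M'" using Suc.prems by (auto intro: Cbound_mono[of "Suc k"] simp del: Cbound.simps)
    then have "Cbound k (\<lambda>x. f' x * g x + f x * g' x) (2 ^ k * (M * M') + 2 ^ k * (M * M'))"
      using d by (intro Cbound_add Suc.IH)
    then have "Cbound k (\<lambda>x. f' x * g x + f x * g' x) (2 ^ Suc k * (M * M'))"
      by (rule Cbound_mono) auto
    then show ?thesis using has_pderiv_mult[OF d(1,3)] by blast
  qed
  moreover have "\<bar>f x * g x\<bar> \<le> 2 ^ Suc k * (M * M')" for x
  proof -
    have "\<bar>f x * g x\<bar> \<le> 1 * (M * M')"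
      using Suc.prems M unfolding abs_mult by (auto intro!: mult_mono)
    also have "\<dots> \<le> 2 ^ Suc k * (M * M')" using M one_le_power[of "2::real" "Suc k"] by (intro mult_right_mono) auto
    finally show ?thesis .
  qed
  ultimately show ?case using Suc.prems by (auto intro!: continuous_intros simp del: power_Suc)
qed

lemma Cbound_reflect: "Cbound k f M \<Longrightarrow> Cbound k (\<lambda>x. f (a - x)) M"
proof (induction k arbitrary: f)
  case 0
  then show ?case by (auto intro!: continuous_on_compose2[of UNIV f] continuous_intros)
next
  case (Suc k)
  have "\<exists>u. has_pderiv v (\<lambda>x. f (a - x)) u \<and> Cbound k u M" for v
  proof -
    obtain g where g: "has_pderiv v f g" "Cbound k g M" using Suc.prems by (meson Cbound.simps(2))
    from Cbound_scale[OF Suc.IH[OF g(2)], of "-1"] has_pderiv_reflect[OF g(1), of a]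
    show ?thesis by auto
  qed
  then show ?case using Suc.prems by (auto intro!: continuous_on_compose2[of UNIV f] continuous_intros)
qed

subsection \<open>Finite differences in the plane\<close>

definition pdiff :: "real \<Rightarrow> bool \<Rightarrow> (real \<times> real \<Rightarrow> real) \<Rightarrow> real \<times> real \<Rightarrow> real" where
  "pdiff h v f x = (f (x + h *\<^sub>R dir v) - f x) / h"

primrec pdiffs :: "real \<Rightarrow> bool list \<Rightarrow> (real \<times> real \<Rightarrow> real) \<Rightarrow> real \<times> real \<Rightarrow> real" where
  "pdiffs h [] f = f"
| "pdiffs h (v # vs) f = pdiff h v (pdiffs h vs f)"

text \<open>Moves differences from the grid to the whole plane, where they commute with space
  derivatives, time derivatives and convolution. This is how differences of the truncation error
  obey the same bounds as the error itself.\<close>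

lemma fdiffs_cell_restr: "fdiffs h vs (cell_restr h f) = cell_restr h (pdiffs h vs f)"
proof (induction vs)
  case (Cons v vs)
  have "fdiff h v (cell_restr h g) = cell_restr h (pdiff h v g)" for g
    by (cases v) (auto simp: fun_eq_iff fdiff_def shift_def cell_restr_def pdiff_def dir_def grid_pt_def algebra_simps)
  then show ?case using Cons by simp
qed simp

lemma pdiff_reorder: "has_pderiv v f g \<Longrightarrow> has_pderiv v (pdiff h w f) (pdiff h w g)"
proof -
  assume "has_pderiv v f g"
  then have "has_pderiv v (\<lambda>x. (1 / h) * (f (x + h *\<^sub>R dir w) - f x)) (\<lambda>x. (1 / h) * (g (x + h *\<^sub>R dir w) - g x))"
    by (intro has_pderiv_scale has_pderiv_diff has_pderiv_translate)
  moreover have "(\<lambda>x. (1 / h) * (u (x + h *\<^sub>R dir w) - u x)) = pdiff h w u" for u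
    by (auto simp: pdiff_def)
  ultimately show ?thesis by simp
qed

lemma has_pderiv_pdiffs: "has_pderiv v f g \<Longrightarrow> has_pderiv v (pdiffs h vs f) (pdiffs h vs g)"
  by (induction vs) (auto intro: pdiff_reorder)

lemma abs_diff_le_deriv_bound:
  fixes f f' :: "real \<Rightarrow> real"
  assumes "\<And>x. (f has_real_derivative f' x) (at x)" "\<And>x. \<bar>f' x\<bar> \<le> M"
  shows "\<bar>f b - f a\<bar> \<le> M * \<bar>b - a\<bar>"
  using field_differentiable_bound[of UNIV f f' M b a] assms by simp

text \<open>The outermost difference is removed by the mean value inequality; the derivative passes
  through the remaining differences and falls on \<open>f\<close>.\<close>

lemma pdiffs_bound:
  assumes "Cbound k f M" "length vs \<le> k" "0 < h"
  shows "\<bar>pdiffs h vs f x\<bar> \<le> M"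
  using assms(1,2)
proof (induction vs arbitrary: f k x)
  case Nil
  then show ?case by (simp add: Cbound_abs_le)
next
  case (Cons v vs)
  then obtain k' where k: "k = Suc k'" by (cases k) auto
  then obtain g where g: "has_pderiv v f g" "Cbound k' g M" using Cons.prems by (meson Cbound.simps(2))
  have "\<bar>pdiffs h vs f (x + h *\<^sub>R dir v) - pdiffs h vs f (x + 0 *\<^sub>R dir v)\<bar> \<le> M * \<bar>h - 0\<bar>"
  proof (rule abs_diff_le_deriv_bound)
    show "((\<lambda>r. pdiffs h vs f (x + r *\<^sub>R dir v)) has_real_derivative pdiffs h vs g (x + r *\<^sub>R dir v)) (at r)" for r
      by (rule has_pderiv_at[OF has_pderiv_pdiffs[OF g(1)]])
    show "\<bar>pdiffs h vs g (x + r *\<^sub>R dir v)\<bar> \<le> M" for r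
      using Cons.IH[OF g(2)] Cons.prems k by simp
  qed
  then show ?case using assms(3) by (simp add: pdiff_def abs_divide pos_divide_le_eq)
qed

lemma sbound_cell_restr_pdiffs:
  "(\<And>vs x. length vs \<le> k \<Longrightarrow> \<bar>pdiffs h vs f x\<bar> \<le> M) \<Longrightarrow> sbound h k (cell_restr h f) M"
  unfolding sbound_def fdiffs_cell_restr by (simp add: cell_restr_def)

lemma sbound_cell_restr: "Cbound k f M \<Longrightarrow> 0 < h \<Longrightarrow> sbound h k (cell_restr h f) M"
  by (rule sbound_cell_restr_pdiffs) (rule pdiffs_bound)

lemma pdiffs_continuous: "continuous_on UNIV f \<Longrightarrow> continuous_on UNIV (pdiffs h vs f)"
proof (induction vs)
  case (Cons v vs)
  then have c: "continuous_on UNIV (pdiffs h vs f)" by simp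
  have "continuous_on UNIV (\<lambda>x. (pdiffs h vs f (x + h *\<^sub>R dir v) - pdiffs h vs f x) * (1 / h))"
    using c by (intro continuous_intros continuous_on_compose2[OF c]) auto
  then show ?case by (simp add: pdiff_def[abs_def])
qed simp

lemma pdiffs_periodic: "periodic2 L1 L2 f \<Longrightarrow> periodic2 L1 L2 (pdiffs h vs f)"
proof (induction vs)
  case (Cons v vs)
  have "pdiffs h vs f (x1 + L1 + a, x2 + b) = pdiffs h vs f (x1 + a, x2 + b)"
    "pdiffs h vs f (x1 + a, x2 + L2 + b) = pdiffs h vs f (x1 + a, x2 + b)" for x1 x2 a b
    using Cons unfolding periodic2_def by (metis add.assoc add.commute)+
  from this[of _ h _ 0] this[of _ 0 _ h] this[of _ 0 _ 0]
  show ?case by (cases v) (auto simp: periodic2_def pdiff_def dir_def)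
qed simp

definition has_tderiv :: "real \<Rightarrow> (real \<times> real \<Rightarrow> real \<Rightarrow> real) \<Rightarrow> (real \<times> real \<Rightarrow> real \<Rightarrow> real) \<Rightarrow> bool" where
  "has_tderiv T f g \<longleftrightarrow> (\<forall>x. \<forall>t\<in>{0..T}. (f x has_real_derivative g x t) (at t within {0..T}))"

lemma has_tderiv_pdiffs:
  assumes "has_tderiv T f g"
  shows "has_tderiv T (\<lambda>x t. pdiffs h vs (\<lambda>x. f x t) x) (\<lambda>x t. pdiffs h vs (\<lambda>x. g x t) x)"
proof (induction vs)
  case Nil
  then show ?case using assms by simp
next
  case (Cons v vs)
  have "has_tderiv T (\<lambda>x t. (pdiffs h vs (\<lambda>x. f x t) (x + h *\<^sub>R dir v) - pdiffs h vs (\<lambda>x. f x t) x) / h)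
     (\<lambda>x t. (pdiffs h vs (\<lambda>x. g x t) (x + h *\<^sub>R dir v) - pdiffs h vs (\<lambda>x. g x t) x) / h)"
    using Cons unfolding has_tderiv_def by (auto intro!: DERIV_cdivide DERIV_diff)
  then show ?case by (simp add: pdiff_def)
qed

subsection \<open>Bounds for periodic smooth functions\<close>

lemma periodic2_reduce:
  assumes "periodic2 L1 L2 f" "0 < L1" "0 < L2"
  obtains y where "y \<in> {0..L1} \<times> {0..L2}" "f x = f y"
proof -
  have 1: "f (a + real k * L1, b) = f (a, b)" "f (a, b + real k * L2) = f (a, b)" for a b k
    using assms(1) by (induction k) (auto simp: periodic2_def algebra_simps, metis add.assoc add.commute, metis add.assoc add.commute)
  have 2: "f (a + of_int k * L1, b) = f (a, b)" "f (a, b + of_int k * L2) = f (a, b)" for a b k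
  proof -
    show "f (a + of_int k * L1, b) = f (a, b)"
      using 1(1)[of a "nat k" b] 1(1)[of "a + of_int k * L1" "nat (- k)" b] by (cases "0 \<le> k") auto
    show "f (a, b + of_int k * L2) = f (a, b)"
      using 1(2)[of a b "nat k"] 1(2)[of a "b + of_int k * L2" "nat (- k)"] by (cases "0 \<le> k") auto
  qed
  define y where "y = (fst x + of_int (- \<lfloor>fst x / L1\<rfloor>) * L1, snd x + of_int (- \<lfloor>snd x / L2\<rfloor>) * L2)"
  have f: "f x = f y" unfolding y_def 2 by simp
  have b: "0 \<le> z - of_int \<lfloor>z / L\<rfloor> * L \<and> z - of_int \<lfloor>z / L\<rfloor> * L \<le> L" if "0 < L" for z L :: real
  proof -
    have "of_int \<lfloor>z / L\<rfloor> \<le> z / L" "z / L \<le> of_int \<lfloor>z / L\<rfloor> + 1" by linarith+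
    then have "of_int \<lfloor>z / L\<rfloor> * L \<le> z" "z \<le> (of_int \<lfloor>z / L\<rfloor> + 1) * L"
      using that by (simp_all only: pos_le_divide_eq pos_divide_le_eq)
    then show ?thesis by (simp add: algebra_simps)
  qed
  have "y \<in> {0..L1} \<times> {0..L2}" using b[OF assms(2), of "fst x"] b[OF assms(3), of "snd x"] by (simp add: y_def)
  then show ?thesis using f that by blast
qed

text \<open>All values are taken on one closed period cell times \<open>{0..T}\<close>, which is
  compact.\<close>

lemma periodic_slab_bounded:
  fixes f :: "(real \<times> real) \<times> real \<Rightarrow> real"
  assumes c: "continuous_on (UNIV \<times> {0..T}) f" and p: "\<And>t. t \<in> {0..T} \<Longrightarrow> periodic2 L1 L2 (\<lambda>x. f (x, t))"
    and L: "0 < L1" "0 < L2"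
  obtains M where "\<And>x t. t \<in> {0..T} \<Longrightarrow> \<bar>f (x, t)\<bar> \<le> M"
proof -
  let ?K = "(({0..L1} \<times> {0..L2}) \<times> {0..T}) :: ((real \<times> real) \<times> real) set"
  have "compact (f ` ?K)"
    by (intro compact_continuous_image continuous_on_subset[OF c] compact_Times compact_Icc) auto
  then obtain M where M: "\<And>y. y \<in> f ` ?K \<Longrightarrow> norm y \<le> M"
    using compact_imp_bounded bounded_iff by metis
  show ?thesis
  proof
    fix x t assume t: "t \<in> {0..T}"
    obtain y where "y \<in> {0..L1} \<times> {0..L2}" "f (x, t) = f (y, t)"
      using periodic2_reduce[OF p[OF t] L] .
    then have "f (x, t) \<in> f ` ?K" using t by auto
    then show "\<bar>f (x, t)\<bar> \<le> M" using M by fastforce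
  qed
qed

lemma Ck_on_continuous: "Ck_on k S f \<Longrightarrow> continuous_on S f"
proof (cases k)
  case (Suc k')
  assume "Ck_on k S f"
  then obtain f' where "\<forall>x\<in>S. (f has_derivative f' x) (at x within S)" using Suc by auto
  then show ?thesis by (intro has_derivative_continuous_on[of S f f']) auto
qed simp

text \<open>A derivative relative to the slab composes with every curve inside it: space lines at
  each time, the end times included, and the time segment through each point, where it is one-sided
  at both ends.\<close>

lemma slab_derivatives:
  fixes f :: "(real \<times> real) \<times> real \<Rightarrow> real"
  assumes "Ck_on (Suc k) (UNIV \<times> {0..T}) f"
  shows "\<exists>g. Ck_on k (UNIV \<times> {0..T}) g \<and> (\<forall>t\<in>{0..T}. has_pderiv v (\<lambda>x. f (x, t)) (\<lambda>x. g (x, t)))" (is ?sp)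
    and "\<exists>g. Ck_on k (UNIV \<times> {0..T}) g \<and> has_tderiv T (\<lambda>x t. f (x, t)) (\<lambda>x t. g (x, t))" (is ?tm)
proof -
  let ?S = "UNIV \<times> {0..T} :: ((real \<times> real) \<times> real) set"
  obtain f' where f': "\<And>p. p \<in> ?S \<Longrightarrow> (f has_derivative f' p) (at p within ?S)" "\<And>w. Ck_on k ?S (\<lambda>p. f' p w)"
    using assms by auto
  have lin: "f' p (r *\<^sub>R w) = f' p w * r" if "p \<in> ?S" for p r w
    using linear_scale[OF has_derivative_linear[OF f'(1)[OF that]], of r w] by simp
  have "has_pderiv v (\<lambda>x. f (x, t)) (\<lambda>x. f' (x, t) (dir v, 0))" if t: "t \<in> {0..T}" for t
    unfolding has_pderiv_def
  proof
    fix x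
    have p: "(x, t) \<in> ?S" using t by simp
    have 1: "((\<lambda>r. (x + r *\<^sub>R dir v, t)) has_derivative (\<lambda>r. (r *\<^sub>R dir v, 0))) (at 0)"
      by (auto intro!: derivative_eq_intros)
    have "(f has_derivative f' (x, t)) (at (x, t) within range (\<lambda>r. (x + r *\<^sub>R dir v, t)))"
      by (rule has_derivative_subset[OF f'(1)[OF p]]) (use t in auto)
    then have "((\<lambda>r. f (x + r *\<^sub>R dir v, t)) has_derivative (\<lambda>r. f' (x, t) (r *\<^sub>R dir v, 0))) (at 0)"
      by (intro has_derivative_in_compose[OF 1, of f "f' (x, t)"]) simp
    moreover have "(\<lambda>r. f' (x, t) (r *\<^sub>R dir v, 0)) = (*) (f' (x, t) (dir v, 0))"
    proof
      show "f' (x, t) (r *\<^sub>R dir v, 0) = f' (x, t) (dir v, 0) * r" for r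
        using lin[OF p, of r "(dir v, 0)"] by simp
    qed
    ultimately show "((\<lambda>r. f (x + r *\<^sub>R dir v, t)) has_real_derivative f' (x, t) (dir v, 0)) (at 0)"
      by (simp add: has_field_derivative_def)
  qed
  then show ?sp using f'(2) by blast
  have "has_tderiv T (\<lambda>x t. f (x, t)) (\<lambda>x t. f' (x, t) (0, 1))"
    unfolding has_tderiv_def
  proof (intro allI ballI)
    fix x t assume t: "t \<in> {0..T}"
    then have p: "(x, t) \<in> ?S" by simp
    have 1: "((\<lambda>r. (x, r)) has_derivative (\<lambda>r. (0, r))) (at t within {0..T})"
      by (auto intro!: derivative_eq_intros)
    have "(f has_derivative f' (x, t)) (at (x, t) within (\<lambda>r. (x, r)) ` {0..T})"
      by (rule has_derivative_subset[OF f'(1)[OF p]]) auto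
    then have "((\<lambda>r. f (x, r)) has_derivative (\<lambda>r. f' (x, t) (0, r))) (at t within {0..T})"
      by (rule has_derivative_in_compose[OF 1])
    moreover have "(\<lambda>r. f' (x, t) (0, r)) = (*) (f' (x, t) (0, 1))"
    proof
      show "f' (x, t) (0, r) = f' (x, t) (0, 1) * r" for r
        using lin[OF p, of r "(0, 1)"] by simp
    qed
    ultimately show "((\<lambda>t. f (x, t)) has_real_derivative f' (x, t) (0, 1)) (at t within {0..T})"
      by (simp add: has_field_derivative_def)
  qed
  then show ?tm using f'(2) by blast
qed

text \<open>\<open>g\<close> and its translate by a period are both the derivative of
  \<open>f\<close>, hence equal.\<close>

lemma has_pderiv_periodic:
  assumes "has_pderiv v f g" "periodic2 L1 L2 f" shows "periodic2 L1 L2 g"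
proof -
  have "f (x + (L1, 0)) = f x" "f (x + (0, L2)) = f x" for x
    using assms(2) by (cases x, simp add: periodic2_def)+
  then have "has_pderiv v f (\<lambda>x. g (x + (L1, 0)))" "has_pderiv v f (\<lambda>x. g (x + (0, L2)))"
    using has_pderiv_translate[OF assms(1), of "(L1, 0)"] has_pderiv_translate[OF assms(1), of "(0, L2)"] by simp_all
  then have "(\<lambda>x. g (x + (L1, 0))) = g" "(\<lambda>x. g (x + (0, L2))) = g"
    using has_pderiv_unique assms(1) by blast+
  then have "g ((a, b) + (L1, 0)) = g (a, b)" "g ((a, b) + (0, L2)) = g (a, b)" for a b by metis+
  then show ?thesis by (simp add: periodic2_def)
qed

lemma real_derivative_unique_Icc:
  assumes "(f has_real_derivative a) (at t within {0..T})" "(f has_real_derivative b) (at t within {0..T})"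
    "t \<in> {0..T}" "0 < T"
  shows "a = b"
  using vector_derivative_unique_within_closed_interval[of 0 T t f a b] assms
  by (simp add: has_real_derivative_iff_has_vector_derivative)

lemma has_tderiv_periodic:
  assumes d: "has_tderiv T f g" and p: "\<And>t. t \<in> {0..T} \<Longrightarrow> periodic2 L1 L2 (\<lambda>x. f x t)"
    and "0 < T" "t \<in> {0..T}"
  shows "periodic2 L1 L2 (\<lambda>x. g x t)"
proof -
  have *: "g y t = g x t" if "\<And>t. t \<in> {0..T} \<Longrightarrow> f y t = f x t" for x y
  proof (rule real_derivative_unique_Icc[OF _ _ assms(4,3)])
    show "(f x has_real_derivative g x t) (at t within {0..T})" using d assms(4) by (simp add: has_tderiv_def)
    have "(f y has_real_derivative g y t) (at t within {0..T})" using d assms(4) by (simp add: has_tderiv_def)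
    then show "(f x has_real_derivative g y t) (at t within {0..T})"
      unfolding has_field_derivative_def
      by (rule has_derivative_transform[OF assms(4), rotated]) (simp add: that)
  qed
  show ?thesis unfolding periodic2_def using p by (auto intro!: * simp: periodic2_def)
qed

text \<open>The derivatives inherit periodicity, so compactness of a period cell gives a bound at
  every order, and over the closed time interval it is uniform in \<open>t\<close>.\<close>

lemma slab_Cbound:
  fixes f :: "(real \<times> real) \<times> real \<Rightarrow> real"
  assumes "Ck_on k (UNIV \<times> {0..T}) f" "\<And>t. t \<in> {0..T} \<Longrightarrow> periodic2 L1 L2 (\<lambda>x. f (x, t))"
    and L: "0 < L1" "0 < L2"
  shows "\<exists>M. \<forall>t\<in>{0..T}. Cbound k (\<lambda>x. f (x, t)) M"
  using assms(1,2)
proof (induction k arbitrary: f)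
  case 0
  obtain M where "\<And>x t. t \<in> {0..T} \<Longrightarrow> \<bar>f (x, t)\<bar> \<le> M"
    using periodic_slab_bounded[OF Ck_on_continuous[OF 0(1)] 0(2) L] by blast
  moreover have "continuous_on UNIV (\<lambda>x. f (x, t))" if "t \<in> {0..T}" for t
    using that by (intro continuous_on_compose2[OF Ck_on_continuous[OF 0(1)]] continuous_intros) auto
  ultimately show ?case unfolding Cbound.simps by blast
next
  case (Suc k)
  obtain M where M: "\<And>x t. t \<in> {0..T} \<Longrightarrow> \<bar>f (x, t)\<bar> \<le> M"
    using periodic_slab_bounded[OF Ck_on_continuous[OF Suc(2)] Suc(3) L] by blast
  have c: "continuous_on UNIV (\<lambda>x. f (x, t))" if "t \<in> {0..T}" for t
    using that by (intro continuous_on_compose2[OF Ck_on_continuous[OF Suc(2)]] continuous_intros) auto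
  have "\<exists>g M. \<forall>t\<in>{0..T}. has_pderiv v (\<lambda>x. f (x, t)) (\<lambda>x. g (x, t)) \<and> Cbound k (\<lambda>x. g (x, t)) M" for v
  proof -
    obtain g where g: "Ck_on k (UNIV \<times> {0..T}) g" "\<And>t. t \<in> {0..T} \<Longrightarrow> has_pderiv v (\<lambda>x. f (x, t)) (\<lambda>x. g (x, t))"
      using slab_derivatives(1)[OF Suc(2)] by blast
    then show ?thesis using Suc.IH[OF g(1)] has_pderiv_periodic[OF g(2) Suc(3)] by blast
  qed
  then obtain g N where g: "\<And>v t. t \<in> {0..T} \<Longrightarrow> has_pderiv v (\<lambda>x. f (x, t)) (\<lambda>x. g v (x, t)) \<and> Cbound k (\<lambda>x. g v (x, t)) (N v)"
    by metis
  let ?M = "max M (max (N True) (N False))"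
  have "Cbound (Suc k) (\<lambda>x. f (x, t)) ?M" if t: "t \<in> {0..T}" for t
  proof -
    have "Cbound k (\<lambda>x. g v (x, t)) ?M" for v
      using g[OF t, of v] by (cases v) (auto elim!: Cbound_mono)
    then show ?thesis using g[OF t] M[OF t] c[OF t] by (auto simp: le_max_iff_disj)
  qed
  then show ?case by blast
qed

text \<open>Views a function of space alone as constant in time, so that the bounds on the slab
  apply to the kernels too.\<close>

lemma Ck_on_slab: 
  fixes f :: "real \<times> real \<Rightarrow> real"
  assumes "Ck_on k UNIV f" shows "Ck_on k (UNIV \<times> {0..T}) (\<lambda>p :: (real \<times> real) \<times> real. f (fst p))"
  using assms
proof (induction k arbitrary: f)
  case 0
  then show ?case by (auto intro!: continuous_on_compose2[of UNIV f] continuous_intros)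
next
  case (Suc k)
  then obtain f' where f': "\<And>x. (f has_derivative f' x) (at x)" "\<And>v. Ck_on k UNIV (\<lambda>x. f' x v)" by auto
  have "((\<lambda>p :: (real \<times> real) \<times> real. f (fst p)) has_derivative (\<lambda>v. f' (fst p) (fst v))) (at p within S)" for p S
    by (rule has_derivative_compose[OF has_derivative_fst[OF has_derivative_ident] f'(1)])
  then show ?case using Suc.IH[OF f'(2)] by (auto intro!: exI[of _ "\<lambda>p v. f' (fst p) (fst v)"])
qed

lemma smooth_per_Cbound:
  assumes "smooth_per L1 L2 f" "0 < L1" "0 < L2"
  shows "\<exists>M. Cbound k f M"
proof -
  have "Ck_on k (UNIV \<times> {0..1}) (\<lambda>p :: (real \<times> real) \<times> real. f (fst p))"
    using assms(1) by (intro Ck_on_slab) (simp add: smooth_per_def smooth_on_def)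
  from slab_Cbound[OF this, of L1 L2] show ?thesis using assms by (auto simp: smooth_per_def)
qed

section \<open>Taylor expansions, for the whole line in space and \<open>{0..T}\<close> in
  time\<close>

lemma taylor1:
  fixes f0 f1 f2 :: "real \<Rightarrow> real"
  assumes S: "convex S" "w \<in> S" "z \<in> S"
    and d: "\<And>x. x \<in> S \<Longrightarrow> (f0 has_real_derivative f1 x) (at x within S)"
      "\<And>x. x \<in> S \<Longrightarrow> (f1 has_real_derivative f2 x) (at x within S)"
    and M: "\<And>x. x \<in> S \<Longrightarrow> \<bar>f2 x\<bar> \<le> M"
  shows "\<bar>f0 z - (f0 w + f1 w * (z - w))\<bar> \<le> M * \<bar>z - w\<bar>\<^sup>2"
proof -
  let ?f = "\<lambda>i. if i = 0 then f0 else if i = Suc 0 then f1 else f2"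
  have "norm (?f 0 z - (\<Sum>i\<le>1. ?f i w * (z - w) ^ i / fact i)) \<le> M * norm (z - w) ^ Suc 1 / fact 1"
  proof (rule field_Taylor[OF S(1) _ _ S(2,3)])
    show "(?f i has_field_derivative ?f (Suc i) x) (at x within S)" if "x \<in> S" "i \<le> 1" for i x
      using d[OF that(1)] that(2) by (auto simp: le_Suc_eq)
  qed (use M in simp)
  then show ?thesis by (simp add: power2_eq_square)
qed

lemma taylor2:
  fixes f0 f1 f2 f3 :: "real \<Rightarrow> real"
  assumes S: "convex S" "w \<in> S" "z \<in> S"
    and d: "\<And>x. x \<in> S \<Longrightarrow> (f0 has_real_derivative f1 x) (at x within S)"
      "\<And>x. x \<in> S \<Longrightarrow> (f1 has_real_derivative f2 x) (at x within S)"
      "\<And>x. x \<in> S \<Longrightarrow> (f2 has_real_derivative f3 x) (at x within S)"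
    and M: "\<And>x. x \<in> S \<Longrightarrow> \<bar>f3 x\<bar> \<le> M"
  shows "\<bar>f0 z - (f0 w + f1 w * (z - w) + f2 w * (z - w)\<^sup>2 / 2)\<bar> \<le> M * \<bar>z - w\<bar> ^ 3 / 2"
proof -
  let ?f = "\<lambda>i. if i = 0 then f0 else if i = Suc 0 then f1 else if i = 2 then f2 else f3"
  have "norm (?f 0 z - (\<Sum>i\<le>2. ?f i w * (z - w) ^ i / fact i)) \<le> M * norm (z - w) ^ Suc 2 / fact 2"
  proof (rule field_Taylor[OF S(1) _ _ S(2,3)])
    show "(?f i has_field_derivative ?f (Suc i) x) (at x within S)" if "x \<in> S" "i \<le> 2" for i x
      using d[OF that(1)] that(2) by (auto simp: le_Suc_eq numeral_2_eq_2)
  qed (use M in simp)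
  then show ?thesis by (simp add: numeral_2_eq_2 numeral_3_eq_3 algebra_simps)
qed

lemma taylor3:
  fixes f0 f1 f2 f3 f4 :: "real \<Rightarrow> real"
  assumes S: "convex S" "w \<in> S" "z \<in> S"
    and d: "\<And>x. x \<in> S \<Longrightarrow> (f0 has_real_derivative f1 x) (at x within S)"
      "\<And>x. x \<in> S \<Longrightarrow> (f1 has_real_derivative f2 x) (at x within S)"
      "\<And>x. x \<in> S \<Longrightarrow> (f2 has_real_derivative f3 x) (at x within S)"
      "\<And>x. x \<in> S \<Longrightarrow> (f3 has_real_derivative f4 x) (at x within S)"
    and M: "\<And>x. x \<in> S \<Longrightarrow> \<bar>f4 x\<bar> \<le> M"
  shows "\<bar>f0 z - (f0 w + f1 w * (z - w) + f2 w * (z - w)\<^sup>2 / 2 + f3 w * (z - w) ^ 3 / 6)\<bar>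
           \<le> M * \<bar>z - w\<bar> ^ 4 / 6"
proof -
  let ?f = "\<lambda>i. if i = 0 then f0 else if i = Suc 0 then f1 else if i = 2 then f2 else if i = 3 then f3 else f4"
  have "norm (?f 0 z - (\<Sum>i\<le>3. ?f i w * (z - w) ^ i / fact i)) \<le> M * norm (z - w) ^ Suc 3 / fact 3"
  proof (rule field_Taylor[OF S(1) _ _ S(2,3)])
    show "(?f i has_field_derivative ?f (Suc i) x) (at x within S)" if "x \<in> S" "i \<le> 3" for i x
      using d[OF that(1)] that(2) by (auto simp: le_Suc_eq numeral_2_eq_2 numeral_3_eq_3)
  qed (use M in simp)
  then show ?thesis by (simp add: eval_nat_numeral algebra_simps)
qed

subsection \<open>The trapezoidal rule\<close>

text \<open>The error over \<open>{a..x}\<close>, as a function \<open>P\<close> of the end point,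
  vanishes at \<open>a\<close>, and its derivative is half a first-order Taylor remainder. So the
  derivative is O(\<open>h\<^sup>2\<close>), and the mean value inequality adds the third
  power.\<close>

lemma trapezoid_cell:
  fixes f f' f'' :: "real \<Rightarrow> real"
  assumes d: "\<And>x. (f has_real_derivative f' x) (at x)" "\<And>x. (f' has_real_derivative f'' x) (at x)"
    and M: "\<And>x. \<bar>f'' x\<bar> \<le> M" and h: "0 < h"
  shows "\<bar>integral {a..a + h} f - h / 2 * (f a + f (a + h))\<bar> \<le> h * (h\<^sup>2 * M)"
proof -
  let ?I = "{a..a + h}"
  have M0: "0 \<le> M" using M[of 0] by linarith
  have cont: "continuous_on ?I f" using d(1) by (meson DERIV_continuous_on has_field_derivative_at_within)
  define P where "P = (\<lambda>x. integral {a..x} f - (x - a) / 2 * (f a + f x))"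
  have dP: "(P has_real_derivative (f x - f a) / 2 - (x - a) / 2 * f' x) (at x within ?I)" if "x \<in> ?I" for x
  proof -
    have 1: "((\<lambda>x. (x - a) / 2) has_real_derivative 1 / 2) (at x within ?I)"
      by (auto intro!: derivative_eq_intros)
    have 2: "((\<lambda>x. f a + f x) has_real_derivative 0 + f' x) (at x within ?I)"
      by (rule DERIV_add[OF DERIV_const has_field_derivative_at_within[OF d(1)]])
    have "(P has_real_derivative f x - ((x - a) / 2 * (0 + f' x) + 1 / 2 * (f a + f x))) (at x within ?I)"
      unfolding P_def by (rule DERIV_diff[OF integral_has_real_derivative[OF cont that] DERIV_mult'[OF 1 2]])
    then show ?thesis by (simp add: field_simps)
  qed
  have bound: "\<bar>(f x - f a) / 2 - (x - a) / 2 * f' x\<bar> \<le> h\<^sup>2 * M" if "x \<in> ?I" for x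
  proof -
    have "\<bar>f a - (f x + f' x * (a - x))\<bar> \<le> M * \<bar>a - x\<bar>\<^sup>2"
      by (rule taylor1[where S=UNIV]) (use d M in auto)
    also have "\<dots> \<le> M * h\<^sup>2" using that M0 by (intro mult_left_mono power_mono) auto
    finally have "\<bar>f a - (f x + f' x * (a - x))\<bar> \<le> M * h\<^sup>2" .
    moreover have "(f x - f a) / 2 - (x - a) / 2 * f' x = - (f a - (f x + f' x * (a - x))) / 2"
      by (simp add: field_simps)
    then have "\<bar>(f x - f a) / 2 - (x - a) / 2 * f' x\<bar> = \<bar>f a - (f x + f' x * (a - x))\<bar> / 2"
      by (simp only: abs_divide abs_minus_cancel abs_numeral)
    moreover have "X = A / 2 \<Longrightarrow> A \<le> K \<Longrightarrow> 0 \<le> A \<Longrightarrow> X \<le> K" for X A K :: real by simp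
    ultimately show ?thesis unfolding mult.commute[of "h\<^sup>2" M] using abs_ge_zero by blast
  qed
  have "norm (P (a + h) - P a) \<le> h\<^sup>2 * M * norm (a + h - a)"
    by (rule field_differentiable_bound[of ?I P "\<lambda>x. (f x - f a) / 2 - (x - a) / 2 * f' x"])
      (use dP bound h in auto)
  then show ?thesis using h by (simp add: P_def mult_ac)
qed

lemma trapezoid_1d:
  fixes f f' f'' :: "real \<Rightarrow> real"
  assumes d: "\<And>x. (f has_real_derivative f' x) (at x)" "\<And>x. (f' has_real_derivative f'' x) (at x)"
    and M: "\<And>x. \<bar>f'' x\<bar> \<le> M" and h: "0 < h" and per: "f (real m * h) = f 0"
  shows "\<bar>h * (\<Sum>k=1..int m. f (of_int k * h)) - integral {0..real m * h} f\<bar> \<le> real m * h * (h\<^sup>2 * M)"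
proof -
  have cont: "continuous_on S f" for S using d(1) by (meson DERIV_continuous_on has_field_derivative_at_within)
  \<comment> \<open>The boundary term turns the sum over right end points into the trapezoidal sum,
    which is what can be added up cell by cell. It vanishes by periodicity at the given
    \<open>m\<close>.\<close>
  have "\<bar>h * (\<Sum>k=1..int m. f (of_int k * h)) + h / 2 * (f 0 - f (real m * h)) - integral {0..real m * h} f\<bar>
      \<le> real m * h * (h\<^sup>2 * M)" for m :: nat
  proof (induction m)
    case 0
    then show ?case by simp
  next
    case (Suc m)
    have e: "real (Suc m) * h = real m * h + h" by (simp add: algebra_simps)
    have "{1..int (Suc m)} = insert (int (Suc m)) {1..int m}" by auto
    then have sum: "(\<Sum>k=1..int (Suc m). f (of_int k * h)) = f (real m * h + h) + (\<Sum>k=1..int m. f (of_int k * h))"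
      by (simp add: algebra_simps)
    have int: "integral {0..real m * h + h} f = integral {0..real m * h} f + integral {real m * h..real m * h + h} f"
      using h by (intro Henstock_Kurzweil_Integration.integral_combine[symmetric] integrable_continuous_interval cont) auto
    have cell: "\<bar>integral {real m * h..real m * h + h} f - h / 2 * (f (real m * h) + f (real m * h + h))\<bar> \<le> h * (h\<^sup>2 * M)"
      by (rule trapezoid_cell[OF d M h])
    have "h * (\<Sum>k=1..int (Suc m). f (of_int k * h)) + h / 2 * (f 0 - f (real m * h + h)) - integral {0..real m * h + h} f
      = (h * (\<Sum>k=1..int m. f (of_int k * h)) + h / 2 * (f 0 - f (real m * h)) - integral {0..real m * h} f)
        - (integral {real m * h..real m * h + h} f - h / 2 * (f (real m * h) + f (real m * h + h)))"
      unfolding sum int by (simp add: field_simps)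
    then have "\<bar>h * (\<Sum>k=1..int (Suc m). f (of_int k * h)) + h / 2 * (f 0 - f (real m * h + h)) - integral {0..real m * h + h} f\<bar>
      \<le> real m * h * (h\<^sup>2 * M) + h * (h\<^sup>2 * M)" using Suc cell by linarith
    also have "\<dots> = real (Suc m) * h * (h\<^sup>2 * M)" by (simp add: algebra_simps)
    finally show ?case unfolding e .
  qed
  from this[of m] show ?thesis by (simp add: per)
qed

lemma Omega_integral:
  fixes f :: "real \<times> real \<Rightarrow> real"
  shows "integral (Omega L1 L2) f = integral (cbox (0, 0) (L1, L2)) f"
proof -
  have "Omega L1 L2 = box (0, 0) (L1, L2)" by (simp add: Omega_def box_prod)
  then show ?thesis by (simp add: integral_open_interval)
qed

lemma has_pderiv_line:
  assumes "has_pderiv v f g"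
  shows "v \<Longrightarrow> ((\<lambda>a. f (a, y)) has_real_derivative g (r, y)) (at r)"
    and "\<not> v \<Longrightarrow> ((\<lambda>b. f (x, b)) has_real_derivative g (x, r)) (at r)"
  using has_pderiv_at[OF assms, of "(0, y)" r] has_pderiv_at[OF assms, of "(x, 0)" r]
  by (auto simp: dir_def)

text \<open>The rule is applied in the second variable at each grid value of the first, and then in
  the first variable under the integral over the second.\<close>

lemma trapezoid_2d:
  assumes F: "Cbound 2 F M" and per: "periodic2 (real m * h) (real n * h) F" and h: "0 < h"
  shows "\<bar>h\<^sup>2 * (\<Sum>k=1..int m. \<Sum>l=1..int n. F (of_int k * h, of_int l * h)) - integral (Omega (real m * h) (real n * h)) F\<bar>
    \<le> 2 * ((real m * h) * (real n * h)) * (h\<^sup>2 * M)"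
proof -
  let ?L1 = "real m * h" and ?L2 = "real n * h"
  have "\<exists>g k. has_pderiv v F g \<and> has_pderiv v g k \<and> (\<forall>x. \<bar>k x\<bar> \<le> M)" for v
    using F by (metis Cbound.simps(2) Cbound_abs_le numeral_2_eq_2)
  then obtain Fx Fxx Fy Fyy where
    x: "has_pderiv True F Fx" "has_pderiv True Fx Fxx" "\<And>x. \<bar>Fxx x\<bar> \<le> M" and
    y: "has_pderiv False F Fy" "has_pderiv False Fy Fyy" "\<And>x. \<bar>Fyy x\<bar> \<le> M" by meson
  have cF: "continuous_on S F" for S using Cbound_continuous[OF F] continuous_on_subset by blast
  have cx: "continuous_on S (\<lambda>a. F (a, b))" and cy: "continuous_on S (\<lambda>b. F (a, b))" for S a b
    by (intro continuous_on_compose2[OF cF[of UNIV]] continuous_intros; simp)+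
  have px: "F (?L1, b) = F (0, b)" "F (a, ?L2) = F (a, 0)" for a b
    using per unfolding periodic2_def by (metis add_0)+
  have inner: "\<bar>h * (\<Sum>l=1..int n. F (a, of_int l * h)) - integral {0..?L2} (\<lambda>b. F (a, b))\<bar> \<le> ?L2 * (h\<^sup>2 * M)" for a
    by (rule trapezoid_1d[where f'="\<lambda>b. Fy (a, b)" and f''="\<lambda>b. Fyy (a, b)"])
      (use has_pderiv_line(2)[OF y(1)] has_pderiv_line(2)[OF y(2)] y(3) h px in auto)
  have outer: "\<bar>h * (\<Sum>k=1..int m. F (of_int k * h, b)) - integral {0..?L1} (\<lambda>a. F (a, b))\<bar> \<le> ?L1 * (h\<^sup>2 * M)" for b
    by (rule trapezoid_1d[where f'="\<lambda>a. Fx (a, b)" and f''="\<lambda>a. Fxx (a, b)"])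
      (use has_pderiv_line(1)[OF x(1)] has_pderiv_line(1)[OF x(2)] x(3) h px in auto)
  have c2: "continuous_on {0..?L2} (\<lambda>b. integral {0..?L1} (\<lambda>a. F (a, b)))"
    using integral_continuous_on_param[of "{0..?L2}" 0 ?L1 "\<lambda>b a. F (a, b)"]
      continuous_on_compose2[OF cF[of UNIV], of _ "\<lambda>p. (snd p, fst p)"]
    by (simp add: case_prod_unfold continuous_intros)
  \<comment> \<open>The first variable is integrated inside, so that \<open>outer\<close> bounds the
    integrand for each \<open>b\<close>.\<close>
  have I: "integral (Omega ?L1 ?L2) F = integral {0..?L2} (\<lambda>b. integral {0..?L1} (\<lambda>a. F (a, b)))"
    using integral_prod_continuous[OF cF, of 0 0 ?L1 ?L2] integral_swap_continuous[of 0 0 ?L1 ?L2 "\<lambda>a b. F (a, b)"] cF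
    unfolding Omega_integral by (simp add: case_prod_unfold)
  have 1: "\<bar>h\<^sup>2 * (\<Sum>k=1..int m. \<Sum>l=1..int n. F (of_int k * h, of_int l * h))
      - h * (\<Sum>k=1..int m. integral {0..?L2} (\<lambda>b. F (of_int k * h, b)))\<bar> \<le> ?L1 * (?L2 * (h\<^sup>2 * M))"
  proof -
    have "h\<^sup>2 * (\<Sum>k=1..int m. \<Sum>l=1..int n. F (of_int k * h, of_int l * h))
      - h * (\<Sum>k=1..int m. integral {0..?L2} (\<lambda>b. F (of_int k * h, b)))
      = h * (\<Sum>k=1..int m. h * (\<Sum>l=1..int n. F (of_int k * h, of_int l * h)) - integral {0..?L2} (\<lambda>b. F (of_int k * h, b)))"
      by (simp add: sum_subtractf right_diff_distrib power2_eq_square sum_distrib_left mult.assoc)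
    also have "\<bar>\<dots>\<bar> \<le> \<bar>h\<bar> * (\<Sum>k=1..int m. ?L2 * (h\<^sup>2 * M))"
      unfolding abs_mult by (rule mult_left_mono[OF order_trans[OF sum_abs sum_mono[OF inner]]]) simp
    also have "\<bar>h\<bar> = h" using h by simp
    finally show ?thesis by (simp add: mult_ac)
  qed
  have 2: "\<bar>h * (\<Sum>k=1..int m. integral {0..?L2} (\<lambda>b. F (of_int k * h, b))) - integral (Omega ?L1 ?L2) F\<bar>
      \<le> ?L1 * (h\<^sup>2 * M) * ?L2"
  proof -
    have i: "(\<lambda>b. F (a, b)) integrable_on {0..?L2}" for a by (intro integrable_continuous_interval cy)
    have "h * (\<Sum>k=1..int m. integral {0..?L2} (\<lambda>b. F (of_int k * h, b))) - integral (Omega ?L1 ?L2) F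
      = integral {0..?L2} (\<lambda>b. h * (\<Sum>k=1..int m. F (of_int k * h, b)) - integral {0..?L1} (\<lambda>a. F (a, b)))"
      unfolding I
      by (subst Henstock_Kurzweil_Integration.integral_diff)
        (auto intro!: integrable_continuous_interval continuous_intros cy c2 simp: Henstock_Kurzweil_Integration.integral_sum i)
    also have "norm \<dots> \<le> ?L1 * (h\<^sup>2 * M) * (?L2 - 0)"
      by (rule integral_bound) (use h outer in \<open>auto intro!: continuous_intros cy c2\<close>)
    finally show ?thesis by simp
  qed
  show ?thesis using 1 2 by (simp add: algebra_simps)
qed

subsection \<open>Periodic convolution\<close>

lemma pconv_continuous_integrand:
  fixes J f :: "real \<times> real \<Rightarrow> real"
  assumes "continuous_on UNIV J" "continuous_on UNIV f"
  shows "continuous_on S (\<lambda>y. J y * f (x - y))"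
  by (intro continuous_intros continuous_on_compose2[OF assms(2)] continuous_on_subset[OF assms(1)]) auto

lemma pconv_cbox: "pconv L1 L2 J f x = integral (cbox (0, 0) (L1, L2)) (\<lambda>y. J y * f (x - y))"
  by (simp add: pconv_def Omega_integral)

lemma pconv_integrable:
  fixes J f :: "real \<times> real \<Rightarrow> real"
  assumes "continuous_on UNIV J" "continuous_on UNIV f"
  shows "(\<lambda>y. J y * f (x - y)) integrable_on cbox (0, 0) (L1, L2)"
  by (intro integrable_continuous pconv_continuous_integrand assms)

lemma has_pderiv_pconv:
  assumes J: "continuous_on UNIV J" and f: "has_pderiv v f g" "continuous_on UNIV f" "continuous_on UNIV g"
  shows "has_pderiv v (pconv L1 L2 J f) (pconv L1 L2 J g)"
  unfolding has_pderiv_def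
proof
  fix x
  have "((\<lambda>r. integral (cbox (0, 0) (L1, L2)) (\<lambda>y. J y * f (x + r *\<^sub>R dir v - y))) has_field_derivative
     integral (cbox (0, 0) (L1, L2)) (\<lambda>y. J y * g (x + 0 *\<^sub>R dir v - y))) (at 0 within UNIV)"
  proof (rule leibniz_rule_field_derivative)
    show "((\<lambda>r. J y * f (x + r *\<^sub>R dir v - y)) has_field_derivative J y * g (x + r *\<^sub>R dir v - y)) (at r within UNIV)" for r y
      using has_pderiv_at[OF f(1), of "x - y" r] by (intro DERIV_cmult) (simp add: algebra_simps)
    show "continuous_on (UNIV \<times> cbox (0, 0) (L1, L2)) (\<lambda>(r, y). J y * g (x + r *\<^sub>R dir v - y))"
      unfolding case_prod_unfold
      by (intro continuous_intros continuous_on_compose2[OF J] continuous_on_compose2[OF f(3)]) auto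
  qed (auto intro: pconv_integrable J f)
  then show "((\<lambda>r. pconv L1 L2 J f (x + r *\<^sub>R dir v)) has_real_derivative pconv L1 L2 J g x) (at 0)"
    by (simp add: pconv_cbox)
qed

lemma pconv_continuous:
  assumes J: "continuous_on UNIV J" and f: "continuous_on UNIV f"
  shows "continuous_on UNIV (pconv L1 L2 J f)"
proof -
  have "continuous_on (UNIV \<times> cbox (0, 0) (L1, L2)) (\<lambda>(x, y). J y * f (x - y))"
    unfolding case_prod_unfold
    by (intro continuous_intros continuous_on_compose2[OF J] continuous_on_compose2[OF f]) auto
  from integral_continuous_on_param[OF this] show ?thesis by (simp add: pconv_cbox[abs_def])
qed

lemma pconv_abs_le:
  assumes J: "continuous_on UNIV J" "\<And>x. \<bar>J x\<bar> \<le> MJ" and f: "continuous_on UNIV f" "\<And>x. \<bar>f x\<bar> \<le> M"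
    and L: "0 \<le> L1" "0 \<le> L2"
  shows "\<bar>pconv L1 L2 J f x\<bar> \<le> L1 * L2 * (MJ * M)"
proof -
  have M0: "0 \<le> MJ" using J(2)[of 0] by linarith
  have "norm (integral (cbox (0, 0) (L1, L2)) (\<lambda>y. J y * f (x - y))) \<le> MJ * M * measure lborel (cbox (0, 0) (L1, L2))"
  proof (rule has_integral_bound[OF _ integrable_integral[OF pconv_integrable[OF J(1) f(1)]]])
    show "0 \<le> MJ * M" using M0 f(2)[of 0] by simp
    show "norm (J y * f (x - y)) \<le> MJ * M" for y
      unfolding real_norm_def abs_mult using J(2) f(2) M0 by (intro mult_mono) auto
  qed
  then show ?thesis using L by (simp add: pconv_cbox content_Pair mult_ac)
qed

lemma Cbound_pconv:
  assumes J: "continuous_on UNIV J" "\<And>x. \<bar>J x\<bar> \<le> MJ" and L: "0 \<le> L1" "0 \<le> L2"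
  shows "Cbound k f M \<Longrightarrow> Cbound k (pconv L1 L2 J f) (L1 * L2 * (MJ * M))"
proof (induction k arbitrary: f)
  case 0
  then show ?case using pconv_continuous[OF J(1)] pconv_abs_le[OF J _ _ L] by auto
next
  case (Suc k)
  have "\<exists>u. has_pderiv v (pconv L1 L2 J f) u \<and> Cbound k u (L1 * L2 * (MJ * M))" for v
  proof -
    obtain g where g: "has_pderiv v f g" "Cbound k g M" using Suc.prems by (meson Cbound.simps(2))
    then show ?thesis
      using has_pderiv_pconv[OF J(1) g(1) Cbound_continuous[OF Suc.prems] Cbound_continuous[OF g(2)]] Suc.IH[OF g(2)]
      by blast
  qed
  then show ?case
    using pconv_continuous[OF J(1)] pconv_abs_le[OF J _ _ L] Cbound_continuous[OF Suc.prems] Cbound_abs_le[OF Suc.prems]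
    by simp
qed

lemma pdiffs_pconv:
  assumes J: "continuous_on UNIV J" and f: "continuous_on UNIV f"
  shows "pdiffs h vs (pconv L1 L2 J f) = pconv L1 L2 J (pdiffs h vs f)"
proof (induction vs)
  case (Cons v vs)
  let ?g = "pdiffs h vs f"
  have "pdiff h v (pconv L1 L2 J ?g) x = pconv L1 L2 J (pdiff h v ?g) x" for x
  proof -
    have c: "continuous_on UNIV ?g" by (rule pdiffs_continuous[OF f])
    have "pconv L1 L2 J (pdiff h v ?g) x = integral (cbox (0, 0) (L1, L2)) (\<lambda>y. (J y * ?g (x + h *\<^sub>R dir v - y) - J y * ?g (x - y)) / h)"
      unfolding pconv_cbox pdiff_def by (simp add: algebra_simps)
    also have "\<dots> = pdiff h v (pconv L1 L2 J ?g) x"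
      unfolding pdiff_def pconv_cbox
      by (simp add: Henstock_Kurzweil_Integration.integral_diff pconv_integrable J c)
    finally show ?thesis by simp
  qed
  then show ?case using Cons by auto
qed simp

lemma Cbound_pdiffs: "Cbound (k + length vs) f M \<Longrightarrow> 0 < h \<Longrightarrow> Cbound k (pdiffs h vs f) M"
proof (induction k arbitrary: f)
  case 0
  then show ?case using pdiffs_continuous[OF Cbound_continuous] pdiffs_bound[of "length vs" f M vs h] by auto
next
  case (Suc k)
  have "\<exists>u. has_pderiv v (pdiffs h vs f) u \<and> Cbound k u M" for v
  proof -
    obtain g where "has_pderiv v f g" "Cbound (k + length vs) g M"
      using Suc.prems by (metis Cbound.simps(2) add_Suc)
    then show ?thesis using has_pderiv_pdiffs Suc.IH Suc.prems(2) by blast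
  qed
  then show ?case
    using pdiffs_continuous[OF Cbound_continuous[OF Suc.prems(1)]] pdiffs_bound[OF Suc.prems(1), of vs h] Suc.prems(2)
    by auto
qed

text \<open>Vertices lie at integer multiples of \<open>h\<close>, so the discrete convolution at
  \<open>x\<close> is the trapezoidal sum of \<open>J y * g (x - y)\<close> over a full period.
  Differences commute with both convolutions and fall on \<open>f\<close>, so it suffices to treat
  \<open>g = pdiffs h vs f\<close>. The constant is 2 from the rule times 4 from two derivatives of
  a product.\<close>

lemma (in pgrid) sbound_dconv_pconv:
  assumes J: "Cbound 2 J MJ" "periodic2 (real m * h) (real n * h) J"
    and f: "Cbound (k + 2) f M" "periodic2 (real m * h) (real n * h) f"
  shows "sbound h k (\<lambda>i j. dconv m n h (vertex_restr h J) (cell_restr h f) i j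
      - cell_restr h (pconv (real m * h) (real n * h) J f) i j) (8 * area * (MJ * M) * h\<^sup>2)"
  unfolding sbound_def
proof (intro allI impI)
  fix vs :: "bool list" and i j assume vs: "length vs \<le> k"
  let ?L1 = "real m * h" and ?L2 = "real n * h"
  have cJ: "continuous_on UNIV J" and cf: "continuous_on UNIV f" using J f Cbound_continuous by auto
  define g where "g = pdiffs h vs f"
  define x where "x = (grid_pt h (of_int i), grid_pt h (of_int j))"
  have g: "Cbound 2 g M" unfolding g_def
    using f(1) vs h_pos by (intro Cbound_pdiffs Cbound_mono[OF f(1)]) auto
  have pg: "periodic2 ?L1 ?L2 g" unfolding g_def by (rule pdiffs_periodic[OF f(2)])
  let ?F = "\<lambda>y. J y * g (x - y)"
  have "Cbound 2 ?F (4 * (MJ * M))" using Cbound_mult[OF J(1) Cbound_reflect[OF g, of x]] by simp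
  moreover have "periodic2 ?L1 ?L2 ?F"
  proof -
    have g1: "g (a - ?L1, b) = g (a, b)" "g (a, b - ?L2) = g (a, b)" for a b
      using pg unfolding periodic2_def by (metis diff_add_cancel)+
    show ?thesis using J(2) g1 by (cases x) (simp add: periodic2_def diff_diff_eq[symmetric])
  qed
  ultimately have trap: "\<bar>h\<^sup>2 * (\<Sum>k=1..int m. \<Sum>l=1..int n. ?F (of_int k * h, of_int l * h)) - integral (Omega ?L1 ?L2) ?F\<bar>
      \<le> 2 * (?L1 * ?L2) * (h\<^sup>2 * (4 * (MJ * M)))"
    by (rule trapezoid_2d[OF _ _ h_pos])
  have "vertex_restr h J k l = J (of_int k * h, of_int l * h)" for k l
    by (simp add: vertex_restr_def grid_pt_def)
  moreover have "cell_restr h g (i - k) (j - l) = g (x - (of_int k * h, of_int l * h))" for k l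
    by (simp add: cell_restr_def grid_pt_def x_def algebra_simps)
  ultimately have "h\<^sup>2 * (\<Sum>k=1..int m. \<Sum>l=1..int n. ?F (of_int k * h, of_int l * h)) = dconv m n h (vertex_restr h J) (cell_restr h g) i j"
    by (simp add: dconv_def)
  moreover have "integral (Omega ?L1 ?L2) ?F = cell_restr h (pconv ?L1 ?L2 J g) i j"
    by (simp add: pconv_def cell_restr_def x_def)
  ultimately show "\<bar>fdiffs h vs (\<lambda>i j. dconv m n h (vertex_restr h J) (cell_restr h f) i j - cell_restr h (pconv ?L1 ?L2 J f) i j) i j\<bar>
      \<le> 8 * area * (MJ * M) * h\<^sup>2"
    using trap unfolding fdiffs_diff fdiffs_dconv fdiffs_cell_restr pdiffs_pconv[OF cJ cf] g_def[symmetric]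
    by (simp add: algebra_simps)
qed

section \<open>The Laplacian and its five-point approximation\<close>

lemma laplacian_has_pderiv:
  assumes "has_pderiv True u ux" "has_pderiv True ux uxx" "has_pderiv False u uy" "has_pderiv False uy uyy"
  shows "laplacian u = (\<lambda>x. uxx x + uyy x)"
proof
  fix x :: "real \<times> real"
  obtain x1 x2 where x: "x = (x1, x2)" by (cases x)
  have "deriv (\<lambda>a. u (a, x2)) = (\<lambda>a. ux (a, x2))" "deriv (\<lambda>a. ux (a, x2)) = (\<lambda>a. uxx (a, x2))"
    "deriv (\<lambda>b. u (x1, b)) = (\<lambda>b. uy (x1, b))" "deriv (\<lambda>b. uy (x1, b)) = (\<lambda>b. uyy (x1, b))"
    using has_pderiv_line(1)[OF assms(1)] has_pderiv_line(1)[OF assms(2)]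
      has_pderiv_line(2)[OF assms(3)] has_pderiv_line(2)[OF assms(4)] by (auto intro!: ext DERIV_imp_deriv)
  then show "laplacian u x = uxx x + uyy x" by (simp add: laplacian_def x numeral_2_eq_2)
qed

text \<open>The odd Taylor terms cancel and leave two fourth-order remainders.\<close>

lemma second_difference_error:
  fixes v0 v1 v2 v3 v4 :: "real \<Rightarrow> real"
  assumes d: "\<And>x. (v0 has_real_derivative v1 x) (at x)" "\<And>x. (v1 has_real_derivative v2 x) (at x)"
    "\<And>x. (v2 has_real_derivative v3 x) (at x)" "\<And>x. (v3 has_real_derivative v4 x) (at x)"
    and M: "\<And>x. \<bar>v4 x\<bar> \<le> M" and h: "0 < h"
  shows "\<bar>(v0 h + v0 (- h) - 2 * v0 0) / h\<^sup>2 - v2 0\<bar> \<le> h\<^sup>2 * M / 2"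
proof -
  have M0: "0 \<le> M" using M[of 0] by linarith
  have t: "\<bar>v0 z - (v0 0 + v1 0 * (z - 0) + v2 0 * (z - 0)\<^sup>2 / 2 + v3 0 * (z - 0) ^ 3 / 6)\<bar> \<le> M * \<bar>z - 0\<bar> ^ 4 / 6" for z
    by (rule taylor3[where S=UNIV]) (use d M in auto)
  let ?A = "v0 h - (v0 0 + v1 0 * (h - 0) + v2 0 * (h - 0)\<^sup>2 / 2 + v3 0 * (h - 0) ^ 3 / 6)"
  let ?B = "v0 (- h) - (v0 0 + v1 0 * (- h - 0) + v2 0 * (- h - 0)\<^sup>2 / 2 + v3 0 * (- h - 0) ^ 3 / 6)"
  have "v0 h + v0 (- h) - 2 * v0 0 - h\<^sup>2 * v2 0 = ?A + ?B"
    by (simp add: field_simps)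
  also have "\<bar>?A + ?B\<bar> \<le> M * \<bar>h - 0\<bar> ^ 4 / 6 + M * \<bar>- h - 0\<bar> ^ 4 / 6"
    by (rule order_trans[OF abs_triangle_ineq add_mono[OF t t]])
  finally have "\<bar>v0 h + v0 (- h) - 2 * v0 0 - h\<^sup>2 * v2 0\<bar> \<le> M * h ^ 4 / 6 + M * h ^ 4 / 6"
    using h by simp
  also have "\<dots> \<le> h\<^sup>2 * M / 2 * h\<^sup>2" using M0 h by (simp add: eval_nat_numeral algebra_simps)
  finally have "\<bar>v0 h + v0 (- h) - 2 * v0 0 - h\<^sup>2 * v2 0\<bar> / h\<^sup>2 \<le> h\<^sup>2 * M / 2"
    using h by (simp only: pos_divide_le_eq zero_less_power)
  moreover have "(v0 h + v0 (- h) - 2 * v0 0) / h\<^sup>2 - v2 0 = (v0 h + v0 (- h) - 2 * v0 0 - h\<^sup>2 * v2 0) / h\<^sup>2"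
    using h by (simp add: diff_divide_distrib)
  ultimately show ?thesis by (simp add: abs_divide)
qed

lemma sbound_dlaplacian_laplacian:
  assumes G: "Cbound (k + 4) G M" and h: "0 < h"
  shows "sbound h k (\<lambda>i j. dlaplacian h (cell_restr h G) i j - cell_restr h (laplacian G) i j) (h\<^sup>2 * M)"
proof -
  have "\<exists>a b c d. has_pderiv v G a \<and> has_pderiv v a b \<and> has_pderiv v b c \<and> has_pderiv v c d \<and> Cbound k d M" for v
  proof -
    have "Cbound (Suc (Suc (Suc (Suc k)))) G M" using G by (simp add: eval_nat_numeral del: Cbound.simps)
    then show ?thesis by (meson Cbound.simps(2))
  qed
  then obtain a b c d where D: "\<And>v. has_pderiv v G (a v)" "\<And>v. has_pderiv v (a v) (b v)"
    "\<And>v. has_pderiv v (b v) (c v)" "\<And>v. has_pderiv v (c v) (d v)" "\<And>v. Cbound k (d v) M" by metis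
  have lap: "laplacian G = (\<lambda>x. b True x + b False x)" by (rule laplacian_has_pderiv[OF D(1) D(2) D(1) D(2)])
  show ?thesis
    unfolding sbound_def
  proof (intro allI impI)
    fix vs :: "bool list" and i j assume vs: "length vs \<le> k"
    define x where "x = (grid_pt h (of_int i), grid_pt h (of_int j))"
    let ?g = "pdiffs h vs G"
    have one: "\<bar>(?g (x + h *\<^sub>R dir v) + ?g (x + (- h) *\<^sub>R dir v) - 2 * ?g (x + 0 *\<^sub>R dir v)) / h\<^sup>2 - pdiffs h vs (b v) (x + 0 *\<^sub>R dir v)\<bar> \<le> h\<^sup>2 * M / 2" for v
      by (rule second_difference_error[OF has_pderiv_at[OF has_pderiv_pdiffs[OF D(1)]] has_pderiv_at[OF has_pderiv_pdiffs[OF D(2)]]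
          has_pderiv_at[OF has_pderiv_pdiffs[OF D(3)]] has_pderiv_at[OF has_pderiv_pdiffs[OF D(4)]] pdiffs_bound[OF D(5) vs h] h])
    have e1: "dlaplacian h (cell_restr h ?g) i j = (?g (x + h *\<^sub>R dir True) + ?g (x + (- h) *\<^sub>R dir True) - 2 * ?g (x + 0 *\<^sub>R dir True)) / h\<^sup>2
       + (?g (x + h *\<^sub>R dir False) + ?g (x + (- h) *\<^sub>R dir False) - 2 * ?g (x + 0 *\<^sub>R dir False)) / h\<^sup>2"
      by (simp add: dlaplacian_def cell_restr_def x_def dir_def grid_pt_def algebra_simps diff_divide_distrib add_divide_distrib)
    have e2: "fdiffs h vs (cell_restr h (laplacian G)) i j
        = pdiffs h vs (b True) (x + 0 *\<^sub>R dir True) + pdiffs h vs (b False) (x + 0 *\<^sub>R dir False)"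
    proof -
      have "cell_restr h (laplacian G) = (\<lambda>i j. cell_restr h (b True) i j + cell_restr h (b False) i j)"
        by (simp add: lap cell_restr_def fun_eq_iff)
      then show ?thesis by (simp add: fdiffs_add fdiffs_cell_restr) (simp add: cell_restr_def x_def)
    qed
    have tri: "\<bar>X - p\<bar> \<le> K / 2 \<Longrightarrow> \<bar>Y - q\<bar> \<le> K / 2 \<Longrightarrow> \<bar>X + Y - (p + q)\<bar> \<le> K" for X Y p q K :: real
      by linarith
    have e3: "fdiffs h vs (dlaplacian h (cell_restr h G)) i j = dlaplacian h (cell_restr h ?g) i j"
      by (simp add: fdiffs_dlaplacian fdiffs_cell_restr)
    show "\<bar>fdiffs h vs (\<lambda>i j. dlaplacian h (cell_restr h G) i j - cell_restr h (laplacian G) i j) i j\<bar> \<le> h\<^sup>2 * M"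
      unfolding fdiffs_diff e2 e3 e1 by (rule tri[OF one one])
  qed
qed

subsection \<open>The truncation error\<close>

text \<open>The central time difference needs a third time derivative. Each time derivative uses up
  one order of smoothness on the slab, so the argument starts from order
  \<open>k + 3\<close>.\<close>

lemma smooth_solution_time_derivatives:
  assumes smooth: "smooth_on (UNIV \<times> {0..T}) (\<lambda>(x, t). \<Phi> x t)"
    and per: "\<And>t. t \<in> {0..T} \<Longrightarrow> periodic2 L1 L2 (\<lambda>x. \<Phi> x t)" and "0 < T" "0 < L1" "0 < L2"
  shows "\<exists>\<Phi>1 \<Phi>2 \<Phi>3 M. has_tderiv T \<Phi> \<Phi>1 \<and> has_tderiv T \<Phi>1 \<Phi>2 \<and> has_tderiv T \<Phi>2 \<Phi>3 \<and>
    (\<forall>\<Psi>\<in>{\<Phi>, \<Phi>1, \<Phi>2, \<Phi>3}. \<forall>t\<in>{0..T}. Cbound k (\<lambda>x. \<Psi> x t) M)"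
proof -
  let ?S = "UNIV \<times> {0..T} :: ((real \<times> real) \<times> real) set"
  define F where "F = (\<lambda>(x, t). \<Phi> x t)"
  have F: "F (x, t) = \<Phi> x t" for x t by (simp add: F_def)
  have 0: "Ck_on (Suc (Suc (Suc k))) ?S F" using smooth by (simp add: smooth_on_def F_def del: Ck_on.simps)
  obtain F1 where 1: "Ck_on (Suc (Suc k)) ?S F1" "has_tderiv T (\<lambda>x t. F (x, t)) (\<lambda>x t. F1 (x, t))"
    using slab_derivatives(2)[OF 0] by blast
  obtain F2 where 2: "Ck_on (Suc k) ?S F2" "has_tderiv T (\<lambda>x t. F1 (x, t)) (\<lambda>x t. F2 (x, t))"
    using slab_derivatives(2)[OF 1(1)] by blast
  obtain F3 where 3: "Ck_on k ?S F3" "has_tderiv T (\<lambda>x t. F2 (x, t)) (\<lambda>x t. F3 (x, t))"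
    using slab_derivatives(2)[OF 2(1)] by blast
  have p: "periodic2 L1 L2 (\<lambda>x. F (x, t))" if "t \<in> {0..T}" for t using per[OF that] by (simp add: F_def)
  have p1: "periodic2 L1 L2 (\<lambda>x. F1 (x, t))" if "t \<in> {0..T}" for t
    using has_tderiv_periodic[OF 1(2) p \<open>0 < T\<close> that] .
  have p2: "periodic2 L1 L2 (\<lambda>x. F2 (x, t))" if "t \<in> {0..T}" for t
    using has_tderiv_periodic[OF 2(2) p1 \<open>0 < T\<close> that] .
  have p3: "periodic2 L1 L2 (\<lambda>x. F3 (x, t))" if "t \<in> {0..T}" for t
    using has_tderiv_periodic[OF 3(2) p2 \<open>0 < T\<close> that] .
  obtain M0 M1 M2 M3 where M:
    "\<forall>t\<in>{0..T}. Cbound (Suc (Suc (Suc k))) (\<lambda>x. F (x, t)) M0"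
    "\<forall>t\<in>{0..T}. Cbound (Suc (Suc k)) (\<lambda>x. F1 (x, t)) M1"
    "\<forall>t\<in>{0..T}. Cbound (Suc k) (\<lambda>x. F2 (x, t)) M2"
    "\<forall>t\<in>{0..T}. Cbound k (\<lambda>x. F3 (x, t)) M3"
    using slab_Cbound[OF 0 p assms(4,5)] slab_Cbound[OF 1(1) p1 assms(4,5)]
      slab_Cbound[OF 2(1) p2 assms(4,5)] slab_Cbound[OF 3(1) p3 assms(4,5)] by blast
  define M where "M = max (max M0 M1) (max M2 M3)"
  have "M0 \<le> M" "M1 \<le> M" "M2 \<le> M" "M3 \<le> M" by (auto simp: M_def)
  then have "Cbound k (\<lambda>x. F (x, t)) M" "Cbound k (\<lambda>x. F1 (x, t)) M" "Cbound k (\<lambda>x. F2 (x, t)) M"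
    "Cbound k (\<lambda>x. F3 (x, t)) M" if "t \<in> {0..T}" for t
    using Cbound_mono[OF bspec[OF M(1) that], of k M] Cbound_mono[OF bspec[OF M(2) that], of k M]
      Cbound_mono[OF bspec[OF M(3) that], of k M] Cbound_mono[OF bspec[OF M(4) that], of k M] by simp_all
  then have "\<forall>\<Psi>\<in>{\<Phi>, \<lambda>x t. F1 (x, t), \<lambda>x t. F2 (x, t), \<lambda>x t. F3 (x, t)}. \<forall>t\<in>{0..T}. Cbound k (\<lambda>x. \<Psi> x t) M"
    unfolding F by blast
  moreover have "has_tderiv T \<Phi> (\<lambda>x t. F1 (x, t))" using 1(2) unfolding F .
  ultimately show ?thesis using 2(2) 3(2) by blast
qed

abbreviation slice :: "real \<Rightarrow> (real \<times> real \<Rightarrow> real \<Rightarrow> real) \<Rightarrow> real \<Rightarrow> grid_fun" where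
  "slice h f t \<equiv> cell_restr h (\<lambda>x. f x t)"

lemma slice_tderiv:
  assumes "has_tderiv T f g" "t \<in> {0..T}"
  shows "((\<lambda>t. fdiffs h vs (slice h f t) i j) has_real_derivative fdiffs h vs (slice h g t) i j) (at t within {0..T})"
  using has_tderiv_pdiffs[OF assms(1), of h vs] assms(2)
  by (simp add: fdiffs_cell_restr has_tderiv_def cell_restr_def)

text \<open>With \<open>c\<close> the midpoint of a step of length \<open>2 * r\<close>, the levels
  \<open>k - 1\<close>, \<open>k\<close>, \<open>k + 1\<close> lie at \<open>c - 3 * r\<close>,
  \<open>c - r\<close>, \<open>c + r\<close>. The claims concern the increment, the mean, the
  difference quotient and the extrapolation, the last with \<open>6 = 3/2 + 9/2\<close>. The final
  claim is the extrapolation in the first step: both old levels coincide and only first order is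
  left.\<close>

lemma time_difference_errors:
  assumes d: "has_tderiv T \<Phi> \<Phi>1" "has_tderiv T \<Phi>1 \<Phi>2" "has_tderiv T \<Phi>2 \<Phi>3"
    and M: "\<And>t. t \<in> {0..T} \<Longrightarrow> sbound h k (slice h \<Phi>1 t) M" "\<And>t. t \<in> {0..T} \<Longrightarrow> sbound h k (slice h \<Phi>2 t) M"
      "\<And>t. t \<in> {0..T} \<Longrightarrow> sbound h k (slice h \<Phi>3 t) M"
    and r: "0 < r" "0 \<le> c - r" "c + r \<le> T"
  shows "sbound h k (\<lambda>i j. slice h \<Phi> (c + r) i j - slice h \<Phi> (c - r) i j) (2 * (M * r))"
    and "sbound h k (\<lambda>i j. 1/2 * (slice h \<Phi> (c - r) i j + slice h \<Phi> (c + r) i j) - slice h \<Phi> c i j) (M * r\<^sup>2)"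
    and "sbound h k (\<lambda>i j. 1 / (2 * r) * (slice h \<Phi> (c + r) i j - slice h \<Phi> (c - r) i j) - slice h \<Phi>1 c i j) (M * r\<^sup>2)"
    and "0 \<le> c - 3 * r \<Longrightarrow>
      sbound h k (\<lambda>i j. 3/2 * slice h \<Phi> (c - r) i j - 1/2 * slice h \<Phi> (c - 3 * r) i j - slice h \<Phi> c i j) (6 * (M * r\<^sup>2))"
    and "sbound h k (\<lambda>i j. 3/2 * slice h \<Phi> (c - r) i j - 1/2 * slice h \<Phi> (c - r) i j - slice h \<Phi> c i j) (M * r)"
proof -
  let ?g = "\<lambda>\<Psi> vs i j t. fdiffs h vs (slice h \<Psi> t) i j"
  have mem: "c \<in> {0..T}" "c - r \<in> {0..T}" "c + r \<in> {0..T}" using r by auto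
  have lip: "\<bar>?g \<Phi> vs i j b - ?g \<Phi> vs i j a\<bar> \<le> M * \<bar>b - a\<bar>"
    if "length vs \<le> k" "a \<in> {0..T}" "b \<in> {0..T}" for vs i j a b
    using field_differentiable_bound[of "{0..T}" "?g \<Phi> vs i j" "?g \<Phi>1 vs i j" M b a]
      slice_tderiv[OF d(1)] sboundD[OF M(1) that(1)] that by simp
  have t1: "\<bar>?g \<Phi> vs i j z - (?g \<Phi> vs i j c + ?g \<Phi>1 vs i j c * (z - c))\<bar> \<le> M * \<bar>z - c\<bar>\<^sup>2"
    if "length vs \<le> k" "z \<in> {0..T}" for vs i j z
    by (rule taylor1[where S="{0..T}" and ?f1.0="?g \<Phi>1 vs i j" and ?f2.0="?g \<Phi>2 vs i j"]) (use mem that slice_tderiv[OF d(1)] slice_tderiv[OF d(2)] sboundD[OF M(2) that(1)] in auto)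
  have t2: "\<bar>?g \<Phi> vs i j z - (?g \<Phi> vs i j c + ?g \<Phi>1 vs i j c * (z - c) + ?g \<Phi>2 vs i j c * (z - c)\<^sup>2 / 2)\<bar> \<le> M * \<bar>z - c\<bar> ^ 3 / 2"
    if "length vs \<le> k" "z \<in> {0..T}" for vs i j z
    by (rule taylor2[where S="{0..T}" and ?f1.0="?g \<Phi>1 vs i j" and ?f2.0="?g \<Phi>2 vs i j" and ?f3.0="?g \<Phi>3 vs i j"])
      (use mem that slice_tderiv[OF d(1)] slice_tderiv[OF d(2)] slice_tderiv[OF d(3)] sboundD[OF M(3) that(1)] in auto)
  show "sbound h k (\<lambda>i j. slice h \<Phi> (c + r) i j - slice h \<Phi> (c - r) i j) (2 * (M * r))"
    unfolding sbound_def fdiffs_diff using lip[OF _ mem(2,3)] r by (simp add: mult.left_commute)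
  show "sbound h k (\<lambda>i j. 1/2 * (slice h \<Phi> (c - r) i j + slice h \<Phi> (c + r) i j) - slice h \<Phi> c i j) (M * r\<^sup>2)"
    unfolding sbound_def fdiffs_diff fdiffs_scale fdiffs_add
  proof (intro allI impI)
    fix vs :: "bool list" and i j assume vs: "length vs \<le> k"
    show "\<bar>1/2 * (?g \<Phi> vs i j (c - r) + ?g \<Phi> vs i j (c + r)) - ?g \<Phi> vs i j c\<bar> \<le> M * r\<^sup>2"
      using t1[OF vs mem(2), of i j] t1[OF vs mem(3), of i j] r
      by (simp add: algebra_simps abs_le_iff add_divide_distrib)
  qed
  show "sbound h k (\<lambda>i j. 1 / (2 * r) * (slice h \<Phi> (c + r) i j - slice h \<Phi> (c - r) i j) - slice h \<Phi>1 c i j) (M * r\<^sup>2)"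
    unfolding sbound_def fdiffs_diff fdiffs_scale
  proof (intro allI impI)
    fix vs :: "bool list" and i j assume vs: "length vs \<le> k"
    let ?A = "?g \<Phi> vs i j (c + r)" and ?B = "?g \<Phi> vs i j (c - r)" and ?D = "?g \<Phi>1 vs i j c"
    have M0: "0 \<le> M" using sbound_nonneg[OF M(1)[OF mem(1)]] .
    let ?C = "?g \<Phi> vs i j c" and ?E = "?g \<Phi>2 vs i j c"
    \<comment> \<open>The second-derivative terms agree and cancel in \<open>?A - ?B\<close>, which
      leaves a remainder of order \<open>r ^ 3\<close>.\<close>
    have "\<bar>?A - (?C + ?D * r + ?E * r\<^sup>2 / 2)\<bar> \<le> M * r ^ 3 / 2" "\<bar>?B - (?C - ?D * r + ?E * r\<^sup>2 / 2)\<bar> \<le> M * r ^ 3 / 2"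
      using t2[OF vs mem(3), of i j] t2[OF vs mem(2), of i j] r by simp_all
    moreover have "\<bar>a - (c + d + e)\<bar> \<le> K / 2 \<Longrightarrow> \<bar>b - (c - d + e)\<bar> \<le> K / 2 \<Longrightarrow> \<bar>a - b - 2 * d\<bar> \<le> K"
      for a b c d e K :: real by linarith
    ultimately have "\<bar>?A - ?B - 2 * (?D * r)\<bar> \<le> M * r ^ 3" by blast
    then have "\<bar>?A - ?B - 2 * r * ?D\<bar> \<le> M * r ^ 3" by (simp add: mult_ac)
    also have "\<dots> \<le> M * r\<^sup>2 * (2 * r)" using M0 r by (simp add: power2_eq_square power3_eq_cube)
    finally have "\<bar>?A - ?B - 2 * r * ?D\<bar> / (2 * r) \<le> M * r\<^sup>2" using r by (simp only: pos_divide_le_eq)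
    moreover have "1 / (2 * r) * (?A - ?B) - ?D = (?A - ?B - 2 * r * ?D) / (2 * r)"
      using r by (simp add: field_simps)
    moreover have "\<bar>(?A - ?B - 2 * r * ?D) / (2 * r)\<bar> = \<bar>?A - ?B - 2 * r * ?D\<bar> / (2 * r)"
      using r by (simp only: abs_divide)
    ultimately show "\<bar>1 / (2 * r) * (?A - ?B) - ?D\<bar> \<le> M * r\<^sup>2" by (simp only:)
  qed
  show "sbound h k (\<lambda>i j. 3/2 * slice h \<Phi> (c - r) i j - 1/2 * slice h \<Phi> (c - 3 * r) i j - slice h \<Phi> c i j) (6 * (M * r\<^sup>2))"
    if c3: "0 \<le> c - 3 * r"
    unfolding sbound_def fdiffs_diff fdiffs_scale
  proof (intro allI impI)
    fix vs :: "bool list" and i j assume vs: "length vs \<le> k"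
    have mem3: "c - 3 * r \<in> {0..T}" using c3 r by auto
    have "\<bar>?g \<Phi> vs i j (c - r) - (?g \<Phi> vs i j c + ?g \<Phi>1 vs i j c * (- r))\<bar> \<le> M * r\<^sup>2"
      using t1[OF vs mem(2), of i j] by simp
    moreover have "\<bar>?g \<Phi> vs i j (c - 3 * r) - (?g \<Phi> vs i j c + ?g \<Phi>1 vs i j c * (- (3 * r)))\<bar> \<le> 9 * (M * r\<^sup>2)"
      using t1[OF vs mem3, of i j] by (simp add: power_mult_distrib)
    ultimately show "\<bar>3/2 * ?g \<Phi> vs i j (c - r) - 1/2 * ?g \<Phi> vs i j (c - 3 * r) - ?g \<Phi> vs i j c\<bar> \<le> 6 * (M * r\<^sup>2)"
      by (simp add: algebra_simps abs_le_iff)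
  qed
  show "sbound h k (\<lambda>i j. 3/2 * slice h \<Phi> (c - r) i j - 1/2 * slice h \<Phi> (c - r) i j - slice h \<Phi> c i j) (M * r)"
    unfolding sbound_def fdiffs_diff fdiffs_scale
  proof (intro allI impI)
    fix vs :: "bool list" and i j assume vs: "length vs \<le> k"
    show "\<bar>3/2 * ?g \<Phi> vs i j (c - r) - 1/2 * ?g \<Phi> vs i j (c - r) - ?g \<Phi> vs i j c\<bar> \<le> M * r"
      using lip[OF vs mem(1) mem(2), of i j] r by simp
  qed
qed

lemma vertex_restr_diff: "vdiff h Jc Je = vertex_restr h (\<lambda>x. Jc x - Je x)"
  by (simp add: fun_eq_iff vertex_restr_def)

lemma fdiff_vertex_restr_le:
  assumes "Cbound 1 J MJ" "0 < h"
  shows "\<bar>fdiff h v (vertex_restr h J) i j\<bar> \<le> MJ"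
proof -
  have "fdiff h v (vertex_restr h J) i j = pdiffs h [v] J (of_int i * h, of_int j * h)"
    by (cases v) (simp_all add: fdiff_def shift_def vertex_restr_def pdiff_def dir_def grid_pt_def algebra_simps)
  then show ?thesis using pdiffs_bound[OF assms(1) _ assms(2), of "[v]"] by simp
qed

context pgrid
begin

lemma per_cell_restr: "periodic2 (real m * h) (real n * h) f \<Longrightarrow> per (cell_restr h f)"
proof -
  assume p: "periodic2 (real m * h) (real n * h) f"
  have "grid_pt h (of_int (i + int k)) = grid_pt h (of_int i) + real k * h" for i k
    by (simp add: grid_pt_def algebra_simps)
  then show ?thesis unfolding per_iff cell_restr_def using p by (simp add: periodic2_def del: of_int_add)
qed

lemma per_vertex_restr: "periodic2 (real m * h) (real n * h) f \<Longrightarrow> per (vertex_restr h f)"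
proof -
  assume p: "periodic2 (real m * h) (real n * h) f"
  have "grid_pt h (of_int (i + int k) + 1 / 2) = grid_pt h (of_int i + 1 / 2) + real k * h" for i k
    by (simp add: grid_pt_def algebra_simps)
  then show ?thesis unfolding per_iff vertex_restr_def using p by (simp add: periodic2_def del: of_int_add)
qed

text \<open>Here \<open>c\<close> is the midpoint of the time step \<open>2 r\<close>, and \<open>\<rho>\<close> bounds the extrapolation error.\<close>

lemma truncation_error_bound:
  fixes um :: grid_fun and \<Phi> \<Phi>1 :: "real \<times> real \<Rightarrow> real \<Rightarrow> real" and \<gamma>c \<gamma>e :: real
  assumes L: "real m * h = L1" "real n * h = L2" and M: "1 \<le> M" "1 \<le> MB"
    and J: "Cbound 2 (\<lambda>x. Jc x - Je x) MJ" "periodic2 L1 L2 (\<lambda>x. Jc x - Je x)"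
    and B: "\<bar>B_coeff m n h Jc \<gamma>c\<bar> \<le> MB" "\<bar>B_coeff m n h Je \<gamma>e\<bar> \<le> MB"
    and \<Phi>: "Cbound 6 (\<lambda>x. \<Phi> x c) M" "periodic2 L1 L2 (\<lambda>x. \<Phi> x c)"
    and pde: "\<And>x. \<Phi>1 x c = laplacian (\<lambda>y. \<Phi> y c ^ 3 + \<gamma>c * \<Phi> y c - \<gamma>e * \<Phi> y c
             + integral (Omega L1 L2) (\<lambda>x. Jc x - Je x) * \<Phi> y c - pconv L1 L2 (\<lambda>x. Jc x - Je x) (\<lambda>z. \<Phi> z c) y) x"
    and u0: "sbound h 4 u0 M" and u1: "sbound h 4 u1 M"
    and e1: "sbound h 4 (\<lambda>i j. u1 i j - u0 i j) (2 * (M * r))"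
    and e2: "sbound h 4 (\<lambda>i j. 1/2 * (u0 i j + u1 i j) - slice h \<Phi> c i j) (M * r\<^sup>2)"
    and e3: "sbound h 4 (\<lambda>i j. 1 / (2 * r) * (u1 i j - u0 i j) - slice h \<Phi>1 c i j) (M * r\<^sup>2)"
    and e4: "sbound h 4 (\<lambda>i j. 3/2 * u0 i j - 1/2 * um i j - slice h \<Phi> c i j) \<rho>"
  shows "sbound h 2 (\<lambda>i j. 1 / (2 * r) * (u1 i j - u0 i j) - dlaplacian h (dpotential m n h Jc Je \<gamma>c \<gamma>e um u0 u1) i j)
     ((M + (4096 * M ^ 3 + \<bar>\<gamma>c - \<gamma>e + integral (Omega L1 L2) (\<lambda>x. Jc x - Je x)\<bar> * M + L1 * L2 * (MJ * M))
        + 2 * (1024 * M ^ 3 + MB * M + MB + L1 * L2 * MJ + 16 * (L1 * L2 * (MJ * M)))) * (r\<^sup>2 + h\<^sup>2 + \<rho>))"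
proof -
  let ?J = "\<lambda>x. Jc x - Je x"
  let ?I = "integral (Omega L1 L2) ?J"
  let ?f = "\<lambda>x. \<Phi> x c"
  let ?Bc = "B_coeff m n h Jc \<gamma>c" and ?Be = "B_coeff m n h Je \<gamma>e"
  define G where "G = (\<lambda>y. ?f y * (?f y * ?f y) + (\<gamma>c - \<gamma>e + ?I) * ?f y - pconv L1 L2 ?J ?f y)"
  define MG where "MG = 4096 * M ^ 3 + \<bar>\<gamma>c - \<gamma>e + ?I\<bar> * M + L1 * L2 * (MJ * M)"
  define uc where "uc = slice h \<Phi> c"
  define p where "p = (\<lambda>i j. 1/2 * (u0 i j + u1 i j))"
  define q where "q = (\<lambda>i j. 1/2 * (u1 i j - u0 i j))"
  define w where "w = (\<lambda>i j. 3/2 * u0 i j - 1/2 * um i j)"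
  define K where "K = (\<lambda>i j. dconv m n h (vdiff h Jc Je) uc i j - cell_restr h (pconv L1 L2 ?J ?f) i j)"
  define \<kappa> where "\<kappa> = ?Bc - ?Be - (\<gamma>c - \<gamma>e + ?I)"
  have L0: "0 < L1" "0 < L2" unfolding L[symmetric] using h_pos m_pos n_pos by auto
  have MJ0: "0 \<le> MJ" using Cbound_abs_le[OF J(1), of 0] by linarith
  have \<rho>0: "0 \<le> \<rho>" by (rule sbound_nonneg[OF e4])
  have cJ: "continuous_on UNIV ?J" by (rule Cbound_continuous[OF J(1)])
  have G: "Cbound 6 G MG"
  proof -
    have "Cbound 6 G (2 ^ 6 * (M * (2 ^ 6 * (M * M))) + \<bar>\<gamma>c - \<gamma>e + ?I\<bar> * M + L1 * L2 * (MJ * M))"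
      unfolding G_def using L0 Cbound_abs_le[OF J(1)]
      by (intro Cbound_diff Cbound_add Cbound_mult Cbound_scale Cbound_pconv[OF cJ] \<Phi>) auto
    then show ?thesis by (simp add: MG_def power3_eq_cube mult.assoc)
  qed
  have "(\<lambda>y. ?f y ^ 3 + \<gamma>c * ?f y - \<gamma>e * ?f y + ?I * ?f y - pconv L1 L2 ?J ?f y) = G"
    by (simp add: G_def fun_eq_iff power3_eq_cube algebra_simps)
  then have pde': "slice h \<Phi>1 c = cell_restr h (laplacian G)"
    using pde by (simp add: cell_restr_def fun_eq_iff)
  have lap: "sbound h 2 (\<lambda>i j. dlaplacian h (cell_restr h G) i j - cell_restr h (laplacian G) i j) (h\<^sup>2 * MG)"
    using sbound_dlaplacian_laplacian[of 2 G MG h] G h_pos by simp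
  have suc: "sbound h 4 uc M"
    unfolding uc_def by (rule sbound_cell_restr[OF Cbound_mono[OF \<Phi>(1)] h_pos]) auto
  have sp: "sbound h 4 p M" using sbound_scale[OF sbound_add[OF u0 u1], of "1/2"] by (simp add: p_def)
  have sq: "sbound h 4 q (M * r)" using sbound_scale[OF e1, of "1/2"] by (simp add: q_def)
  have spc: "sbound h 4 (\<lambda>i j. p i j - uc i j) (M * r\<^sup>2)" using e2 by (simp add: p_def uc_def)
  have swc: "sbound h 4 (\<lambda>i j. w i j - uc i j) \<rho>" using e4 by (simp add: w_def uc_def)
  have sJ: "\<bar>vdiff h Jc Je i j\<bar> \<le> MJ" for i j
    using Cbound_abs_le[OF J(1)] by (simp add: vertex_restr_def)
  have sK: "sbound h 4 K (8 * (L1 * L2) * (MJ * M) * h\<^sup>2)"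
    using sbound_dconv_pconv[of ?J MJ 4 ?f M] J \<Phi> unfolding K_def uc_def vertex_restr_diff L by simp
  \<comment> \<open>\<kappa> is the quadrature error for the integral of the kernel, that is, the
    convolution error for the constant function 1.\<close>
  have \<kappa>: "\<bar>\<kappa>\<bar> \<le> 8 * (L1 * L2) * MJ * h\<^sup>2"
  proof -
    have C: "Cbound 2 (\<lambda>x. 1) 1"
    proof -
      have "has_pderiv v (\<lambda>x. 1) (\<lambda>x. 0)" "has_pderiv v (\<lambda>x. 0) (\<lambda>x. 0)" for v
        by (simp_all add: has_pderiv_def)
      then show ?thesis by (auto simp: numeral_2_eq_2 intro!: exI[of _ "\<lambda>x. 0"])
    qed
    have "periodic2 L1 L2 (\<lambda>x. 1)" by (simp add: periodic2_def)
    then have "sbound h 0 (\<lambda>i j. dconv m n h (vertex_restr h ?J) (cell_restr h (\<lambda>x. 1)) i j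
        - cell_restr h (pconv L1 L2 ?J (\<lambda>x. 1)) i j) (8 * (L1 * L2) * (MJ * 1) * h\<^sup>2)"
      by (rule sbound_dconv_pconv[of ?J MJ 0 "\<lambda>x. 1" 1, unfolded L add_0, OF J C])
    from sbound_point[OF this, of 1 1]
    have "\<bar>dconv m n h (vdiff h Jc Je) (\<lambda>i j. 1) 1 1 - ?I\<bar> \<le> 8 * (L1 * L2) * MJ * h\<^sup>2"
      by (simp add: cell_restr_def[abs_def] pconv_def vertex_restr_diff)
    then show ?thesis unfolding dconv_diff_kernel by (simp add: \<kappa>_def B_coeff_def dconv_one_def algebra_simps)
  qed
  \<comment> \<open>Exact discrepancy between the discrete potential and \<open>G\<close> on the
    grid. Every summand has a small factor: \<open>p - uc\<close> and the square of \<open>q\<close>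
    are O(\<open>r\<^sup>2\<close>), \<open>w - uc\<close> is bounded by \<rho>, \<kappa> and
    \<open>K\<close> are O(\<open>h\<^sup>2\<close>). Four differences are kept, since the Laplacian
    takes two of them.\<close>
  define D where "D = (\<lambda>i j. (p i j - uc i j) * (p i j * p i j + p i j * uc i j + uc i j * uc i j) + p i j * (q i j * q i j)
     + ?Bc * (p i j - uc i j) - ?Be * (w i j - uc i j) - dconv m n h (vdiff h Jc Je) (\<lambda>i j. w i j - uc i j) i j
     + \<kappa> * uc i j - K i j)"
  have pot: "dpotential m n h Jc Je \<gamma>c \<gamma>e um u0 u1 = (\<lambda>i j. cell_restr h G i j + D i j)"
  proof (intro ext)
    fix i j
    have "eta (u0 i j) (u1 i j) = p i j * (p i j * p i j) + p i j * (q i j * q i j)"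
      by (simp add: eta_def p_def q_def power2_eq_square field_simps)
    moreover have "cell_restr h G i j = uc i j * (uc i j * uc i j) + (\<gamma>c - \<gamma>e + ?I) * uc i j - cell_restr h (pconv L1 L2 ?J ?f) i j"
      by (simp add: G_def uc_def cell_restr_def)
    moreover have "dpotential m n h Jc Je \<gamma>c \<gamma>e um u0 u1 i j = eta (u0 i j) (u1 i j) + ?Bc * p i j - ?Be * w i j
        - dconv m n h (vdiff h Jc Je) w i j"
      by (simp add: dpotential_def Let_def p_def w_def)
    ultimately show "dpotential m n h Jc Je \<gamma>c \<gamma>e um u0 u1 i j = cell_restr h G i j + D i j"
      unfolding D_def K_def dconv_diff \<kappa>_def by (simp add: algebra_simps)
  qed
  let ?X = "r\<^sup>2 + h\<^sup>2 + \<rho>"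
  have le: "r\<^sup>2 \<le> ?X" "h\<^sup>2 \<le> ?X" "\<rho> \<le> ?X" using \<rho>0 by simp_all
  define C3 where "C3 = 1024 * M ^ 3 + MB * M + MB + L1 * L2 * MJ + 16 * (L1 * L2 * (MJ * M))"
  have sD: "sbound h 4 D (C3 * ?X)"
  proof -
    have "sbound h 4 D (2^4 * (M * r\<^sup>2 * (2^4 * (M * M) + 2^4 * (M * M) + 2^4 * (M * M))) + 2^4 * (M * (2^4 * ((M * r) * (M * r))))
      + \<bar>?Bc\<bar> * (M * r\<^sup>2) + \<bar>?Be\<bar> * \<rho> + area * MJ * \<rho> + \<bar>\<kappa>\<bar> * M + 8 * (L1 * L2) * (MJ * M) * h\<^sup>2)"
      unfolding D_def
      by (intro sbound_diff sbound_add sbound_mult sbound_scale sbound_dconv sp sq spc swc suc sK sJ)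
    moreover have "2^4 * (M * r\<^sup>2 * (2^4 * (M * M) + 2^4 * (M * M) + 2^4 * (M * M))) + 2^4 * (M * (2^4 * ((M * r) * (M * r))))
      = 1024 * M ^ 3 * r\<^sup>2" by (simp add: power3_eq_cube power2_eq_square)
    moreover have "1024 * M ^ 3 * r\<^sup>2 \<le> 1024 * M ^ 3 * ?X" using le M by (intro mult_left_mono) auto
    moreover have "\<bar>?Bc\<bar> * (M * r\<^sup>2) \<le> MB * (M * ?X)" using le M B by (intro mult_mono) auto
    moreover have "\<bar>?Be\<bar> * \<rho> \<le> MB * ?X" using le M B \<rho>0 by (intro mult_mono) auto
    moreover have "area * MJ * \<rho> \<le> L1 * L2 * MJ * ?X" using le MJ0 L0 unfolding L by (intro mult_left_mono) auto
    moreover have "\<bar>\<kappa>\<bar> * M \<le> 8 * (L1 * L2 * (MJ * M)) * ?X"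
    proof -
      have "\<bar>\<kappa>\<bar> * M \<le> 8 * (L1 * L2) * MJ * h\<^sup>2 * M" using \<kappa> M by (intro mult_right_mono) auto
      also have "\<dots> = 8 * (L1 * L2 * (MJ * M)) * h\<^sup>2" by simp
      also have "\<dots> \<le> 8 * (L1 * L2 * (MJ * M)) * ?X" using le L0 MJ0 M by (intro mult_left_mono) auto
      finally show ?thesis .
    qed
    moreover have "8 * (L1 * L2) * (MJ * M) * h\<^sup>2 \<le> 8 * (L1 * L2) * (MJ * M) * ?X"
      using le L0 MJ0 M by (intro mult_left_mono) auto
    moreover have "C3 * ?X = 1024 * M ^ 3 * ?X + MB * (M * ?X) + MB * ?X + L1 * L2 * MJ * ?X
        + 8 * (L1 * L2 * (MJ * M)) * ?X + 8 * (L1 * L2) * (MJ * M) * ?X"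
      by (simp add: C3_def algebra_simps)
    ultimately show ?thesis by (elim sbound_mono) linarith+
  qed
  have "(\<lambda>i j. 1 / (2 * r) * (u1 i j - u0 i j) - dlaplacian h (dpotential m n h Jc Je \<gamma>c \<gamma>e um u0 u1) i j)
    = (\<lambda>i j. (1 / (2 * r) * (u1 i j - u0 i j) - slice h \<Phi>1 c i j)
        - (dlaplacian h (cell_restr h G) i j - cell_restr h (laplacian G) i j) - dlaplacian h D i j)"
    unfolding pot dlaplacian_add pde' by (simp add: fun_eq_iff)
  moreover have "sbound h 2 \<dots> (M * r\<^sup>2 + h\<^sup>2 * MG + 2 * (C3 * ?X))"
    using sD by (intro sbound_diff lap sbound_mono[OF e3] sbound_dlaplacian) auto
  moreover have "M * r\<^sup>2 + h\<^sup>2 * MG + 2 * (C3 * ?X) \<le> (M + MG + 2 * C3) * ?X"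
  proof -
    have "M * r\<^sup>2 \<le> M * ?X" using le M by (intro mult_left_mono) auto
    moreover have "0 \<le> MG" using Cbound_abs_le[OF G, of 0] by linarith
    then have "h\<^sup>2 * MG \<le> ?X * MG" using le by (intro mult_right_mono) auto
    ultimately show ?thesis by (simp add: algebra_simps)
  qed
  ultimately show ?thesis unfolding MG_def C3_def by (auto elim!: sbound_mono)
qed

lemma per_dpotential:
  assumes "per am" "per a" "per b"
  shows "per (dpotential m n h Jc Je \<gamma>c \<gamma>e am a b)"
proof -
  have "per (\<lambda>i j. 3/2 * a i j - 1/2 * am i j)"
    using assms(2,1) by (rule per_comb2)
  from per_dconv[OF this, of "vdiff h Jc Je"]
  show ?thesis using assms by (simp add: per_iff dpotential_def Let_def)
qed

lemma B_coeff_bounds: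
  assumes "\<And>x. 0 \<le> K x" "\<And>x. \<bar>K x\<bar> \<le> MK" "0 \<le> \<gamma>"
  shows "0 \<le> B_coeff m n h K \<gamma>" and "B_coeff m n h K \<gamma> \<le> area * MK + \<gamma>"
proof -
  have "0 \<le> dconv m n h (vertex_restr h K) (\<lambda>i j. 1) 1 1"
    unfolding dconv_gsum using assms(1) by (intro gsum_nonneg) (simp add: vertex_restr_def)
  moreover have "\<bar>dconv m n h (vertex_restr h K) (\<lambda>i j. 1) 1 1\<bar> \<le> area * MK * 1"
    using assms(2) by (intro dconv_sup) (auto simp: vertex_restr_def)
  ultimately show "0 \<le> B_coeff m n h K \<gamma>" "B_coeff m n h K \<gamma> \<le> area * MK + \<gamma>"
    using assms(3) by (simp_all add: B_coeff_def dconv_one_def)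
qed

end

section \<open>Choice of the constants, and the exact solution inserted into the grid
  estimate\<close>

theorem theorem3p11:
  fixes L1 L2 \<gamma>c \<gamma>e \<alpha>0 T Cstar :: real
    and Jc Je :: "real \<times> real \<Rightarrow> real"
    and \<Phi> :: "real \<times> real \<Rightarrow> real \<Rightarrow> real"
  assumes "L1 > 0" and "L2 > 0"
    and "admissible_kernel L1 L2 Jc Je"
    and "\<gamma>c \<ge> 0" and "\<gamma>e \<ge> 0"
    and "\<gamma>c - \<gamma>e + integral (Omega L1 L2) (\<lambda>x. Jc x - Je x) > 0"
    and "\<alpha>0 > 0"
    and "\<exists>h1>0. \<forall>h m n. uniform_grid L1 L2 h m n \<and> h \<le> h1 \<longrightarrow>
           B_coeff m n h Jc \<gamma>c - 3 * B_coeff m n h Je \<gamma>e \<ge> \<alpha>0"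
    and "T > 0"
    and "smooth_per L1 L2 (\<lambda>x. \<Phi> x 0)"
    and "unique_nCH_solution L1 L2 (\<lambda>x. Jc x - Je x) \<gamma>c \<gamma>e T \<Phi>"
    and "Cstar > 0"
  shows "\<exists>s0>0. \<exists>h0>0. \<exists>C>0. \<forall>s h m n \<phi>.
           0 < s \<and> s \<le> s0 \<and> h \<le> h0 \<and> s \<le> Cstar * h \<and>
           uniform_grid L1 L2 h m n \<and>
           nCH_scheme m n h s Jc Je \<gamma>c \<gamma>e \<phi> \<and>
           (\<forall>i j. \<phi> 0 i j = cell_restr h (\<lambda>x. \<Phi> x 0) i j)
           \<longrightarrow> (\<forall>l::nat. 0 < l \<and> real l * s \<le> T \<longrightarrow>
                 grid_max_norm m n (\<lambda>i j. cell_restr h (\<lambda>x. \<Phi> x (real l * s)) i j - \<phi> l i j)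
                   \<le> C * (h\<^sup>2 + s\<^sup>2))"
proof -
  note L = assms(1,2) and \<gamma> = assms(4,5) and \<alpha> = assms(7) and T = assms(9) and Cs = assms(12)
  let ?J = "\<lambda>x. Jc x - Je x"
  let ?I = "integral (Omega L1 L2) ?J"
  have J: "smooth_per L1 L2 Jc" "smooth_per L1 L2 Je" "\<And>x. 0 \<le> Jc x" "\<And>x. 0 \<le> Je x"
    using assms(3) by (auto simp: admissible_kernel_def)
  have J_per: "periodic2 L1 L2 ?J"
    using J(1,2) by (simp add: smooth_per_def periodic2_def)
  obtain MJc MJe where MJ: "Cbound 2 Jc MJc" "Cbound 2 Je MJe"
    using smooth_per_Cbound[OF J(1) L] smooth_per_Cbound[OF J(2) L] by blast
  define MJ where "MJ = MJc + MJe"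
  have CJ: "Cbound 2 ?J MJ" unfolding MJ_def using MJ by (rule Cbound_diff)
  have MJ0: "0 \<le> MJ" "0 \<le> MJc" "0 \<le> MJe"
    using Cbound_abs_le[OF CJ, of 0] Cbound_abs_le[OF MJ(1), of 0] Cbound_abs_le[OF MJ(2), of 0] by linarith+
  have sol: "smooth_on (UNIV \<times> {0..T}) (\<lambda>(x, t). \<Phi> x t)"
    "\<And>t. t \<in> {0..T} \<Longrightarrow> periodic2 L1 L2 (\<lambda>x. \<Phi> x t)"
    "\<And>x t. t \<in> {0..T} \<Longrightarrow> (\<Phi> x has_real_derivative
           laplacian (\<lambda>y. \<Phi> y t ^ 3 + \<gamma>c * \<Phi> y t - \<gamma>e * \<Phi> y t + ?I * \<Phi> y t - pconv L1 L2 ?J (\<lambda>z. \<Phi> z t) y) x)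
          (at t within {0..T})"
    using assms(11) unfolding unique_nCH_solution_def nCH_solution_def by blast+
  \<comment> \<open>Order 6 is two differences plus four derivatives for the consistency of the
    Laplacian, and equally four differences plus two derivatives for the trapezoidal rule.\<close>
  obtain \<Phi>1 \<Phi>2 \<Phi>3 M0 where d: "has_tderiv T \<Phi> \<Phi>1" "has_tderiv T \<Phi>1 \<Phi>2" "has_tderiv T \<Phi>2 \<Phi>3"
    and M0: "\<And>\<Psi> t. \<Psi> \<in> {\<Phi>, \<Phi>1, \<Phi>2, \<Phi>3} \<Longrightarrow> t \<in> {0..T} \<Longrightarrow> Cbound 6 (\<lambda>x. \<Psi> x t) M0"
    using smooth_solution_time_derivatives[OF sol(1,2) T L] by blast
  define M where "M = max 1 M0"
  have M1: "1 \<le> M" by (simp add: M_def)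
  have CM: "Cbound 6 (\<lambda>x. \<Psi> x t) M" if "\<Psi> \<in> {\<Phi>, \<Phi>1, \<Phi>2, \<Phi>3}" "t \<in> {0..T}" for \<Psi> t
    by (rule Cbound_mono[OF M0[OF that]]) (auto simp: M_def)
  have pde: "\<Phi>1 x t = laplacian (\<lambda>y. \<Phi> y t ^ 3 + \<gamma>c * \<Phi> y t - \<gamma>e * \<Phi> y t + ?I * \<Phi> y t - pconv L1 L2 ?J (\<lambda>z. \<Phi> z t) y) x"
    if "t \<in> {0..T}" for x t
    using d(1) that by (intro real_derivative_unique_Icc[OF _ sol(3)[OF that] that T]) (simp add: has_tderiv_def)
  define a where "a = L1 * L2"
  have a0: "0 < a" using L by (simp add: a_def)
  define MB where "MB = 1 + a * MJ + \<gamma>c + \<gamma>e"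
  have MB1: "1 \<le> MB" using a0 MJ0 \<gamma> by (simp add: MB_def)
  define Ct where "Ct = M + (4096 * M ^ 3 + \<bar>\<gamma>c - \<gamma>e + ?I\<bar> * M + L1 * L2 * (MJ * M))
        + 2 * (1024 * M ^ 3 + MB * M + MB + L1 * L2 * MJ + 16 * (L1 * L2 * (MJ * M)))"
  have Ct0: "0 \<le> Ct" unfolding Ct_def using M1 MB1 MJ0 L by (intro add_nonneg_nonneg mult_nonneg_nonneg) auto
  \<comment> \<open>The factor \<open>1 + 6 * M\<close> covers the extrapolation error, at most
    \<open>6 * M * r\<^sup>2\<close> in general and \<open>M * r\<close> in the first step.\<close>
  define Mt where "Mt = Ct * (1 + 6 * M)"
  have Mt0: "0 \<le> Mt" using Ct0 M1 by (simp add: Mt_def)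
  \<comment> \<open>Each constant uses only earlier ones and the data. The grid enters through its
    area alone, which is \<open>L1 * L2\<close> on every grid, so nothing depends on
    \<open>h\<close> or \<open>s\<close>.\<close>
  define k1 where "k1 = 7 * ((rem_const M Cstar 1 MJ a)\<^sup>2 / \<alpha>0) + 1"
  define \<Theta> where "\<Theta> = 28 * (a * Mt\<^sup>2) + 1"
  define CS where "CS = sqrt a * ((1 + 1 / L1) * (1 + 1 / L2))"
  define C where "C = CS * sqrt (\<Theta> * exp (5 * k1 * T))"
  define K where "K = C * (Cstar\<^sup>2 + 1)"
  define g where "g = K + Cstar * (2 * Mt) + 8 * Cstar * (4 * (M + 1)\<^sup>2 + 3 * MB + 2 * (a * MJ)) * K"
  define R2 where "R2 = max 1 ((4 * (M + 1)\<^sup>2 + MB) * g / (\<alpha>0 / 2))"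
  define k2 where "k2 = 7 * ((rem_const M Cstar R2 MJ a)\<^sup>2 / \<alpha>0) + 1"
  have k0: "1 \<le> k1" "1 \<le> k2" unfolding k1_def k2_def using \<alpha> by simp_all
  have "0 < \<Theta>" using a0 by (simp add: \<Theta>_def add_nonneg_pos)
  moreover have "0 < CS" unfolding CS_def using a0 L by (intro mult_pos_pos add_pos_pos) auto
  ultimately have C0: "0 < C" by (simp add: C_def)
  have K0: "0 < K" unfolding K_def using C0 by (intro mult_pos_pos add_nonneg_pos) auto
  have g0: "0 < g" unfolding g_def
    using K0 Cs Mt0 MB1 a0 MJ0 by (intro add_pos_nonneg mult_nonneg_nonneg add_nonneg_nonneg) auto
  obtain h1 where h1: "0 < h1" "\<And>h m n. uniform_grid L1 L2 h m n \<Longrightarrow> h \<le> h1 \<Longrightarrow>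
           B_coeff m n h Jc \<gamma>c - 3 * B_coeff m n h Je \<gamma>e \<ge> \<alpha>0"
    using assms(8) by blast
  \<comment> \<open>\<open>g\<close> and \<open>k2\<close> depend on \<open>C\<close>, but act back
    only here, by shrinking the admissible range of \<open>h\<close> and \<open>s\<close>.\<close>
  define s0 where "s0 = min 1 (min (1 / (5 * k1)) (1 / (5 * k2)))"
  define h0 where "h0 = min (min h1 1) (min (1 / (2 * K)) (1 / g))"
  have "0 < s0" "0 < h0" using k0 K0 g0 h1 by (simp_all add: s0_def h0_def)
  moreover have "grid_max_norm m n (\<lambda>i j. cell_restr h (\<lambda>x. \<Phi> x (real l * s)) i j - \<phi> l i j) \<le> C * (h\<^sup>2 + s\<^sup>2)"
    if s: "0 < s" "s \<le> s0" "s \<le> Cstar * h" and h: "h \<le> h0" and grid: "uniform_grid L1 L2 h m n"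
      and scheme: "nCH_scheme m n h s Jc Je \<gamma>c \<gamma>e \<phi>"
      and init: "\<forall>i j. \<phi> 0 i j = cell_restr h (\<lambda>x. \<Phi> x 0) i j"
      and l: "real l * s \<le> T" for s h m n \<phi> and l :: nat
  proof -
    interpret pgrid h m n using grid by unfold_locales (auto simp: uniform_grid_def)
    have L': "real m * h = L1" "real n * h = L2" using grid by (auto simp: uniform_grid_def)
    have hs: "h \<le> 1" "h \<le> h1" "2 * K * h \<le> 1" "g * h \<le> 1" "s \<le> 1" "5 * (s * k1) \<le> 1" "5 * (s * k2) \<le> 1"
    proof -
      have "h \<le> 1 / (2 * K)" "h \<le> 1 / g" "s \<le> 1 / (5 * k1)" "s \<le> 1 / (5 * k2)" using h s by (auto simp: h0_def s0_def)
      then have "h * (2 * K) \<le> 1" "h * g \<le> 1" "s * (5 * k1) \<le> 1" "s * (5 * k2) \<le> 1"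
        using K0 g0 k0 by (simp_all only: pos_le_divide_eq)
      then show "2 * K * h \<le> 1" "g * h \<le> 1" "5 * (s * k1) \<le> 1" "5 * (s * k2) \<le> 1" by (simp_all add: mult_ac)
    qed (use h s in \<open>auto simp: h0_def s0_def\<close>)
    note Bc = B_coeff_bounds[of Jc MJc \<gamma>c, OF J(3) Cbound_abs_le[OF MJ(1)] \<gamma>(1), unfolded L', folded a_def]
    note Be = B_coeff_bounds[of Je MJe \<gamma>e, OF J(4) Cbound_abs_le[OF MJ(2)] \<gamma>(2), unfolded L', folded a_def]
    have MBs: "a * MJc + \<gamma>c \<le> MB" "a * MJe + \<gamma>e \<le> MB"
    proof -
      have "0 \<le> a * MJc" "0 \<le> a * MJe" using a0 MJ0 by simp_all
      then show "a * MJc + \<gamma>c \<le> MB" "a * MJe + \<gamma>e \<le> MB"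
        using \<gamma> by (simp_all add: MB_def MJ_def algebra_simps)
    qed
    have B: "\<bar>B_coeff m n h Jc \<gamma>c\<bar> \<le> MB" "\<bar>B_coeff m n h Je \<gamma>e\<bar> \<le> MB"
      using Bc Be MBs by (simp_all add: abs_le_iff)
    have BcMB: "B_coeff m n h Jc \<gamma>c \<le> MB" using B(1) by linarith
    \<comment> \<open>The grid estimate speaks of all levels, while \<open>\<Phi>\<close> is
      controlled only up to \<open>T\<close>; the value 0 beyond keeps \<open>u\<close> and
      \<open>\<tau>\<close> periodic there.\<close>
    define u where "u = (\<lambda>k :: nat. if real k * s \<le> T then slice h \<Phi> (real k * s) else (\<lambda>i j. 0))"
    define \<tau> where "\<tau> = (\<lambda>k i j. if real (Suc k) * s \<le> T then
        1 / (2 * (s / 2)) * (u (Suc k) i j - u k i j)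
          - dlaplacian h (dpotential m n h Jc Je \<gamma>c \<gamma>e (u (k - 1)) (u k) (u (Suc k))) i j else 0)"
    have u: "u k = slice h \<Phi> (real k * s)" if "real k * s \<le> T" for k using that by (simp add: u_def)
    have mem: "real k * s \<in> {0..T}" if "real k * s \<le> T" for k using that s by simp
    have peru: "per (u k)" for k
      using per_cell_restr[unfolded L', OF sol(2)[OF mem]] by (auto simp: u_def per_iff)
    have per\<tau>: "per (\<tau> k)" for k
    proof (cases "real (Suc k) * s \<le> T")
      case True
      then have "\<tau> k = (\<lambda>i j. 1 / (2 * (s / 2)) * (u (Suc k) i j - u k i j)
          - dlaplacian h (dpotential m n h Jc Je \<gamma>c \<gamma>e (u (k - 1)) (u k) (u (Suc k))) i j)" by (simp add: \<tau>_def)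
      moreover have "per (dlaplacian h (dpotential m n h Jc Je \<gamma>c \<gamma>e (u (k - 1)) (u k) (u (Suc k))))"
        by (intro per_dlaplacian per_dpotential peru)
      ultimately show ?thesis using peru by (simp add: per_iff)
    next
      case False
      then show ?thesis by (simp add: \<tau>_def per_iff)
    qed
    have sb: "sbound h 4 (slice h \<Psi> t) M" if "\<Psi> \<in> {\<Phi>, \<Phi>1, \<Phi>2, \<Phi>3}" "t \<in> {0..T}" for \<Psi> t
      by (rule sbound_cell_restr[OF Cbound_mono[OF CM[OF that]] h_pos]) auto
    have sb1: "sbound h 4 (slice h \<Phi>1 t) M" and sb2: "sbound h 4 (slice h \<Phi>2 t) M"
      and sb3: "sbound h 4 (slice h \<Phi>3 t) M" if "t \<in> {0..T}" for t
      using sb[OF _ that] by auto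
    have prev: "real k * s \<le> T" if "real (Suc k) * s \<le> T" for k
      using nat_le_of_mult_le[OF that, of k] s by simp
    have step: "sbound h 4 (\<lambda>i j. u (Suc k) i j - u k i j) (M * s)
        \<and> sbound h 2 (\<tau> k) (Mt * (if k = 0 then s + h\<^sup>2 else s\<^sup>2 + h\<^sup>2))" if k: "real (Suc k) * s \<le> T" for k
    proof -
      define r where "r = s / 2"
      define c where "c = real k * s + r"
      have cr: "real k * s = c - r" "real (Suc k) * s = c + r" by (simp_all add: c_def r_def algebra_simps)
      have r: "0 < r" "0 \<le> c - r" "c + r \<le> T" using s k unfolding cr[symmetric] by (auto simp: r_def)
      have c: "c \<in> {0..T}" using r by simp
      have u01: "u k = slice h \<Phi> (c - r)" "u (Suc k) = slice h \<Phi> (c + r)"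
        using u[OF prev[OF k]] u[OF k] unfolding cr by simp_all
      \<comment> \<open>At \<open>k = 0\<close> the level \<open>k - 1\<close> is level 0 itself, so
        extrapolation is only first order.\<close>
      define \<rho> where "\<rho> = (if k = 0 then M * r else 6 * (M * r\<^sup>2))"
      have e4: "sbound h 4 (\<lambda>i j. 3/2 * u k i j - 1/2 * u (k - 1) i j - slice h \<Phi> c i j) \<rho>"
      proof (cases "k = 0")
        case True
        then show ?thesis using time_difference_errors(5)[OF d sb1 sb2 sb3 r] u01 by (simp add: \<rho>_def)
      next
        case False
        have "real (k - 1) * s = c - 3 * r" using False by (simp add: c_def r_def of_nat_diff algebra_simps)
        moreover have "0 \<le> real (k - 1) * s" using s by simp
        moreover have "u (k - 1) = slice h \<Phi> (real (k - 1) * s)"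
          using nat_le_of_mult_le[OF k, of "k - 1"] s by (intro u) simp
        ultimately show ?thesis using time_difference_errors(4)[OF d sb1 sb2 sb3 r] u01 False by (simp add: \<rho>_def)
      qed
      have "sbound h 2 (\<lambda>i j. 1 / (2 * r) * (u (Suc k) i j - u k i j)
          - dlaplacian h (dpotential m n h Jc Je \<gamma>c \<gamma>e (u (k - 1)) (u k) (u (Suc k))) i j) (Ct * (r\<^sup>2 + h\<^sup>2 + \<rho>))"
        unfolding Ct_def
      proof (rule truncation_error_bound[OF L' M1 MB1 CJ J_per B])
        show "Cbound 6 (\<lambda>x. \<Phi> x c) M" "periodic2 L1 L2 (\<lambda>x. \<Phi> x c)" using CM c sol(2) by auto
        show "sbound h 4 (u k) M" "sbound h 4 (u (Suc k)) M" unfolding u01 using sb r by auto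
        show "sbound h 4 (\<lambda>i j. u (Suc k) i j - u k i j) (2 * (M * r))"
          "sbound h 4 (\<lambda>i j. 1/2 * (u k i j + u (Suc k) i j) - slice h \<Phi> c i j) (M * r\<^sup>2)"
          "sbound h 4 (\<lambda>i j. 1 / (2 * r) * (u (Suc k) i j - u k i j) - slice h \<Phi>1 c i j) (M * r\<^sup>2)"
          unfolding u01 using time_difference_errors(1-3)[OF d sb1 sb2 sb3 r] by simp_all
      qed (use e4 pde[OF c] in auto)
      moreover have "Ct * (r\<^sup>2 + h\<^sup>2 + \<rho>) \<le> Mt * (if k = 0 then s + h\<^sup>2 else s\<^sup>2 + h\<^sup>2)"
      proof -
        have r2: "r\<^sup>2 \<le> s\<^sup>2" and rs: "r\<^sup>2 \<le> s" "r \<le> s"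
          using s hs(5) mult_left_mono[OF hs(5), of s] by (auto simp: r_def power2_eq_square)
        have "r\<^sup>2 + h\<^sup>2 + \<rho> \<le> (1 + 6 * M) * (if k = 0 then s + h\<^sup>2 else s\<^sup>2 + h\<^sup>2)"
        proof (cases "k = 0")
          case True
          have "M * r \<le> M * (6 * (s + h\<^sup>2))" using M1 rs s by (intro mult_left_mono) (auto simp: add_increasing2)
          then show ?thesis using True rs by (simp add: \<rho>_def algebra_simps)
        next
          case False
          have "M * r\<^sup>2 \<le> M * (s\<^sup>2 + h\<^sup>2)" using M1 r2 by (intro mult_left_mono) (auto simp: add_increasing2)
          then show ?thesis using False r2 by (simp add: \<rho>_def algebra_simps)
        qed
        then show ?thesis unfolding Mt_def mult.assoc using Ct0 by (intro mult_left_mono)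
      qed
      moreover have "\<tau> k = (\<lambda>i j. 1 / (2 * r) * (u (Suc k) i j - u k i j)
          - dlaplacian h (dpotential m n h Jc Je \<gamma>c \<gamma>e (u (k - 1)) (u k) (u (Suc k))) i j)"
        using k by (simp add: \<tau>_def r_def)
      moreover have "sbound h 4 (\<lambda>i j. u (Suc k) i j - u k i j) (M * s)"
        using time_difference_errors(1)[OF d sb1 sb2 sb3 r] unfolding u01 by (simp add: r_def)
      ultimately show ?thesis by (auto elim: sbound_mono)
    qed
    have est: "\<bar>u l i j - \<phi> l i j\<bar> \<le> C * (s\<^sup>2 + h\<^sup>2)" for i j
      unfolding C_def
    proof (rule error_estimate[unfolded L', folded a_def, where Cs=Cstar and M=M and \<tau>=\<tau> and Jc=Jc and Je=Je
            and \<gamma>c=\<gamma>c and \<gamma>e=\<gamma>e and Mt=Mt and MJ=MJ and MB=MB and \<alpha>=\<alpha>0 and K=K and g=g and ?R2.0=R2 and ?k2.0=k2])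
      show "per (\<phi> k)" for k using scheme by (simp add: nCH_scheme_def)
      show "\<phi> (Suc k) i j - \<phi> k i j =
         s * dlaplacian h (dpotential m n h Jc Je \<gamma>c \<gamma>e (\<phi> (k - 1)) (\<phi> k) (\<phi> (Suc k))) i j" for k i j
        using scheme unfolding nCH_scheme_def by (cases "k = 0") auto
      show "u (Suc k) i j - u k i j =
         s * dlaplacian h (dpotential m n h Jc Je \<gamma>c \<gamma>e (u (k - 1)) (u k) (u (Suc k))) i j + s * \<tau> k i j"
        if "real (Suc k) * s \<le> T" for k i j
        using that s(1) by (simp add: \<tau>_def right_diff_distrib)
      show "sbound h 3 (u k) M" if "real k * s \<le> T" for k
        unfolding u[OF that] by (rule sbound_mono[OF sb[OF _ mem[OF that]]]) auto
      show "sbound h 3 (\<lambda>i j. u (Suc k) i j - u k i j) (M * s)" if "real (Suc k) * s \<le> T" for k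
        by (rule sbound_mono[OF conjunct1[OF step[OF that]]]) auto
      show "sbound h 2 (\<tau> 0) (Mt * (s + h\<^sup>2))"
      proof (cases "real (Suc 0) * s \<le> T")
        case True
        then show ?thesis using step[OF True] by simp
      next
        case False
        \<comment> \<open>Here already the first step ends after \<open>T\<close>, and
          \<open>\<tau> 0\<close> is the default 0, written as a product so that
          \<open>fdiffs_scale\<close> applies.\<close>
        then have "\<tau> 0 = (\<lambda>i j. 0 * 0)" by (simp add: \<tau>_def)
        then have "fdiffs h vs (\<tau> 0) = (\<lambda>i j. 0)" for vs using fdiffs_scale[of h vs 0 "\<lambda>i j. 0"] by simp
        then show ?thesis using Mt0 s by (simp add: sbound_def)
      qed
      show "sbound h 2 (\<tau> k) (Mt * (s\<^sup>2 + h\<^sup>2))" if "0 < k" "real (Suc k) * s \<le> T" for k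
        using step[OF that(2)] that(1) by simp
      show "\<phi> 0 = u 0" using init u[of 0] T by (simp add: fun_eq_iff)
      show "per (vdiff h Jc Je)" unfolding vertex_restr_diff by (rule per_vertex_restr[unfolded L', OF J_per])
      show "\<bar>vertex_restr h Jc i j - vertex_restr h Je i j\<bar> \<le> MJ" for i j
        using Cbound_abs_le[OF CJ] by (simp add: vertex_restr_def)
      show "\<bar>fdiff h v (vdiff h Jc Je) i j\<bar> \<le> MJ" for v i j
        unfolding vertex_restr_diff by (rule fdiff_vertex_restr_le[OF Cbound_mono[OF CJ] h_pos]) auto
      show "3 * B_coeff m n h Je \<gamma>e + \<alpha>0 \<le> B_coeff m n h Jc \<gamma>c" using h1(2)[OF grid hs(2)] by linarith
      show "sqrt a * ((1 + 1 / L1) * (1 + 1 / L2)) \<le> CS" by (simp add: CS_def)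
      show "CS * sqrt (\<Theta> * exp (5 * k1 * T)) * (Cstar\<^sup>2 + 1) \<le> K" by (simp add: K_def C_def)
      show "(4 * (M + 1)\<^sup>2 + MB) * g / (\<alpha>0 / 2) \<le> R2" "1 \<le> R2" by (simp_all add: R2_def)
    qed (rule s(1,3) hs M1 peru per\<tau> Be(1) BcMB \<alpha> l k1_def[symmetric, THEN eq_refl] k2_def[symmetric, THEN eq_refl]
        \<Theta>_def[symmetric, THEN eq_refl] g_def[symmetric, THEN eq_refl])+
    have "finite ((\<lambda>(i, j). \<bar>slice h \<Phi> (real l * s) i j - \<phi> l i j\<bar>) ` ({1..int m} \<times> {1..int n}))"
      "(\<lambda>(i, j). \<bar>slice h \<Phi> (real l * s) i j - \<phi> l i j\<bar>) ` ({1..int m} \<times> {1..int n}) \<noteq> {}"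
      using m_pos n_pos by auto
    then show ?thesis
      unfolding grid_max_norm_def using est u[OF l] by (subst Max_le_iff) (auto simp: add.commute)
  qed
  ultimately show ?thesis using C0 by blast
qed

end
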